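(* Let $K$ and $L$ be strictly convex and $\mathrm{C}^1$ regular convex bodies in $\mathbb{E}^2$ with equal covariograms, that is, $g_K(x)=g_L(x)$ for all $x\in\mathbb{E}^2$. Then $L$ possesses a non-degenerate boundary arc whose translation or reflection lies in the boundary of $K$; i.e., there exist a non-degenerate arc $A\subseteq \mathrm{bd}\, L$ and a vector $a\in\mathbb{E}^2$ such that $A+a\subseteq\mathrm{bd}\,K$ or $-A+a\subseteq \mathrm{bd}\,K$.
   Context: A convex body in $\mathbb{E}^2$ is a compact convex set with nonempty interior; $\mathrm{bd}$ denotes the boundary. A convex body is strictly convex if its boundary contains no non-degenerate segment, and it is $\mathrm{C}^1$ regular if through each of its boundary points there passes precisely one supporting line. The covariogram of $K$ is $g_K(x):=V_2(K\cap(K+x))$, $x\in\mathbb{E}^2$, where $V_2$ is the two-dimensional Lebesgue measure. Reflection always means reflection in a point. A boundary arc is non-degenerate if it is a connected subset of the boundary with more than one point. *)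

theory Defs
  imports "HOL-Analysis.Analysis"
begin

definition convex_body :: "(real^2) set \<Rightarrow> bool" where
  "convex_body K \<longleftrightarrow> compact K \<and> convex K \<and> interior K \<noteq> {}"

definition strictly_convex :: "(real^2) set \<Rightarrow> bool" where
  "strictly_convex K \<longleftrightarrow> (\<forall>p q. p \<noteq> q \<longrightarrow> \<not> closed_segment p q \<subseteq> frontier K)"

definition supporting_line :: "(real^2) set \<Rightarrow> (real^2) set \<Rightarrow> bool" where
  "supporting_line K H \<longleftrightarrow>
     (\<exists>u c. u \<noteq> 0 \<and> H = {x. u \<bullet> x = c} \<and> K \<subseteq> {x. u \<bullet> x \<le> c} \<and> H \<inter> K \<noteq> {})"

definition C1_regular :: "(real^2) set \<Rightarrow> bool" where
  "C1_regular K \<longleftrightarrow> (\<forall>p\<in>frontier K. \<exists>!H. supporting_line K H \<and> p \<in> H)"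

definition covariogram :: "(real^2) set \<Rightarrow> real^2 \<Rightarrow> real" where
  "covariogram K x = measure lebesgue (K \<inter> (\<lambda>y. y + x) ` K)"

definition nondegenerate_boundary_arc :: "(real^2) set \<Rightarrow> (real^2) set \<Rightarrow> bool" where
  "nondegenerate_boundary_arc K A \<longleftrightarrow>
     A \<subseteq> frontier K \<and> connected A \<and> (\<exists>p\<in>A. \<exists>q\<in>A. p \<noteq> q)"

end

theory Submission
  imports Defs
begin

text \<open>A chord of a body with the vector \<open>x\<close> is a segment from \<open>a - x\<close> to \<open>a\<close> with both ends on the
  boundary. Strict convexity and smoothness give every non-zero interior vector \<open>x\<close> of the
  difference body exactly two chords. They are told apart by the sign \<open>cs\<close> of the angle
  between the outer normals at the two ends, and their heads are called \<open>pl x\<close> and \<open>mi x\<close>; the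
  two chords are opposite sides of an inscribed parallelogram. Up to a quarter turn,
  \<open>pl x - mi x\<close> is the gradient of the covariogram. Hence the parallelograms that belong to the same
  \<open>x\<close> in \<open>K\<close> and in \<open>L\<close> have the same side vectors and are translates of each other
  (\<open>twin_eq\<close>). The problem is to show that the translation does not depend on \<open>x\<close>.

  Fix \<open>p\<close> on the boundary of \<open>K\<close>. The mate of another boundary point \<open>z\<close> is the head \<open>q\<close> of the
  chord of \<open>L\<close> with the vector \<open>p - z\<close> and the same sign as the chord from \<open>z\<close> to \<open>p\<close>. If \<open>t\<close> is the
  vertex opposite to \<open>p\<close> in the parallelogram with the side from \<open>z\<close> to \<open>p\<close>, then the corresponding
  diagonals of \<open>K\<close> and of \<open>L\<close> have the same vector \<open>p - t\<close>. So \<open>q\<close> is also the mate of \<open>t\<close>, provided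
  that these diagonals bend the same way in both bodies; the bend is measured by \<open>diag\<close>. Passing
  from \<open>z\<close> to \<open>t\<close> strictly descends in the direction of the normal at \<open>p\<close>, and by compactness the
  descent ends at the antipode of \<open>p\<close>, the point where the tangent is parallel to that at \<open>p\<close>. All
  points therefore have the same mate, which means that the boundary of \<open>K\<close> without \<open>p\<close> is
  translated into the boundary of \<open>L\<close> (\<open>coherent_translate\<close>).

  It remains to find a point \<open>p\<close> for which the products of the two values of \<open>diag\<close> have a
  constant sign while \<open>z\<close> runs over the boundary on one side of \<open>p\<close>. The zeros of \<open>diag\<close> are the same
  for both bodies. Near a zero at which the other diagonal does not join antipodal points, \<open>diag\<close> is
  positive on one connected piece, negative on another, and takes both signs (\<open>diag_crossing\<close>). This
  holds for both bodies, so the product does not change its sign there (\<open>product_local_sign\<close>). If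
  both diagonals of the parallelogram join antipodal points, they are affine diameters of \<open>K\<close> with
  the same midpoint. So it suffices to find an affine diameter that shares its midpoint with
  no other one. The midpoint of an affine diameter moves in the direction of the tangents at
  its ends; the curve of midpoints therefore crosses itself transversally, and transversal
  crossings have length zero (\<open>null_transversal\<close>). Consequently the required diameter exists unless
  the midpoint is constant (\<open>simple_midpoint_or_symmetric\<close>), and in that case \<open>diag\<close> vanishes
  identically.

  If the product is everywhere non-negative, the boundary of \<open>L\<close> contains a translate of an arc of
  the boundary of \<open>K\<close>; if it is non-positive, the reflected body \<open>- L\<close> has the same covariogram and the opposite
  values of \<open>diag\<close>, and the translate of the arc is a reflected arc of the boundary of \<open>L\<close>.\<close>

section \<open>The area form of the plane\<close>

text \<open>The oriented area of the parallelogram spanned by two vectors.\<close>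
definition cr :: "real^2 \<Rightarrow> real^2 \<Rightarrow> real" where
  "cr a b = a$1 * b$2 - a$2 * b$1"

definition rot :: "real^2 \<Rightarrow> real^2" where
  "rot a = vector [- a$2, a$1]"

lemma inner_plane: "(x::real^2) \<bullet> y = x$1 * y$1 + x$2 * y$2"
  by (simp add: inner_vec_def sum_2)

lemma plane_eqI: "(x::real^2)$1 = y$1 \<Longrightarrow> x$2 = y$2 \<Longrightarrow> x = y"
  by (simp add: vec_eq_iff forall_2)

lemma cr_bilinear [simp]:
  "cr (a + b) c = cr a c + cr b c" "cr a (b + c) = cr a b + cr a c"
  "cr (a - b) c = cr a c - cr b c" "cr a (b - c) = cr a b - cr a c"
  "cr (- a) b = - cr a b" "cr a (- b) = - cr a b"
  "cr (r *\<^sub>R a) b = r * cr a b" "cr a (r *\<^sub>R b) = r * cr a b"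
  "cr a a = 0" "cr 0 b = 0" "cr a 0 = 0"
  by (simp_all add: cr_def algebra_simps)

lemma cr_swap: "cr b a = - cr a b"
  by (simp add: cr_def algebra_simps)

lemma rot_inner: "rot a \<bullet> b = cr a b"
  by (simp add: inner_plane rot_def cr_def algebra_simps)

lemma rot_eq_0 [simp]: "rot a = 0 \<longleftrightarrow> a = 0"
  by (auto simp: rot_def vec_eq_iff forall_2)

lemma continuous_cr [continuous_intros]:
  "continuous_on S f \<Longrightarrow> continuous_on S g \<Longrightarrow> continuous_on S (\<lambda>x. cr (f x) (g x))"
  unfolding cr_def by (intro continuous_intros)

lemma tendsto_cr [tendsto_intros]:
  "(f \<longlongrightarrow> a) F \<Longrightarrow> (g \<longlongrightarrow> b) F \<Longrightarrow> ((\<lambda>x. cr (f x) (g x)) \<longlongrightarrow> cr a b) F"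
  unfolding cr_def by (intro tendsto_intros)

lemma cr_Binet_Cauchy: "cr u v * cr x d = (x \<bullet> u) * (d \<bullet> v) - (x \<bullet> v) * (d \<bullet> u)"
  by (simp add: cr_def inner_plane algebra_simps)

lemma cr_eq_0_orthogonal:
  assumes "d \<noteq> 0" "d \<bullet> u = 0" "d \<bullet> v = 0"
  shows "cr u v = 0"
proof -
  have "cr u v * (d \<bullet> d) = (d \<bullet> u) * cr d v - (d \<bullet> v) * cr d u"
    by (simp add: cr_def inner_plane algebra_simps)
  then have "cr u v * (d \<bullet> d) = 0" using assms by simp
  then show ?thesis using assms by simp
qed

lemma cr_square_unit:
  assumes "norm u = 1" "norm v = 1"
  shows "(cr u v)\<^sup>2 + (u \<bullet> v)\<^sup>2 = 1"
proof -
  have "(cr u v)\<^sup>2 + (u \<bullet> v)\<^sup>2 = (u \<bullet> u) * (v \<bullet> v)"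
    by (simp add: cr_def inner_plane power2_eq_square algebra_simps)
  then show ?thesis using assms by (simp add: dot_square_norm)
qed

lemma unit_inner_eq_1:
  "norm u = 1 \<Longrightarrow> norm v = 1 \<Longrightarrow> u \<bullet> v = 1 \<Longrightarrow> u = (v::real^2)"
proof -
  assume "norm u = 1" "norm v = 1" "u \<bullet> v = 1"
  moreover have "(u - v) \<bullet> (u - v) = u \<bullet> u - 2 * (u \<bullet> v) + v \<bullet> v"
    by (simp only: inner_diff_left inner_diff_right inner_commute[of v u])
  ultimately have "(u - v) \<bullet> (u - v) = 0" by (simp only: dot_square_norm) simp
  then show "u = v" by simp
qed

lemma cr_eq_0_unit:
  assumes "norm u = 1" "norm v = 1" "cr u v = 0"
  shows "v = u \<or> v = - u"
proof -
  have "(u \<bullet> v)\<^sup>2 = 1" using cr_square_unit[OF assms(1,2)] assms(3) by simp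
  then have "u \<bullet> v = 1 \<or> u \<bullet> v = -1" by (simp add: power2_eq_1_iff)
  then show ?thesis
  proof
    assume "u \<bullet> v = 1" then show ?thesis using unit_inner_eq_1 assms by blast
  next
    assume "u \<bullet> v = -1" then have "(-u) \<bullet> v = 1" by simp
    then have "- u = v" by (intro unit_inner_eq_1) (use assms in auto)
    then show ?thesis by simp
  qed
qed

section \<open>Normals and contact points of an oval\<close>

text \<open>Continuity into a compact set is closedness of the graph. Normals, contact points and heads of
  chords below are selected by choice; this reduces their continuity to the fact that a limit
  still has the property that characterises the selected object.\<close>
lemma continuous_on_unique_limits:
  fixes f :: "'a::euclidean_space \<Rightarrow> 'b::euclidean_space"
  assumes T: "compact T" and fT: "f \<in> S \<rightarrow> T"
    and lim: "\<And>x l xs. (\<And>n. xs n \<in> S) \<Longrightarrow> x \<in> S \<Longrightarrow> xs \<longlonglongrightarrow> x \<Longrightarrow> (\<lambda>n. f (xs n)) \<longlonglongrightarrow> l \<Longrightarrow> l \<in> T \<Longrightarrow> l = f x"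
  shows "continuous_on S f"
proof -
  let ?G = "(\<lambda>x. (x, f x)) ` S"
  have "?G = closure ?G \<inter> (S \<times> T)"
  proof
    show "?G \<subseteq> closure ?G \<inter> (S \<times> T)"
    proof (rule Int_greatest)
      show "?G \<subseteq> closure ?G" by (rule closure_subset)
      show "?G \<subseteq> S \<times> T"
      proof
        fix z assume "z \<in> ?G"
        then obtain x where "x \<in> S" "z = (x, f x)" by blast
        moreover have "f x \<in> T" using Pi_mem[OF fT \<open>x \<in> S\<close>] .
        ultimately show "z \<in> S \<times> T" by simp
      qed
    qed
    show "closure ?G \<inter> (S \<times> T) \<subseteq> ?G"
    proof
      fix z assume z: "z \<in> closure ?G \<inter> (S \<times> T)"
      have "\<exists>g. (\<forall>n. g n \<in> ?G) \<and> g \<longlonglongrightarrow> z"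
        using IntD1[OF z] by (simp only: closure_sequential)
      then obtain g where g: "\<And>n. g n \<in> ?G" "g \<longlonglongrightarrow> z" by blast
      define xs where "xs n = fst (g n)" for n
      have xs: "xs n \<in> S" "g n = (xs n, f (xs n))" for n using g(1)[of n] by (auto simp: xs_def)
      have 1: "xs \<longlonglongrightarrow> fst z" unfolding xs_def using g(2) by (rule tendsto_fst)
      have 2: "(\<lambda>n. f (xs n)) \<longlonglongrightarrow> snd z" using tendsto_snd[OF g(2)] xs(2) by simp
      have "snd z = f (fst z)" using lim[OF xs(1) _ 1 2] z by auto
      moreover have "fst z \<in> S" using z by (auto simp: mem_Times_iff)
      ultimately show "z \<in> ?G" by (intro image_eqI[of _ _ "fst z"]) (simp_all add: prod_eq_iff)
    qed
  qed
  then have "closedin (top_of_set (S \<times> T)) ?G"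
    by (metis closedin_closed closed_closure inf_commute)
  then show ?thesis using continuous_closed_graph_eq[OF T fT] by simp
qed

locale oval =
  fixes K :: "(real^2) set"
  assumes body: "convex_body K" and strict: "strictly_convex K" and smooth: "C1_regular K"
begin

lemma compact_K: "compact K" and convex_K: "convex K" and interior_K: "interior K \<noteq> {}"
  using body by (auto simp: convex_body_def)

lemma closed_K: "closed K" using compact_K by (rule compact_imp_closed)

lemma frontier_subset: "frontier K \<subseteq> K" using closed_K by (rule frontier_subset_closed)

lemma frontier_iff: "p \<in> frontier K \<longleftrightarrow> p \<in> K \<and> p \<notin> interior K"
  using closed_K by (simp add: frontier_def)

lemma compact_frontier_K: "compact (frontier K)" using compact_K by (rule compact_frontier)

lemma support_at_frontier:
  assumes "p \<in> frontier K"
  shows "\<exists>u. norm u = 1 \<and> (\<forall>q\<in>K. u \<bullet> q \<le> u \<bullet> p)"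
proof -
  have "rel_interior K = interior K" using interior_K rel_interior_nonempty_interior by blast
  then obtain a where a: "a \<noteq> 0" "\<And>y. y \<in> K \<Longrightarrow> a \<bullet> p \<le> a \<bullet> y"
    using supporting_hyperplane_rel_boundary[OF convex_K, of p] assms frontier_iff by metis
  show ?thesis
    by (rule exI[of _ "- a /\<^sub>R norm a"]) (use a in \<open>auto simp: mult_left_mono\<close>)
qed

lemma interior_not_max:
  assumes "p \<in> interior K" "u \<noteq> 0"
  obtains q where "q \<in> K" "u \<bullet> p < u \<bullet> q"
proof -
  obtain e where e: "e > 0" "ball p e \<subseteq> K" using assms(1) mem_interior by blast
  define q where "q = p + (e / (2 * norm u)) *\<^sub>R u"
  have "dist p q < e" using e assms(2) by (simp add: q_def dist_norm)
  moreover have "u \<bullet> p < u \<bullet> q" using e assms(2) by (simp add: q_def inner_add_right)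
  ultimately show ?thesis using that e by auto
qed

lemma max_in_frontier:
  assumes "p \<in> K" "u \<noteq> 0" "\<And>q. q \<in> K \<Longrightarrow> u \<bullet> q \<le> u \<bullet> p"
  shows "p \<in> frontier K"
  using assms interior_not_max[of p u] frontier_iff by (metis not_less)

text \<open>At an interior point of a segment a supporting functional is constant along the segment, so that
  the whole segment would lie on the boundary.\<close>
lemma open_segment_interior:
  assumes "p \<in> K" "q \<in> K" "p \<noteq> q" "m \<in> open_segment p q"
  shows "m \<in> interior K"
proof (rule ccontr)
  assume m: "m \<notin> interior K"
  obtain t where t: "0 < t" "t < 1" "m = (1 - t) *\<^sub>R p + t *\<^sub>R q"
    using assms(4) by (auto simp: in_segment)
  have seg: "closed_segment p q \<subseteq> K" using convex_K assms by (simp add: convex_contains_segment)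
  then have "m \<in> frontier K" using m assms(4) frontier_iff open_closed_segment by blast
  then obtain u where u: "norm u = 1" "\<forall>y\<in>K. u \<bullet> y \<le> u \<bullet> m" using support_at_frontier by blast
  have "u \<bullet> m = (1-t) * (u \<bullet> p) + t * (u \<bullet> q)" by (simp add: t inner_add_right)
  moreover have "(1-t) * (u \<bullet> p) \<le> (1-t) * (u \<bullet> m)" "t * (u \<bullet> q) \<le> t * (u \<bullet> m)"
    using u(2) assms t by (auto intro!: mult_left_mono)
  moreover have "(1-t) * (u \<bullet> m) + t * (u \<bullet> m) = u \<bullet> m" by (simp add: algebra_simps)
  ultimately have "(1-t) * (u \<bullet> p) = (1-t) * (u \<bullet> m)" "t * (u \<bullet> q) = t * (u \<bullet> m)" by linarith+
  then have pq: "u \<bullet> p = u \<bullet> m" "u \<bullet> q = u \<bullet> m" using t by auto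
  have "closed_segment p q \<subseteq> frontier K"
  proof
    fix y assume y: "y \<in> closed_segment p q"
    then obtain s where "y = (1-s) *\<^sub>R p + s *\<^sub>R q" by (auto simp: in_segment)
    then have "u \<bullet> y = u \<bullet> m" by (simp add: inner_add_right pq) (simp add: algebra_simps)
    then show "y \<in> frontier K" using u y seg by (intro max_in_frontier[of y u]) auto
  qed
  then show False using strict assms(3) by (auto simp: strictly_convex_def)
qed

lemma max_unique:
  assumes "p \<in> K" "q \<in> K" "u \<noteq> 0" "\<And>y. y \<in> K \<Longrightarrow> u \<bullet> y \<le> u \<bullet> p" "u \<bullet> q = u \<bullet> p"
  shows "q = p"
proof (rule ccontr)
  assume ne: "q \<noteq> p"
  define m where "m = midpoint q p"
  have "m \<in> interior K" by (rule open_segment_interior[of q p]) (use assms ne in \<open>auto simp: m_def\<close>)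
  then obtain y where "y \<in> K" "u \<bullet> m < u \<bullet> y" using interior_not_max assms(3) by blast
  moreover have "u \<bullet> m = u \<bullet> p" using assms(5) by (simp add: m_def midpoint_def inner_add_right)
  ultimately show False using assms(4) by fastforce
qed

lemma max_exists: "\<exists>p\<in>K. \<forall>q\<in>K. u \<bullet> q \<le> u \<bullet> p"
proof -
  have "continuous_on K (\<lambda>q. u \<bullet> q)" by (intro continuous_intros)
  moreover have "K \<noteq> {}" using interior_K interior_subset by fastforce
  ultimately show ?thesis using continuous_attains_sup[OF compact_K] by blast
qed

text \<open>The point at which the supporting line with the outer normal \<open>u\<close> touches \<open>K\<close>.\<close>
definition contact :: "real^2 \<Rightarrow> real^2" where
  "contact u = (SOME p. p \<in> K \<and> (\<forall>q\<in>K. u \<bullet> q \<le> u \<bullet> p))"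

lemma contact_K: "contact u \<in> K" and contact_max: "q \<in> K \<Longrightarrow> u \<bullet> q \<le> u \<bullet> contact u"
proof -
  have "contact u \<in> K \<and> (\<forall>q\<in>K. u \<bullet> q \<le> u \<bullet> contact u)"
    unfolding contact_def by (rule someI_ex) (use max_exists in blast)
  then show "contact u \<in> K" "q \<in> K \<Longrightarrow> u \<bullet> q \<le> u \<bullet> contact u" by auto
qed

lemma contact_eqI: "u \<noteq> 0 \<Longrightarrow> p \<in> K \<Longrightarrow> (\<And>q. q \<in> K \<Longrightarrow> u \<bullet> q \<le> u \<bullet> p) \<Longrightarrow> contact u = p"
  using max_unique[of p "contact u" u] contact_K contact_max by (simp add: antisym)

lemma contact_frontier: "u \<noteq> 0 \<Longrightarrow> contact u \<in> frontier K"
  using max_in_frontier contact_K contact_max by blast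

text \<open>Two unit normals of the same supporting line agree up to sign, and opposite ones would squeeze \<open>K\<close>
  into a line.\<close>
lemma normal_unique:
  assumes p: "p \<in> frontier K" and u: "norm u = 1" "\<And>q. q \<in> K \<Longrightarrow> u \<bullet> q \<le> u \<bullet> p"
    and v: "norm v = 1" "\<And>q. q \<in> K \<Longrightarrow> v \<bullet> q \<le> v \<bullet> p"
  shows "u = v"
proof -
  have pK: "p \<in> K" using p frontier_subset by blast
  have sl: "supporting_line K {x. w \<bullet> x = w \<bullet> p} \<and> p \<in> {x. w \<bullet> x = w \<bullet> p}"
    if w: "norm w = 1" "\<And>q. q \<in> K \<Longrightarrow> w \<bullet> q \<le> w \<bullet> p" for w
  proof -
    have "w \<noteq> 0" using w(1) by auto
    then show ?thesis
      unfolding supporting_line_def using w(2) pK by (intro conjI exI[of _ w] exI[of _ "w \<bullet> p"]) auto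
  qed
  have "\<exists>!H. supporting_line K H \<and> p \<in> H" using smooth p by (auto simp: C1_regular_def)
  then obtain H0 where "\<forall>H. supporting_line K H \<and> p \<in> H \<longrightarrow> H = H0" unfolding Ex1_def by blast
  then have H0: "H = H0" if "supporting_line K H \<and> p \<in> H" for H using that by blast
  have eq: "{x. u \<bullet> x = u \<bullet> p} = {x. v \<bullet> x = v \<bullet> p}"
    by (rule trans[OF H0[OF sl[OF u(1,2)]] H0[OF sl[OF v(1,2)], symmetric]])
  have "cr u v = 0"
  proof -
    have "u \<bullet> (p + rot u) = u \<bullet> p" by (simp add: inner_add_right inner_commute[of u] rot_inner)
    then have "v \<bullet> (p + rot u) = v \<bullet> p" using eq by blast
    then show ?thesis by (simp add: inner_add_right inner_commute[of v] rot_inner)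
  qed
  then consider "v = u" | "v = - u" using cr_eq_0_unit[OF u(1) v(1)] by blast
  then show ?thesis
  proof cases
    case 2
    obtain m where m: "m \<in> interior K" using interior_K by blast
    have "u \<noteq> 0" using u by auto
    then obtain q where q: "q \<in> K" "u \<bullet> m < u \<bullet> q" using interior_not_max m by blast
    have eq: "u \<bullet> y = u \<bullet> p" if "y \<in> K" for y using u(2)[OF that] v(2)[OF that] 2 by simp
    have "m \<in> K" using m interior_subset by blast
    then show ?thesis using eq[of m] eq[of q] q by simp
  qed simp
qed

text \<open>The outer unit normal.\<close>
definition nrm :: "real^2 \<Rightarrow> real^2" where
  "nrm p = (SOME u. norm u = 1 \<and> (\<forall>q\<in>K. u \<bullet> q \<le> u \<bullet> p))"

lemma nrm_props:
  assumes "p \<in> frontier K"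
  shows norm_nrm: "norm (nrm p) = 1" and nrm_max: "q \<in> K \<Longrightarrow> nrm p \<bullet> q \<le> nrm p \<bullet> p"
proof -
  have *: "norm (nrm p) = 1 \<and> (\<forall>q\<in>K. nrm p \<bullet> q \<le> nrm p \<bullet> p)"
    unfolding nrm_def by (rule someI_ex) (rule support_at_frontier[OF assms])
  show "norm (nrm p) = 1" using * by simp
  show "q \<in> K \<Longrightarrow> nrm p \<bullet> q \<le> nrm p \<bullet> p" using * by simp
qed

lemma nrm_eqI: "p \<in> frontier K \<Longrightarrow> norm u = 1 \<Longrightarrow> (\<And>q. q \<in> K \<Longrightarrow> u \<bullet> q \<le> u \<bullet> p) \<Longrightarrow> nrm p = u"
  by (rule normal_unique[of p "nrm p" u]) (simp_all add: nrm_props)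

lemma nrm_nz: "p \<in> frontier K \<Longrightarrow> nrm p \<noteq> 0" using norm_nrm by force

lemma nrm_contact: "norm u = 1 \<Longrightarrow> nrm (contact u) = u"
  by (rule nrm_eqI) (auto intro!: contact_frontier contact_max)

lemma contact_nrm: "p \<in> frontier K \<Longrightarrow> contact (nrm p) = p"
  by (rule contact_eqI) (use nrm_nz nrm_max frontier_subset in auto)

lemma nrm_strict:
  assumes "p \<in> frontier K" "q \<in> K" "q \<noteq> p"
  shows "nrm p \<bullet> (q - p) < 0"
proof -
  have "nrm p \<bullet> q \<le> nrm p \<bullet> p" using assms nrm_max by blast
  moreover have "nrm p \<bullet> q \<noteq> nrm p \<bullet> p"
    using max_unique[of p q "nrm p"] assms nrm_nz[OF assms(1)] nrm_max[OF assms(1)] frontier_subset by blast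
  ultimately show ?thesis by (simp add: inner_diff_right)
qed

lemma nrm_inj: "p \<in> frontier K \<Longrightarrow> q \<in> frontier K \<Longrightarrow> nrm p = nrm q \<Longrightarrow> p = q"
  by (metis contact_nrm)

lemma continuous_nrm: "continuous_on (frontier K) nrm"
proof (rule continuous_on_unique_limits)
  show "compact (sphere (0::real^2) 1)" by simp
  show "nrm \<in> frontier K \<rightarrow> sphere 0 1" using norm_nrm by auto
next
  fix x l xs assume xs: "\<And>n. xs n \<in> frontier K" "x \<in> frontier K" "xs \<longlonglongrightarrow> x" "(\<lambda>n. nrm (xs n)) \<longlonglongrightarrow> l" "l \<in> sphere 0 1"
  have "l \<bullet> q \<le> l \<bullet> x" if "q \<in> K" for q
    by (rule LIMSEQ_le[of "\<lambda>n. nrm (xs n) \<bullet> q" _ "\<lambda>n. nrm (xs n) \<bullet> xs n"])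
      (use xs that nrm_max in \<open>auto intro!: tendsto_intros\<close>)
  then show "l = nrm x" using nrm_eqI[OF xs(2), of l] xs(5) by auto
qed

lemma continuous_contact: "continuous_on (sphere 0 1) contact"
proof (rule continuous_on_unique_limits)
  show "compact (frontier K)" by (rule compact_frontier_K)
  have "u \<noteq> 0" if "norm u = 1" for u :: "real^2" using that by auto
  then show "contact \<in> sphere 0 1 \<rightarrow> frontier K" using contact_frontier by auto
next
  fix x l xs assume xs: "\<And>n. xs n \<in> sphere (0::real^2) 1" "x \<in> sphere 0 1" "xs \<longlonglongrightarrow> x" "(\<lambda>n. contact (xs n)) \<longlonglongrightarrow> l" "l \<in> frontier K"
  have "x \<bullet> q \<le> x \<bullet> l" if "q \<in> K" for q
    by (rule LIMSEQ_le[of "\<lambda>n. xs n \<bullet> q" _ "\<lambda>n. xs n \<bullet> contact (xs n)"])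
      (use xs that contact_max in \<open>auto intro!: tendsto_intros\<close>)
  moreover have "x \<noteq> 0" using xs(2) by auto
  ultimately show "l = contact x" using contact_eqI[of x l] xs(5) frontier_subset by auto
qed

lemma tendsto_nrm:
  assumes "xs \<longlonglongrightarrow> x" "\<And>n. xs n \<in> frontier K" "x \<in> frontier K"
  shows "(\<lambda>n. nrm (xs n)) \<longlonglongrightarrow> nrm x"
  using continuous_nrm assms unfolding continuous_on_sequentially comp_def by blast

text \<open>A ray that avoided the interior would be separated from \<open>K\<close> by a line through \<open>p\<close>; by smoothness
  this is the tangent, so the ray could not point below it.\<close>
lemma inward_direction:
  assumes p: "p \<in> frontier K" and v: "nrm p \<bullet> v < 0"
  shows "\<exists>t0>0. \<forall>t. 0 < t \<and> t \<le> t0 \<longrightarrow> p + t *\<^sub>R v \<in> interior K"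
proof -
  have pK: "p \<in> K" using p frontier_subset by blast
  let ?R = "(\<lambda>t. p + t *\<^sub>R v) ` {0<..}"
  have "interior K \<inter> ?R \<noteq> {}"
  proof
    assume e: "interior K \<inter> ?R = {}"
    have "?R = (\<lambda>y. p + y) ` (\<lambda>t. t *\<^sub>R v) ` {0<..}" by (simp add: image_image)
    then have "convex ?R"
      by (metis convex_linear_image convex_real_interval(3) convex_translation linear_scaleR_left)
    moreover have "?R \<noteq> {}" by auto
    ultimately obtain a b where ab: "a \<noteq> 0" "\<forall>x\<in>interior K. a \<bullet> x \<le> b" "\<forall>x\<in>?R. b \<le> a \<bullet> x"
      using separating_hyperplane_sets[OF convex_interior[OF convex_K] _ interior_K _ e] by blast
    have "closure (interior K) \<subseteq> {x. a \<bullet> x \<le> b}"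
      by (rule closure_minimal) (use ab(2) in \<open>auto simp: closed_halfspace_le\<close>)
    then have aK: "a \<bullet> x \<le> b" if "x \<in> K" for x
      using that convex_closure_interior[OF convex_K interior_K] closed_K by auto
    have lim: "(\<lambda>n. a \<bullet> (p + (1 / real (Suc n)) *\<^sub>R v)) \<longlonglongrightarrow> a \<bullet> (p + 0 *\<^sub>R v)"
      by (intro tendsto_intros lim_1_over_n[THEN LIMSEQ_Suc] )
    have "b \<le> a \<bullet> (p + 0 *\<^sub>R v)"
      by (rule LIMSEQ_le_const[OF lim]) (use ab(3) in auto)
    then have bp: "b = a \<bullet> p" using aK[OF pK] by simp
    have "a \<bullet> (p + 1 *\<^sub>R v) \<ge> b" using ab(3) by (meson greaterThan_iff imageI zero_less_one)
    then have av: "a \<bullet> v \<ge> 0" using bp by (simp add: inner_add_right)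
    have "nrm p = a /\<^sub>R norm a"
      by (rule nrm_eqI[OF p]) (use ab(1) aK bp in \<open>auto simp: mult_left_mono\<close>)
    then have "nrm p \<bullet> v \<ge> 0" using av by simp
    then show False using v by simp
  qed
  then obtain t0 where t0: "t0 > 0" "p + t0 *\<^sub>R v \<in> interior K" by auto
  show ?thesis
  proof (intro exI[of _ t0] conjI allI impI t0(1))
    fix t assume t: "0 < t \<and> t \<le> t0"
    have "p - (t / t0) *\<^sub>R (p - (p + t0 *\<^sub>R v)) \<in> interior K"
      using mem_interior_convex_shrink[OF convex_K t0(2) pK, of "t/t0"] t t0 by (simp add: divide_le_eq)
    then show "p + t *\<^sub>R v \<in> interior K" using t0(1) by simp
  qed
qed

end

section \<open>Chords with a given vector\<close>

lemma mem_translate_iff: "q \<in> (\<lambda>y. y + x) ` A \<longleftrightarrow> q - x \<in> (A :: 'a::ab_group_add set)"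
proof
  assume "q - x \<in> A"
  then show "q \<in> (\<lambda>y. y + x) ` A" by (intro image_eqI[of _ _ "q - x"]) simp_all
qed auto

context oval begin

text \<open>The vector \<open>x\<close> leads from the tail \<open>a - x\<close> to the head \<open>a\<close>.\<close>
definition chord :: "real^2 \<Rightarrow> real^2 \<Rightarrow> bool" where
  "chord x a \<longleftrightarrow> a \<in> frontier K \<and> a - x \<in> frontier K"

text \<open>The sine of the angle from the normal at the head to the normal at the tail. It vanishes when the
  chord is an affine diameter, that is, when the tangents at its ends are parallel.\<close>
definition cs :: "real^2 \<Rightarrow> real^2 \<Rightarrow> real" where
  "cs x a = cr (nrm a) (nrm (a - x))"

lemma chord_normals:
  assumes "chord x a" "x \<noteq> 0"
  shows "x \<bullet> nrm a > 0" "x \<bullet> nrm (a - x) < 0"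
  using nrm_strict[of a "a - x"] nrm_strict[of "a - x" a] assms frontier_subset
  by (auto simp: chord_def inner_commute)

lemma two_chords_normals:
  assumes "chord x a" "chord x b" "a \<noteq> b"
  shows "(b - a) \<bullet> nrm a < 0" "(b - a) \<bullet> nrm (a - x) < 0" "(b - a) \<bullet> nrm b > 0" "(b - a) \<bullet> nrm (b - x) > 0"
  using nrm_strict[of a b] nrm_strict[of b a] nrm_strict[of "a - x" "b - x"] nrm_strict[of "b - x" "a - x"] assms frontier_subset
  by (auto simp: chord_def inner_commute inner_diff_left inner_diff_right)

text \<open>The Binet--Cauchy identity turns each product into a sum of products of inner products whose signs
  are known from the supporting lines at the four ends.\<close>
lemma two_chords_signs:
  assumes "chord x a" "chord x b" "a \<noteq> b" "x \<noteq> 0"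
  shows "cs x b * cr x (b - a) > 0" "cs x a * cr x (b - a) < 0"
    "cr (nrm b) (nrm a) * cr x (b - a) < 0" "cr (nrm (b - x)) (nrm (a - x)) * cr x (b - a) > 0"
proof -
  note s = two_chords_normals[OF assms(1-3)] chord_normals[OF assms(1,4)] chord_normals[OF assms(2,4)]
  show "cs x b * cr x (b - a) > 0" "cs x a * cr x (b - a) < 0"
    "cr (nrm b) (nrm a) * cr x (b - a) < 0" "cr (nrm (b - x)) (nrm (a - x)) * cr x (b - a) > 0"
    unfolding cs_def cr_Binet_Cauchy using s
    by (smt (verit) mult_neg_neg mult_pos_neg mult_pos_pos mult_neg_pos)+
qed

lemma chord_unique_sign:
  assumes "chord x a" "chord x b" "x \<noteq> 0" "cs x a * cs x b \<ge> 0"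
  shows "a = b"
proof (rule ccontr)
  assume "a \<noteq> b"
  from two_chords_signs(1,2)[OF assms(1,2) this assms(3)] assms(4) show False
    by (smt (verit) mult_less_0_iff zero_less_mult_iff)
qed

text \<open>The lens \<open>K \<inter> (K + x)\<close> has interior points, so that the covariogram is positive at \<open>x\<close>.\<close>
definition lens :: "real^2 \<Rightarrow> bool" where
  "lens x \<longleftrightarrow> (\<exists>q. q \<in> interior K \<and> q - x \<in> interior K)"

text \<open>Unless the normals at the ends are opposite, the negative of their sum points into the interior at
  both ends.\<close>
lemma cs_nonzero_imp_lens:
  assumes c: "chord x a" and "x \<noteq> 0" and cs: "cs x a \<noteq> 0"
  shows "lens x"
proof -
  let ?u = "nrm a" and ?w = "nrm (a - x)"
  have f: "a \<in> frontier K" "a - x \<in> frontier K" using c by (auto simp: chord_def)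
  have n: "norm ?u = 1" "norm ?w = 1" using norm_nrm f by auto
  have "?u \<bullet> ?w \<noteq> -1"
  proof
    assume "?u \<bullet> ?w = -1"
    then have "(- ?u) \<bullet> ?w = 1" by simp
    then have "- ?u = ?w" using unit_inner_eq_1[of "- ?u" ?w] n by simp
    then show False using cs by (simp add: cs_def flip: \<open>- ?u = ?w\<close>)
  qed
  moreover have "\<bar>?u \<bullet> ?w\<bar> \<le> 1" using Cauchy_Schwarz_ineq2[of ?u ?w] n by simp
  ultimately have gt: "?u \<bullet> ?w > -1" by linarith
  define v where "v = - (?u + ?w)"
  have "?u \<bullet> ?u = 1" "?w \<bullet> ?w = 1" using n by (simp_all add: dot_square_norm)
  then have "?u \<bullet> v < 0" "?w \<bullet> v < 0"
    using gt by (simp_all add: v_def inner_add_right inner_diff_right inner_commute[of ?w ?u])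
  then obtain s t where st: "s > 0" "\<forall>r. 0 < r \<and> r \<le> s \<longrightarrow> a + r *\<^sub>R v \<in> interior K"
      "t > 0" "\<forall>r. 0 < r \<and> r \<le> t \<longrightarrow> (a - x) + r *\<^sub>R v \<in> interior K"
    using inward_direction[OF f(1)] inward_direction[OF f(2)] by blast
  define r where "r = min s t"
  have "r > 0" "r \<le> s" "r \<le> t" using st by (auto simp: r_def)
  then have "a + r *\<^sub>R v \<in> interior K" "(a + r *\<^sub>R v) - x \<in> interior K"
    using st(2,4) by (simp_all add: algebra_simps)
  then show ?thesis by (auto simp: lens_def)
qed

text \<open>The functional \<open>r\<close> takes the same value at \<open>a\<close> and \<open>a - x\<close>. If one of these points were interior
  to \<open>K\<close>, the other one would maximise \<open>r\<close> on \<open>K\<close>, and then both would be maximisers, against strict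
  convexity.\<close>
lemma lens_max_chord:
  assumes x: "x \<noteq> 0" and r: "r \<noteq> 0" "r \<bullet> x = 0"
    and a: "a \<in> K" "a - x \<in> K" "\<And>q. q \<in> K \<Longrightarrow> q - x \<in> K \<Longrightarrow> r \<bullet> q \<le> r \<bullet> a"
  shows "chord x a"
proof -
  have shift: "\<exists>t>0. t \<le> 1 \<and> b + t *\<^sub>R v \<in> K" if b: "b \<in> interior K" for b v
  proof -
    obtain e where e: "e > 0" "ball b e \<subseteq> K" using b mem_interior by blast
    define t where "t = min 1 (e / (2 * norm v + 1))"
    have pos: "2 * norm v + 1 > 0" by (simp add: add_nonneg_pos)
    have t: "t > 0" "t \<le> 1" using e pos by (auto simp: t_def)
    have "t \<le> e / (2 * norm v + 1)" by (simp add: t_def)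
    then have "t * (2 * norm v + 1) \<le> e" using pos by (simp add: le_divide_eq)
    moreover have "t * (2 * norm v + 1) = 2 * (t * norm v) + t" by (simp add: algebra_simps)
    moreover have "t * norm v \<ge> 0" using t by simp
    ultimately have "t * norm v < e" using t by linarith
    then have "b + t *\<^sub>R v \<in> ball b e" using t by (simp add: dist_norm)
    then show ?thesis using e t by blast
  qed
  have step: "c + t *\<^sub>R (y - c) \<in> K" if "c \<in> K" "y \<in> K" "0 < t" "t \<le> 1" for c y t
    using convexD_alt[OF convex_K that(1,2), of t] that by (simp add: algebra_simps)
  have "a \<notin> interior K"
  proof
    assume i: "a \<in> interior K"
    have le: "r \<bullet> y \<le> r \<bullet> (a - x)" if y: "y \<in> K" for y
    proof (rule ccontr)
      assume *: "\<not> ?thesis"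
      obtain t where t: "t > 0" "t \<le> 1" "a + t *\<^sub>R (y - (a - x)) \<in> K" using shift[OF i] by blast
      have "(a - x) + t *\<^sub>R (y - (a - x)) \<in> K" using step[OF a(2) y t(1,2)] .
      then have "a + t *\<^sub>R (y - (a - x)) - x \<in> K" by (simp add: add_diff_eq diff_add_eq)
      then have "r \<bullet> (a + t *\<^sub>R (y - (a - x))) \<le> r \<bullet> a" by (rule a(3)[OF t(3)])
      then have "t * (r \<bullet> (y - (a - x))) \<le> 0" by (simp add: inner_add_right)
      then show False using * t by (simp add: inner_diff_right mult_le_0_iff)
    qed
    have "r \<bullet> a = r \<bullet> (a - x)" using r(2) by (simp add: inner_diff_right)
    with le have "a = a - x" by (rule max_unique[OF a(2,1) r(1)])
    then show False using x by simp
  qed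
  moreover have "a - x \<notin> interior K"
  proof
    assume i: "a - x \<in> interior K"
    have le: "r \<bullet> y \<le> r \<bullet> a" if y: "y \<in> K" for y
    proof (rule ccontr)
      assume *: "\<not> ?thesis"
      obtain t where t: "t > 0" "t \<le> 1" "(a - x) + t *\<^sub>R (y - a) \<in> K" using shift[OF i] by blast
      have "a + t *\<^sub>R (y - a) \<in> K" using step[OF a(1) y t(1,2)] .
      moreover have "a + t *\<^sub>R (y - a) - x \<in> K" using t(3) by (simp add: add_diff_eq diff_add_eq)
      ultimately have "r \<bullet> (a + t *\<^sub>R (y - a)) \<le> r \<bullet> a" by (rule a(3))
      then have "t * (r \<bullet> (y - a)) \<le> 0" by (simp add: inner_add_right)
      then show False using * t by (simp add: inner_diff_right mult_le_0_iff)
    qed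
    have "r \<bullet> (a - x) = r \<bullet> a" using r(2) by (simp add: inner_diff_right)
    with le have "a - x = a" by (rule max_unique[OF a(1,2) r(1)])
    then show False using x by simp
  qed
  ultimately show ?thesis using a frontier_iff by (auto simp: chord_def)
qed

lemma compact_lens: "compact (K \<inter> (\<lambda>q. q + x) ` K)"
  by (simp add: compact_Int compact_K add.commute[of _ x] compact_translation)

lemma lens_set_iff: "q \<in> K \<inter> (\<lambda>q. q + x) ` K \<longleftrightarrow> q \<in> K \<and> q - x \<in> K"
  by (simp add: mem_translate_iff)

text \<open>The heads are the extreme points of the lens in the two directions orthogonal to \<open>x\<close>.\<close>
lemma lens_imp_chords:
  assumes x: "x \<noteq> 0" and l: "lens x"
  shows "\<exists>a b. chord x a \<and> chord x b \<and> cs x a > 0 \<and> cs x b < 0"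
proof -
  obtain m where m: "m \<in> interior K" "m - x \<in> interior K" using l by (auto simp: lens_def)
  let ?L = "K \<inter> (\<lambda>q. q + x) ` K"
  have ne: "?L \<noteq> {}" using m interior_subset lens_set_iff by blast
  have cont: "continuous_on ?L (\<lambda>q. rot x \<bullet> q)" by (intro continuous_intros)
  obtain a where a: "a \<in> ?L" "\<And>q. q \<in> ?L \<Longrightarrow> rot x \<bullet> q \<le> rot x \<bullet> a"
    using continuous_attains_sup[OF compact_lens ne cont] by blast
  obtain b where b: "b \<in> ?L" "\<And>q. q \<in> ?L \<Longrightarrow> rot x \<bullet> b \<le> rot x \<bullet> q"
    using continuous_attains_inf[OF compact_lens ne cont] by blast
  have ca: "chord x a"
    by (rule lens_max_chord[OF x, of "rot x"]) (use a x lens_set_iff in \<open>auto simp: rot_inner\<close>)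
  have cb: "chord x b"
    by (rule lens_max_chord[OF x, of "- rot x"]) (use b x lens_set_iff in \<open>auto simp: rot_inner\<close>)
  have "open (interior K \<inter> (\<lambda>q. q + x) ` interior K)"
    by (simp add: open_Int add.commute[of _ x] open_translation)
  moreover have "m \<in> interior K \<inter> (\<lambda>q. q + x) ` interior K"
    using m by (auto intro!: image_eqI[of _ _ "m - x"])
  ultimately obtain e where e: "e > 0" "ball m e \<subseteq> interior K \<inter> (\<lambda>q. q + x) ` interior K"
    by (rule openE)
  have sub: "ball m e \<subseteq> ?L"
    by (rule order_trans[OF e(2)]) (intro Int_mono image_mono interior_subset)
  define q where "q = m + (e / (2 * norm (rot x))) *\<^sub>R rot x"
  have rx: "norm (rot x) > 0" using x by simp
  have "q \<in> ball m e" using e rx by (simp add: q_def dist_norm)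
  then have "rot x \<bullet> q \<le> rot x \<bullet> a" using sub a by blast
  moreover have "rot x \<bullet> b \<le> rot x \<bullet> m" using sub b e by (meson centre_in_ball subsetD)
  moreover have "rot x \<bullet> m < rot x \<bullet> q"
  proof -
    have "rot x \<bullet> q = rot x \<bullet> m + (e / (2 * norm (rot x))) * (rot x \<bullet> rot x)"
      by (simp add: q_def inner_add_right)
    moreover have "(e / (2 * norm (rot x))) * (rot x \<bullet> rot x) > 0"
      using e rx x by (intro mult_pos_pos) auto
    ultimately show ?thesis by linarith
  qed
  ultimately have lt: "cr x (a - b) > 0" by (simp add: rot_inner)
  then have "a \<noteq> b" by auto
  then have "b \<noteq> a" by auto
  note sg = two_chords_signs(1,2)[OF cb ca this x]
  have "cs x a > 0" by (rule zero_less_mult_pos2[OF sg(1) lt])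
  moreover have "cs x b < 0" using sg(2) lt mult_nonneg_nonneg[of "cs x b" "cr x (a - b)"] by linarith
  ultimately show ?thesis using ca cb by blast
qed

lemma covariogram_pos_iff: "covariogram K x > 0 \<longleftrightarrow> lens x"
proof -
  let ?L = "K \<inter> (\<lambda>q. q + x) ` K"
  have conv: "convex ?L"
    by (simp add: convex_Int convex_K add.commute[of _ x] convex_translation)
  have lm: "?L \<in> lmeasurable" using compact_lens by (rule lmeasurable_compact)
  have int: "interior ?L = interior K \<inter> (\<lambda>q. q + x) ` interior K"
    by (simp add: add.commute[of _ x] interior_translation)
  have "lens x \<longleftrightarrow> interior ?L \<noteq> {}"
    unfolding int lens_def ex_in_conv[symmetric] by (simp add: mem_translate_iff)
  moreover have "measure lebesgue ?L > 0 \<longleftrightarrow> \<not> negligible ?L"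
    using negligible_iff_measure0[OF lm] measure_nonneg[of lebesgue ?L] by linarith
  ultimately show ?thesis
    unfolding covariogram_def using negligible_convex_interior[OF conv] by simp
qed

lemma lens_iff_chord: "x \<noteq> 0 \<Longrightarrow> chord x a \<Longrightarrow> lens x \<longleftrightarrow> cs x a \<noteq> 0"
proof
  assume x: "x \<noteq> 0" "chord x a" and "lens x"
  then obtain b where b: "chord x b" "cs x b > 0" using lens_imp_chords[of x] by auto
  show "cs x a \<noteq> 0" using chord_unique_sign[OF x(2) b(1) x(1)] b(2) by auto
next
  assume "x \<noteq> 0" "chord x a" "cs x a \<noteq> 0"
  then show "lens x" using cs_nonzero_imp_lens by simp
qed

lemma cs_zero_antipodal: "x \<noteq> 0 \<Longrightarrow> chord x a \<Longrightarrow> cs x a = 0 \<Longrightarrow> nrm (a - x) = - nrm a"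
  using cr_eq_0_unit[of "nrm a" "nrm (a - x)"] nrm_inj[of a "a - x"]
  by (auto simp: chord_def cs_def norm_nrm)

lemma open_lens: "open {x. lens x}"
proof -
  have "{x. lens x} = (\<Union>q\<in>interior K. {x. q - x \<in> interior K})"
    by (auto simp: lens_def)
  moreover have "open {x. q - x \<in> interior K}" for q
    using continuous_open_preimage[of UNIV "\<lambda>x. q - x" "interior K"]
    by (simp add: vimage_def continuous_intros)
  ultimately show ?thesis by auto
qed

text \<open>The heads of the two chords with the vector \<open>x\<close>. They are meaningful for \<open>x\<close> different from 0 with
  \<open>lens x\<close>.\<close>
definition pl :: "real^2 \<Rightarrow> real^2" where "pl x = (SOME a. chord x a \<and> cs x a > 0)"
definition mi :: "real^2 \<Rightarrow> real^2" where "mi x = (SOME a. chord x a \<and> cs x a < 0)"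

lemma pl_mi:
  assumes "x \<noteq> 0" "lens x"
  shows "chord x (pl x)" "cs x (pl x) > 0" "chord x (mi x)" "cs x (mi x) < 0"
proof -
  have "chord x (pl x) \<and> cs x (pl x) > 0" "chord x (mi x) \<and> cs x (mi x) < 0"
    unfolding pl_def mi_def by (rule someI_ex, use lens_imp_chords[OF assms] in blast)+
  then show "chord x (pl x)" "cs x (pl x) > 0" "chord x (mi x)" "cs x (mi x) < 0" by auto
qed

lemma pl_eqI: "x \<noteq> 0 \<Longrightarrow> chord x a \<Longrightarrow> cs x a > 0 \<Longrightarrow> pl x = a"
  using pl_mi[of x] chord_unique_sign[of x a "pl x"] cs_nonzero_imp_lens[of x a] by auto

lemma mi_eqI: "x \<noteq> 0 \<Longrightarrow> chord x a \<Longrightarrow> cs x a < 0 \<Longrightarrow> mi x = a"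
  using pl_mi[of x] chord_unique_sign[of x a "mi x"] cs_nonzero_imp_lens[of x a] by (auto simp: zero_le_mult_iff)

lemma cr_pl_mi: "x \<noteq> 0 \<Longrightarrow> lens x \<Longrightarrow> cr x (pl x - mi x) > 0"
  using two_chords_signs(1)[of x "mi x" "pl x"] pl_mi[of x]
  by (cases "mi x = pl x") (auto simp: zero_less_mult_iff)

lemma tendsto_chord:
  assumes "xs \<longlonglongrightarrow> x" "as \<longlonglongrightarrow> a" "\<And>n. chord (xs n) (as n)"
  shows "chord x a" "(\<lambda>n. cs (xs n) (as n)) \<longlonglongrightarrow> cs x a"
proof -
  have c: "closed (frontier K)" by simp
  have 1: "a \<in> frontier K" using closed_sequentially[OF c _ assms(2)] assms(3) by (auto simp: chord_def)
  have l: "(\<lambda>n. as n - xs n) \<longlonglongrightarrow> a - x" using assms by (intro tendsto_intros)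
  have 2: "a - x \<in> frontier K" using closed_sequentially[OF c _ l] assms(3) by (auto simp: chord_def)
  show "chord x a" using 1 2 by (simp add: chord_def)
  show "(\<lambda>n. cs (xs n) (as n)) \<longlonglongrightarrow> cs x a"
    unfolding cs_def by (intro tendsto_intros tendsto_nrm assms l 1 2) (use assms(3) in \<open>auto simp: chord_def\<close>)
qed

lemma continuous_pl: "continuous_on ({x. lens x} - {0}) pl"
proof (rule continuous_on_unique_limits)
  show "compact (frontier K)" by (rule compact_frontier_K)
  show "pl \<in> {x. lens x} - {0} \<rightarrow> frontier K" using pl_mi(1) by (auto simp: chord_def)
next
  fix x l xs assume xs: "\<And>n. xs n \<in> {x. lens x} - {0}" "x \<in> {x. lens x} - {0}" "xs \<longlonglongrightarrow> x" "(\<lambda>n. pl (xs n)) \<longlonglongrightarrow> l"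
  have c: "chord (xs n) (pl (xs n))" "cs (xs n) (pl (xs n)) > 0" for n using pl_mi[of "xs n"] xs(1) by auto
  note t = tendsto_chord[OF xs(3,4) c(1)]
  have "cs x l \<ge> 0" by (rule LIMSEQ_le_const[OF t(2)]) (use c(2) in \<open>auto intro: less_imp_le\<close>)
  moreover have "cs x l \<noteq> 0" using lens_iff_chord[OF _ t(1)] xs(2) by auto
  ultimately show "l = pl x" using pl_eqI[OF _ t(1)] xs(2) by auto
qed

lemma continuous_mi: "continuous_on ({x. lens x} - {0}) mi"
proof (rule continuous_on_unique_limits)
  show "compact (frontier K)" by (rule compact_frontier_K)
  show "mi \<in> {x. lens x} - {0} \<rightarrow> frontier K" using pl_mi(3) by (auto simp: chord_def)
next
  fix x l xs assume xs: "\<And>n. xs n \<in> {x. lens x} - {0}" "x \<in> {x. lens x} - {0}" "xs \<longlonglongrightarrow> x" "(\<lambda>n. mi (xs n)) \<longlonglongrightarrow> l"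
  have c: "chord (xs n) (mi (xs n))" "cs (xs n) (mi (xs n)) < 0" for n using pl_mi[of "xs n"] xs(1) by auto
  note t = tendsto_chord[OF xs(3,4) c(1)]
  have "cs x l \<le> 0" by (rule LIMSEQ_le_const2[OF t(2)]) (use c(2) in \<open>auto intro: less_imp_le\<close>)
  moreover have "cs x l \<noteq> 0" using lens_iff_chord[OF _ t(1)] xs(2) by auto
  ultimately show "l = mi x" using mi_eqI[OF _ t(1)] xs(2) by auto
qed

end

section \<open>The gradient of the covariogram\<close>

text \<open>The coordinates of a point are \<open>s\<close> along \<open>D\<close> and \<open>h\<close> along \<open>X\<close>, measured from \<open>b\<close>.\<close>
definition parallelogram :: "real^2 \<Rightarrow> real^2 \<Rightarrow> real^2 \<Rightarrow> real \<Rightarrow> real \<Rightarrow> real \<Rightarrow> real \<Rightarrow> (real^2) set" where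
  "parallelogram b D X s0 s1 h0 h1 =
    (\<lambda>v::real^2. b + (v$1 *\<^sub>R D + v$2 *\<^sub>R X)) ` cbox (vector [s0, h0]) (vector [s1, h1])"

lemma measure_parallelogram:
  fixes s0 s1 h0 h1 :: real
  assumes "\<bar>cr D X\<bar> = 1" "s0 \<le> s1" "h0 \<le> h1"
  shows "parallelogram b D X s0 s1 h0 h1 \<in> lmeasurable"
    "measure lebesgue (parallelogram b D X s0 s1 h0 h1) = (s1 - s0) * (h1 - h0)"
proof -
  let ?f = "\<lambda>v::real^2. v$1 *\<^sub>R D + v$2 *\<^sub>R X"
  let ?B = "cbox (vector [s0, h0]) (vector [s1, h1]) :: (real^2) set"
  have lin: "linear ?f" by (rule linearI) (auto simp: algebra_simps)
  have "det (matrix ?f) = cr D X"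
    by (simp add: det_2 matrix_def cr_def axis_def)
  then have f: "?f ` ?B \<in> lmeasurable" "measure lebesgue (?f ` ?B) = measure lebesgue ?B"
    using measurable_linear_image[OF lin] measure_linear_image[OF lin] assms(1) by auto
  have P: "parallelogram b D X s0 s1 h0 h1 = (+) b ` ?f ` ?B" unfolding parallelogram_def image_image ..
  have "vector [s0, h0] \<in> ?B" using assms(2,3) by (simp add: mem_box_cart forall_2)
  then have "?B \<noteq> {}" by blast
  then have "measure lebesgue ?B = (s1 - s0) * (h1 - h0)"
    using content_cbox_cart[of "vector [s0, h0] :: real^2" "vector [s1, h1]"] by (simp add: UNIV_2)
  then show "parallelogram b D X s0 s1 h0 h1 \<in> lmeasurable"
    "measure lebesgue (parallelogram b D X s0 s1 h0 h1) = (s1 - s0) * (h1 - h0)"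
    unfolding P using f by (simp_all add: measurable_translation measure_translation)
qed

lemma mem_parallelogram:
  fixes s0 s1 h0 h1 :: real
  assumes "cr X D = 1"
  shows "q \<in> parallelogram b D X s0 s1 h0 h1 \<longleftrightarrow>
     s0 \<le> cr X (q - b) \<and> cr X (q - b) \<le> s1 \<and> h0 \<le> cr (q - b) D \<and> cr (q - b) D \<le> h1" (is "?L \<longleftrightarrow> ?R")
  unfolding parallelogram_def
proof
  assume "q \<in> (\<lambda>v::real^2. b + (v$1 *\<^sub>R D + v$2 *\<^sub>R X)) ` cbox (vector [s0, h0]) (vector [s1, h1])"
  then obtain v :: "real^2" where v: "v \<in> cbox (vector [s0, h0]) (vector [s1, h1])" "q = b + (v$1 *\<^sub>R D + v$2 *\<^sub>R X)" by blast
  then have q: "q - b = v$1 *\<^sub>R D + v$2 *\<^sub>R X" by simp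
  have "cr X (q - b) = v$1" "cr (q - b) D = v$2" unfolding q using assms by simp_all
  then show ?R using v(1) by (simp add: mem_box_cart forall_2)
next
  assume R: ?R
  define v :: "real^2" where "v = vector [cr X (q - b), cr (q - b) D]"
  have "cr X D *\<^sub>R (q - b) = cr X (q - b) *\<^sub>R D + cr (q - b) D *\<^sub>R X"
    by (simp add: vec_eq_iff forall_2 cr_def algebra_simps)
  then have "q = b + (v$1 *\<^sub>R D + v$2 *\<^sub>R X)" using assms by (simp add: v_def algebra_simps)
  moreover have "v \<in> cbox (vector [s0, h0]) (vector [s1, h1])" using R by (simp add: v_def mem_box_cart forall_2)
  ultimately show "q \<in> (\<lambda>v::real^2. b + (v$1 *\<^sub>R D + v$2 *\<^sub>R X)) ` cbox (vector [s0, h0]) (vector [s1, h1])"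
    by blast
qed

lemma scaleR_solve:
  fixes v :: "'a::real_vector"
  assumes "c *\<^sub>R v = r *\<^sub>R d + s *\<^sub>R x" "c \<noteq> 0"
  shows "v = (r / c) *\<^sub>R d + (s / c) *\<^sub>R x"
proof -
  have "v = (1 / c) *\<^sub>R (c *\<^sub>R v)" using assms(2) by simp
  then show ?thesis unfolding assms(1) by (simp add: scaleR_add_right)
qed

context oval begin

lemma convex_combination: "p \<in> K \<Longrightarrow> q \<in> K \<Longrightarrow> 0 \<le> t \<Longrightarrow> t \<le> 1 \<Longrightarrow> (1 - t) *\<^sub>R p + t *\<^sub>R q \<in> K"
  using convexD_alt[OF convex_K] by simp

lemma frontier_not_between:
  assumes "p \<in> frontier K" "q \<in> K" "y \<in> K" "0 < t" "t < 1" "p = (1 - t) *\<^sub>R q + t *\<^sub>R y"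
  shows "q = p"
proof (rule ccontr)
  assume ne: "q \<noteq> p"
  have "q \<noteq> y" using ne assms(6) by (auto simp: algebra_simps)
  then have "p \<in> open_segment q y" using assms by (auto simp: in_segment)
  then show False using open_segment_interior[OF assms(2,3) \<open>q \<noteq> y\<close>] assms(1) frontier_iff by blast
qed

text \<open>A point beyond the extension of the side from \<open>b\<close> to \<open>a\<close> would push the corner \<open>a\<close> into the
  interior.\<close>
lemma no_point_beyond_corner:
  assumes a: "a \<in> frontier K" "b \<in> K" "a - x \<in> K" and q: "b + s *\<^sub>R (a - b) + r *\<^sub>R x \<in> K"
    and s: "s > 1" "r \<ge> 0" and ind: "cr x (a - b) \<noteq> 0"
  shows False
proof -
  \<comment> \<open>the weights put \<open>a\<close> on the segment from the given point to a point of the side from \<open>b\<close> to \<open>a - x\<close>\<close>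
  define k where "k = r / (s + r - 1)"
  define t where "t = 1 - 1 / (s + r)"
  have k: "0 \<le> k" "k \<le> 1" using s by (auto simp: k_def divide_simps)
  have t: "0 < t" "t < 1" using s by (auto simp: t_def divide_simps)
  have y: "(1 - k) *\<^sub>R b + k *\<^sub>R (a - x) \<in> K" by (rule convex_combination[OF a(2,3) k])
  have tk: "t * k = r / (s + r)" "1 - t = 1 / (s + r)"
    using s by (auto simp: t_def k_def divide_simps)
  have c1: "(1 - t) * s + t * k = 1" unfolding tk using s by (simp add: add_divide_distrib[symmetric])
  have c2: "(1 - t) * r - t * k = 0" unfolding tk by simp
  have "(1 - t) *\<^sub>R (b + s *\<^sub>R (a - b) + r *\<^sub>R x) + t *\<^sub>R ((1 - k) *\<^sub>R b + k *\<^sub>R (a - x))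
      = b + ((1 - t) * s + t * k) *\<^sub>R (a - b) + ((1 - t) * r - t * k) *\<^sub>R x"
    by (simp add: algebra_simps)
  also have "\<dots> = a" unfolding c1 c2 by simp
  finally have "b + s *\<^sub>R (a - b) + r *\<^sub>R x = a"
    using frontier_not_between[OF a(1) q y t] by simp
  then have "(s - 1) *\<^sub>R (a - b) + r *\<^sub>R x = 0" by (simp add: algebra_simps)
  then have "cr x ((s - 1) *\<^sub>R (a - b) + r *\<^sub>R x) = 0" by simp
  then have "(s - 1) * cr x (a - b) = 0" by (simp add: algebra_simps)
  then show False using s ind by simp
qed

text \<open>By \<open>no_point_beyond_corner\<close> the cap of \<open>K\<close> beyond the line through \<open>a\<close> and \<open>b\<close> lies in the strip
  spanned by the side from \<open>b\<close> to \<open>a\<close> in the direction \<open>x\<close>. A point of the strip at distance at most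
  one side length is carried by \<open>- x\<close> into the parallelogram, and a farther one into the
  triangle that it spans with that side.\<close>
lemma cap_translate:
  assumes a: "chord x a" and b: "chord x b" and pos: "cr x (a - b) > 0"
    and q: "q \<in> K" "cr (q - b) (a - b) \<ge> 0"
  shows "q - x \<in> K"
proof -
  define r where "r = cr (q - b) (a - b) / cr x (a - b)"
  define s where "s = cr x (q - b) / cr x (a - b)"
  have fr: "a \<in> frontier K" "b \<in> frontier K" "a - x \<in> K" "b - x \<in> K" "a \<in> K" "b \<in> K"
    using a b frontier_subset by (auto simp: chord_def)
  have r: "r \<ge> 0" using q pos by (simp add: r_def)
  have "cr x (a - b) *\<^sub>R (q - b) = cr x (q - b) *\<^sub>R (a - b) + cr (q - b) (a - b) *\<^sub>R x"
    by (simp add: vec_eq_iff forall_2 cr_def algebra_simps)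
  then have "q - b = s *\<^sub>R (a - b) + r *\<^sub>R x"
    unfolding s_def r_def using pos by (intro scaleR_solve) auto
  then have qs: "q = b + s *\<^sub>R (a - b) + r *\<^sub>R x" by (simp add: algebra_simps)
  have s1: "s \<le> 1"
  proof (rule ccontr)
    assume "\<not> s \<le> 1"
    then show False using no_point_beyond_corner[OF fr(1,6,3), of s r] q(1) qs r pos by auto
  qed
  have s0: "s \<ge> 0"
  proof (rule ccontr)
    assume "\<not> s \<ge> 0"
    moreover have "q = a + (1 - s) *\<^sub>R (b - a) + r *\<^sub>R x" by (subst qs) (simp add: algebra_simps)
    moreover have "cr x (b - a) \<noteq> 0" using pos by simp
    ultimately show False using no_point_beyond_corner[OF fr(2,5,4), of "1 - s" r] q(1) r by simp
  qed
  have m: "(1 - s) *\<^sub>R b + s *\<^sub>R a \<in> K" by (rule convex_combination[OF fr(6,5) s0 s1])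
  show ?thesis
  proof (cases "r \<le> 1")
    case True
    have mx: "(1 - s) *\<^sub>R (b - x) + s *\<^sub>R (a - x) \<in> K" by (rule convex_combination[OF fr(4,3) s0 s1])
    have "q - x = (1 - r) *\<^sub>R ((1 - s) *\<^sub>R (b - x) + s *\<^sub>R (a - x)) + r *\<^sub>R ((1 - s) *\<^sub>R b + s *\<^sub>R a)"
      by (subst qs) (simp add: algebra_simps)
    then show ?thesis using convex_combination[OF mx m r True] by simp
  next
    case False
    have "q - x = (1 - 1/r) *\<^sub>R q + (1/r) *\<^sub>R ((1 - s) *\<^sub>R b + s *\<^sub>R a)"
    proof -
      have "(1/r) *\<^sub>R ((1 - s) *\<^sub>R b + s *\<^sub>R a) = (1/r) *\<^sub>R (q - r *\<^sub>R x)"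
        by (subst qs) (simp add: algebra_simps)
      then show ?thesis using False by (simp add: algebra_simps)
    qed
    then show ?thesis using convex_combination[OF q(1) m, of "1/r"] False by (simp add: divide_simps)
  qed
qed

text \<open>The part of \<open>K\<close> on one side of a line parallel to \<open>D\<close>; \<open>h = 0\<close> is the line through \<open>b\<close>.\<close>
definition low :: "real^2 \<Rightarrow> real^2 \<Rightarrow> real \<Rightarrow> (real^2) set" where
  "low b D h = {q \<in> K. cr (q - b) D \<le> h}"

lemma mem_low: "q \<in> low b D h \<longleftrightarrow> q \<in> K \<and> cr (q - b) D \<le> h"
  by (simp add: low_def)

lemma low_lmeasurable: "low b D h \<in> lmeasurable"
proof -
  have "closed {q. cr (q - b) D \<le> h}" by (intro closed_Collect_le continuous_intros)
  then have "compact (K \<inter> {q. cr (q - b) D \<le> h})" by (rule compact_Int_closed[OF compact_K])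
  moreover have "low b D h = K \<inter> {q. cr (q - b) D \<le> h}" by (auto simp: low_def)
  ultimately show ?thesis by (simp add: lmeasurable_compact)
qed

text \<open>In the coordinate along \<open>D\<close> the section of \<open>K\<close> by the line through \<open>b\<close> and \<open>b + D\<close> has length 1, and
  this is the slope of the area. Neighbouring sections differ little in length because the
  two ends are boundary points and the points between them are interior.\<close>
lemma low_derivative:
  assumes b: "b \<in> frontier K" "b + D \<in> frontier K" and D: "D \<noteq> 0" and e: "0 < e" "e < 1/2"
  shows "\<exists>d>0. \<forall>h. \<bar>h\<bar> < d \<longrightarrow> measure lebesgue (low b D h) \<le> measure lebesgue (low b D 0) + h + 3 * e * \<bar>h\<bar>"
proof -
  \<comment> \<open>normalised such that the pair \<open>X\<close>, \<open>D\<close> spans area 1\<close>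
  define X where "X = - (1 / (D \<bullet> D)) *\<^sub>R rot D"
  have DD: "D \<bullet> D > 0" using D by simp
  have "cr (rot D) D = - (D \<bullet> D)" by (simp add: cr_def rot_def inner_plane)
  then have X: "cr X D = 1" using DD by (simp add: X_def)
  then have DX: "\<bar>cr D X\<bar> = 1" using cr_swap[of D X] by simp
  have bK: "b \<in> K" "b + D \<in> K" using b frontier_subset by auto
  define P where "P = parallelogram b D X"
  have P: "P s0 s1 h0 h1 \<in> lmeasurable" "measure lebesgue (P s0 s1 h0 h1) = (s1 - s0) * (h1 - h0)"
    if "s0 \<le> s1" "h0 \<le> h1" for s0 s1 h0 h1
    unfolding P_def using measure_parallelogram[OF DX that] by auto
  have memP: "q \<in> P s0 s1 h0 h1 \<longleftrightarrow> s0 \<le> cr X (q - b) \<and> cr X (q - b) \<le> s1 \<and> h0 \<le> cr (q - b) D \<and> cr (q - b) D \<le> h1" for q s0 s1 h0 h1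
    unfolding P_def by (rule mem_parallelogram[OF X])
  have rep: "q = b + (cr X (q - b) *\<^sub>R D + cr (q - b) D *\<^sub>R X)" for q
  proof -
    have "cr X D *\<^sub>R (q - b) = cr X (q - b) *\<^sub>R D + cr (q - b) D *\<^sub>R X"
      by (simp add: vec_eq_iff forall_2 cr_def algebra_simps)
    then show ?thesis using X by (simp add: algebra_simps)
  qed
  have seg_int: "b + s *\<^sub>R D \<in> interior K" if "0 < s" "s < 1" for s
  proof (rule open_segment_interior[OF bK])
    show "b \<noteq> b + D" using D by simp
    show "b + s *\<^sub>R D \<in> open_segment b (b + D)"
      using that D by (auto simp: in_segment intro!: exI[of _ s]) (simp add: algebra_simps)
  qed
  \<comment> \<open>near the chord, the sections of \<open>K\<close> parallel to it are hardly longer than the chord\<close>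
  obtain d1 where d1: "d1 > 0" "\<And>q. q \<in> K \<Longrightarrow> \<bar>cr (q - b) D\<bar> < d1 \<Longrightarrow> - e < cr X (q - b) \<and> cr X (q - b) < 1 + e"
  proof -
    define C where "C = K \<inter> ({q. cr X (q - b) \<le> - e} \<union> {q. 1 + e \<le> cr X (q - b)})"
    have "compact C" unfolding C_def
      by (intro compact_Int_closed compact_K closed_Un closed_Collect_le continuous_intros)
    have nz: "\<bar>cr (q - b) D\<bar> > 0" if q: "q \<in> C" for q
    proof (rule ccontr)
      assume "\<not> ?thesis"
      then have z: "cr (q - b) D = 0" by simp
      define s where "s = cr X (q - b)"
      have qs: "q = b + s *\<^sub>R D" using rep[of q] z by (simp add: s_def)
      have qK: "q \<in> K" using q by (simp add: C_def)
      from q have "s \<le> - e \<or> 1 + e \<le> s" by (auto simp: C_def s_def)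
      then show False
      proof
        assume s: "s \<le> - e"
        have "b = (1 - (-s) / (1 - s)) *\<^sub>R q + ((-s) / (1 - s)) *\<^sub>R (b + D)"
        proof -
          have eq: "1 - (-s) / (1 - s) = 1 / (1 - s)" using s e by (simp add: divide_simps)
          have "(1 - (-s) / (1 - s)) *\<^sub>R q + ((-s) / (1 - s)) *\<^sub>R (b + D) = (1 / (1-s)) *\<^sub>R (q + (-s) *\<^sub>R (b + D))"
            unfolding eq by (simp only: scaleR_add_right scaleR_scaleR times_divide_eq_left mult_1)
          also have "q + (-s) *\<^sub>R (b + D) = (1 - s) *\<^sub>R b" by (simp add: qs algebra_simps)
          finally show ?thesis using s e by simp
        qed
        then have "q = b" using frontier_not_between[OF b(1) qK bK(2), of "(-s) / (1 - s)"] s e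
          by (simp add: divide_simps)
        then show False using qs s e D by simp
      next
        assume s: "1 + e \<le> s"
        have "b + D = (1 - (s - 1) / s) *\<^sub>R q + ((s - 1) / s) *\<^sub>R b"
        proof -
          have eq: "1 - (s - 1) / s = 1 / s" using s e by (simp add: divide_simps)
          have "(1 - (s - 1) / s) *\<^sub>R q + ((s - 1) / s) *\<^sub>R b = (1 / s) *\<^sub>R (q + (s - 1) *\<^sub>R b)"
            unfolding eq by (simp add: scaleR_add_right)
          also have "q + (s - 1) *\<^sub>R b = s *\<^sub>R (b + D)" by (simp add: qs algebra_simps)
          finally show ?thesis using s e by simp
        qed
        then have "q = b + D" using frontier_not_between[OF b(2) qK bK(1), of "(s - 1) / s"] s e
          by (simp add: divide_simps)
        then have "(s - 1) *\<^sub>R D = 0" using qs by (simp add: algebra_simps)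
        then show False using s e D by simp
      qed
    qed
    show ?thesis
    proof (cases "C = {}")
      case True
      show ?thesis by (rule that[of 1]) (use True in \<open>auto simp: C_def not_le\<close>)
    next
      case False
      have "continuous_on C (\<lambda>q. \<bar>cr (q - b) D\<bar>)" by (intro continuous_intros)
      then obtain q0 where q0: "q0 \<in> C" "\<forall>q\<in>C. \<bar>cr (q0 - b) D\<bar> \<le> \<bar>cr (q - b) D\<bar>"
        using continuous_attains_inf[OF \<open>compact C\<close> False] by blast
      show ?thesis
      proof (rule that[OF nz[OF q0(1)]])
        fix q assume "q \<in> K" "\<bar>cr (q - b) D\<bar> < \<bar>cr (q0 - b) D\<bar>"
        then have "q \<notin> C" using q0(2) by force
        then show "- e < cr X (q - b) \<and> cr X (q - b) < 1 + e" using \<open>q \<in> K\<close> by (auto simp: C_def)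
      qed
    qed
  qed
  \<comment> \<open>and hardly shorter\<close>
  obtain d2 where d2: "d2 > 0" "\<And>s h. e \<le> s \<Longrightarrow> s \<le> 1 - e \<Longrightarrow> \<bar>h\<bar> < d2 \<Longrightarrow> b + (s *\<^sub>R D + h *\<^sub>R X) \<in> K"
  proof -
    let ?S = "(\<lambda>s. b + s *\<^sub>R D) ` {e..1 - e}"
    have "compact ?S" by (intro compact_continuous_image continuous_intros compact_Icc)
    moreover have "?S \<subseteq> interior K" using seg_int e by auto
    ultimately obtain r where r: "r > 0" "(\<Union>x\<in>?S. cball x r) \<subseteq> interior K"
      using compact_subset_open_imp_cball_epsilon_subset[of ?S "interior K"] by auto
    have nX: "norm X > 0" using X by auto
    show ?thesis
    proof (rule that[of "r / norm X"])
      fix s h assume s: "e \<le> s" "s \<le> 1 - e" and h: "\<bar>h\<bar> < r / norm X"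
      have "b + (s *\<^sub>R D + h *\<^sub>R X) \<in> cball (b + s *\<^sub>R D) r"
        using h nX by (simp add: dist_norm algebra_simps less_divide_eq)
      then show "b + (s *\<^sub>R D + h *\<^sub>R X) \<in> K" using r(2) s interior_subset by fastforce
    qed (use r nX in auto)
  qed
  show ?thesis
  proof (intro exI[of _ "min d1 d2"] conjI allI impI)
    show "min d1 d2 > 0" using d1 d2 by simp
    fix h assume h: "\<bar>h\<bar> < min d1 d2"
    let ?m = "\<lambda>h. measure lebesgue (low b D h)"
    show "?m h \<le> ?m 0 + h + 3 * e * \<bar>h\<bar>"
    proof (cases "h \<ge> 0")
      case True
      have "low b D h \<subseteq> low b D 0 \<union> P (- e) (1 + e) 0 h"
      proof
        fix q assume q: "q \<in> low b D h"
        show "q \<in> low b D 0 \<union> P (- e) (1 + e) 0 h"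
        proof (cases "cr (q - b) D \<le> 0")
          case False
          then have "\<bar>cr (q - b) D\<bar> < d1" using q h by (simp add: mem_low)
          then show ?thesis using d1(2)[of q] q False by (simp add: memP mem_low)
        qed (use q in \<open>auto simp: mem_low\<close>)
      qed
      then have "?m h \<le> measure lebesgue (low b D 0 \<union> P (- e) (1 + e) 0 h)"
        using P(1)[of "- e" "1 + e" 0 h] True e
        by (intro measure_mono_fmeasurable fmeasurable.Un fmeasurableD low_lmeasurable) auto
      also have "\<dots> \<le> ?m 0 + measure lebesgue (P (- e) (1 + e) 0 h)"
        using P(1)[of "- e" "1 + e" 0 h] True e by (intro measure_Un_le fmeasurableD low_lmeasurable) auto
      also have "measure lebesgue (P (- e) (1 + e) 0 h) = (1 + 2 * e) * h" using P(2)[of "- e" "1 + e" 0 h] True e by simp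
      also have "?m 0 + (1 + 2 * e) * h \<le> ?m 0 + h + 3 * e * \<bar>h\<bar>"
        using True e by (simp add: algebra_simps)
      finally show ?thesis .
    next
      case False
      let ?Q = "P e (1 - e) ((1 - e) * h) 0"
      have hm: "(1 - e) * h \<le> 0" "h < (1 - e) * h"
        using False e mult_neg_pos[of h e] by (auto simp: algebra_simps mult_le_0_iff)
      have Q: "?Q \<in> lmeasurable" "measure lebesgue ?Q = (1 - 2 * e) * ((1 - e) * (- h))"
        using P[of e "1 - e" "(1 - e) * h" 0] hm e by (auto simp: algebra_simps)
      have "q \<in> K" if q: "q \<in> ?Q" for q
      proof -
        have "\<bar>cr (q - b) D\<bar> \<le> \<bar>(1 - e) * h\<bar>" using q hm by (simp add: memP)
        also have "\<dots> \<le> \<bar>h\<bar>" using hm by linarith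
        finally have "b + (cr X (q - b) *\<^sub>R D + cr (q - b) D *\<^sub>R X) \<in> K" using q h by (intro d2(2)) (auto simp: memP)
        then show ?thesis using rep[of q] by simp
      qed
      then have sub: "low b D h \<union> ?Q \<subseteq> low b D 0" using False by (auto simp: memP mem_low)
      have "low b D h \<inter> ?Q = {}" using hm by (auto simp: memP mem_low)
      then have "?m h + measure lebesgue ?Q = measure lebesgue (low b D h \<union> ?Q)"
        using measure_Un3[of "low b D h" lebesgue ?Q] Q by (simp add: low_lmeasurable)
      also have "\<dots> \<le> ?m 0"
        using sub Q(1) by (intro measure_mono_fmeasurable fmeasurable.Un fmeasurableD low_lmeasurable) auto
      finally have "?m h \<le> ?m 0 - (1 - 2 * e) * ((1 - e) * (- h))" using Q by simp
      also have "\<dots> = ?m 0 + h + 3 * e * (-h) - 2 * e\<^sup>2 * (- h)" by (simp add: algebra_simps power2_eq_square)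
      also have "\<dots> \<le> ?m 0 + h + 3 * e * \<bar>h\<bar>" using False by (simp add: mult_nonneg_nonpos)
      finally show ?thesis .
    qed
  qed
qed

text \<open>The line through \<open>mi x\<close> and \<open>pl x\<close> cuts the lens into a cap of \<open>K\<close> and a cap of \<open>K + x\<close>, by
  \<open>cap_translate\<close>. For a vector \<open>x + v\<close> the lens is still contained in the union of the same cap of \<open>K\<close>
  and the cap of \<open>K + x + v\<close> beyond the same line, whose area is controlled by \<open>low_derivative\<close>.\<close>
lemma covariogram_upper:
  assumes x: "x \<noteq> 0" "lens x" and e: "e > 0"
  shows "\<exists>d>0. \<forall>v. norm v < d \<longrightarrow>
    covariogram K (x + v) \<le> covariogram K x - cr v (pl x - mi x) + e * norm v"
proof -
  define D where "D = pl x - mi x"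
  define b where "b = mi x - x"
  note c = pl_mi[OF x]
  have pos: "cr x D > 0" using cr_pl_mi[OF x] by (simp add: D_def)
  then have D: "D \<noteq> 0" by auto
  have fr: "mi x \<in> frontier K" "pl x \<in> frontier K" "b \<in> frontier K" "b + D \<in> frontier K"
    using c by (auto simp: chord_def b_def D_def)
  define H where "H = K - low (mi x) D 0"
  have H: "H \<in> lmeasurable"
    unfolding H_def by (intro fmeasurable.Diff lmeasurable_compact compact_K low_lmeasurable)
  have cap: "q - x \<in> K" if "q \<in> H" for q
  proof -
    have "q \<in> K" "cr (q - mi x) D \<ge> 0" using that unfolding H_def Diff_iff mem_low by auto
    then show ?thesis using cap_translate[OF c(1,3)] pos unfolding D_def by blast
  qed
  have cap': "q + x \<in> K" if q: "q \<in> low b D 0" for q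
  proof -
    have ch: "chord (- x) (mi x - x)" "chord (- x) (pl x - x)" using c by (auto simp: chord_def)
    have E: "(mi x - x) - (pl x - x) = - D" by (simp add: D_def)
    have "cr (q - (pl x - x)) (- D) = - cr (q - b) D"
      by (simp add: b_def D_def algebra_simps cr_swap[of "mi x" "pl x"])
    then have q': "q \<in> K" "cr (q - (pl x - x)) (- D) \<ge> 0" using q unfolding mem_low by simp_all
    have "cr (- x) (- D) > 0" using pos by simp
    then have "q - (- x) \<in> K" using cap_translate[OF ch] q' unfolding E by blast
    then show ?thesis by simp
  qed
  have low: "(+) y ` low b D h \<in> lmeasurable" "measure lebesgue ((+) y ` low b D h) = measure lebesgue (low b D h)" for y h
    by (simp_all add: measurable_translation low_lmeasurable measure_translation)
  have upper: "covariogram K (x + v) \<le> measure lebesgue H + measure lebesgue (low b D (- cr v D))" for v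
  proof -
    have "K \<inter> (\<lambda>q. q + (x + v)) ` K \<subseteq> H \<union> (+) (x + v) ` low b D (- cr v D)"
    proof
      fix q assume "q \<in> K \<inter> (\<lambda>q. q + (x + v)) ` K"
      then have q: "q \<in> K" "q - (x + v) \<in> K" unfolding lens_set_iff by blast+
      show "q \<in> H \<union> (+) (x + v) ` low b D (- cr v D)"
      proof (cases "q \<in> H")
        case False
        then have "cr (q - mi x) D \<le> 0" using q(1) unfolding H_def Diff_iff mem_low by auto
        moreover have "cr (q - (x + v) - b) D = cr (q - mi x) D - cr v D" by (simp add: b_def)
        ultimately have "q - (x + v) \<in> low b D (- cr v D)" using q(2) unfolding mem_low by simp
        then show ?thesis by (intro UnI2 image_eqI[of _ _ "q - (x + v)"]) simp_all
      qed simp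
    qed
    then have "covariogram K (x + v) \<le> measure lebesgue (H \<union> (+) (x + v) ` low b D (- cr v D))"
      unfolding covariogram_def using compact_lens
      by (intro measure_mono_fmeasurable fmeasurable.Un fmeasurableD H low) (auto intro: lmeasurable_compact)
    also have "\<dots> \<le> measure lebesgue H + measure lebesgue ((+) (x + v) ` low b D (- cr v D))"
      by (intro measure_Un_le fmeasurableD H low)
    finally show ?thesis by (simp only: low)
  qed
  have lower: "measure lebesgue H + measure lebesgue (low b D 0) \<le> covariogram K x"
  proof -
    have "H \<inter> (+) x ` low b D 0 = {}"
    proof -
      have "q \<notin> H" if q: "q \<in> (+) x ` low b D 0" for q
      proof -
        obtain y where y: "y \<in> low b D 0" "q = x + y" using q unfolding image_iff by blast
        have "cr (q - mi x) D = cr (y - b) D" by (simp add: y(2) b_def)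
        then show ?thesis using y(1) unfolding H_def Diff_iff mem_low by simp
      qed
      then show ?thesis by blast
    qed
    then have "measure lebesgue H + measure lebesgue (low b D 0) = measure lebesgue (H \<union> (+) x ` low b D 0)"
      using measure_Un3[OF H low(1), of x 0] by (simp add: low(2))
    also have "\<dots> \<le> covariogram K x"
      unfolding covariogram_def
    proof (intro measure_mono_fmeasurable fmeasurableD fmeasurable.Un H low lmeasurable_compact compact_lens subsetI)
      fix q assume "q \<in> H \<union> (+) x ` low b D 0"
      then show "q \<in> K \<inter> (\<lambda>q. q + x) ` K"
        unfolding lens_set_iff
      proof
        assume "q \<in> H" then show "q \<in> K \<and> q - x \<in> K" using cap by (auto simp: H_def)
      next
        assume "q \<in> (+) x ` low b D 0"
        then obtain y where y: "y \<in> low b D 0" "q = x + y" unfolding image_iff by blast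
        then show "q \<in> K \<and> q - x \<in> K" using cap'[of y] by (simp add: mem_low add.commute)
      qed
    qed
    finally show ?thesis .
  qed
  \<comment> \<open>the factor \<open>norm D + 1\<close> converts between \<open>cr v D\<close> and \<open>norm v\<close>\<close>
  define e' where "e' = min (1/4) (e / (3 * (norm D + 1)))"
  have nD: "norm D + 1 > 0" by (simp add: add_nonneg_pos)
  have e': "0 < e'" "e' < 1/2" using e nD by (auto simp: e'_def)
  have "e' \<le> e / (3 * (norm D + 1))" by (simp add: e'_def)
  then have e'D: "3 * e' * (norm D + 1) \<le> e" using nD by (simp add: le_divide_eq algebra_simps)
  obtain d where d: "d > 0" "\<forall>h. \<bar>h\<bar> < d \<longrightarrow> measure lebesgue (low b D h) \<le> measure lebesgue (low b D 0) + h + 3 * e' * \<bar>h\<bar>"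
    using low_derivative[OF fr(3,4) D e'] by blast
  show ?thesis
  proof (intro exI[of _ "d / (norm D + 1)"] conjI allI impI)
    show "d / (norm D + 1) > 0" using d nD by simp
    fix v :: "real^2" assume v: "norm v < d / (norm D + 1)"
    have "\<bar>cr v D\<bar> \<le> norm (rot v) * norm D" using Cauchy_Schwarz_ineq2[of "rot v" D] by (simp add: rot_inner)
    also have "norm (rot v) = norm v" by (simp add: norm_eq_sqrt_inner rot_def inner_plane algebra_simps)
    also have "norm v * norm D \<le> norm v * (norm D + 1)" by (intro mult_left_mono) auto
    finally have cv: "\<bar>cr v D\<bar> \<le> norm v * (norm D + 1)" .
    also have "\<dots> < d" using v nD by (simp add: less_divide_eq)
    finally have "\<bar>- cr v D\<bar> < d" by simp
    then have "measure lebesgue (low b D (- cr v D)) \<le> measure lebesgue (low b D 0) + - cr v D + 3 * e' * \<bar>- cr v D\<bar>"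
      using d(2) by blast
    then have "measure lebesgue (low b D (- cr v D)) \<le> measure lebesgue (low b D 0) - cr v D + 3 * e' * \<bar>cr v D\<bar>"
      by simp
    moreover have "3 * e' * \<bar>cr v D\<bar> \<le> e * norm v"
    proof -
      have "3 * e' * \<bar>cr v D\<bar> \<le> 3 * e' * (norm v * (norm D + 1))" using cv e' by (intro mult_left_mono) auto
      also have "\<dots> = (3 * e' * (norm D + 1)) * norm v" by (simp add: algebra_simps)
      also have "\<dots> \<le> e * norm v" using e'D by (intro mult_right_mono) auto
      finally show ?thesis .
    qed
    ultimately show "covariogram K (x + v) \<le> covariogram K x - cr v (pl x - mi x) + e * norm v"
      using upper[of v] lower unfolding D_def[symmetric] by linarith
  qed
qed

text \<open>If \<open>K\<close> contains a disc of radius \<open>r\<close>, then \<open>K \<inter> (K + v)\<close> contains the homothetic copy of \<open>K\<close>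
  with the ratio \<open>1 - norm v / r\<close>.\<close>
lemma covariogram_lipschitz:
  "\<exists>r C. r > 0 \<and> C \<ge> 0 \<and> (\<forall>x v. norm v < r \<longrightarrow> \<bar>covariogram K (x + v) - covariogram K x\<bar> \<le> C * norm v)"
proof -
  obtain c where "c \<in> interior K" using interior_K by blast
  then obtain r where r: "r > 0" "cball c r \<subseteq> K" using mem_interior_cball by blast
  let ?m = "measure lebesgue K"
  have lK: "K \<in> lmeasurable" using compact_K by (rule lmeasurable_compact)
  have lT: "(\<lambda>y. y + v) ` K \<in> lmeasurable" "measure lebesgue ((\<lambda>y. y + v) ` K) = ?m" for v
    using measurable_translation[OF lK, of v] measure_translation[of v K] by (simp_all add: add.commute[of _ v])
  have diff: "measure lebesgue (K - (\<lambda>y. y + v) ` K) \<le> 2 * (norm v / r) * ?m" if v: "norm v < r" for v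
  proof -
    define t where "t = norm v / r"
    have t: "0 \<le> t" "t < 1" using v r by (auto simp: t_def)
    let ?S = "(\<lambda>q. (1 - t) *\<^sub>R q + t *\<^sub>R c) ` K"
    have sub: "?S \<subseteq> (\<lambda>y. y + v) ` K \<inter> K"
    proof (intro subsetI)
      fix y assume "y \<in> ?S"
      then obtain q where q: "q \<in> K" "y = (1 - t) *\<^sub>R q + t *\<^sub>R c" by blast
      have "(1 - t) *\<^sub>R q + t *\<^sub>R (c - (1/t) *\<^sub>R v) \<in> K"
      proof (rule convex_combination[OF q(1)])
        show "c - (1/t) *\<^sub>R v \<in> K" using r by (auto simp: t_def dist_norm intro!: subsetD[OF r(2)])
      qed (use t in auto)
      moreover have "y - v = (1 - t) *\<^sub>R q + t *\<^sub>R (c - (1/t) *\<^sub>R v)"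
      proof (cases "t = 0")
        case True
        then have "v = 0" using r by (simp add: t_def)
        then show ?thesis using q(2) True by simp
      qed (simp add: q(2) scaleR_diff_right)
      moreover have "c \<in> K" using r by auto
      then have "y \<in> K" unfolding q(2) using convex_combination[OF q(1), of c t] t by auto
      ultimately show "y \<in> (\<lambda>y. y + v) ` K \<inter> K" by (simp add: mem_translate_iff)
    qed
    have Sm: "measure lebesgue ?S = (1 - t)\<^sup>2 * ?m"
      using measure_lebesgue_affine[of "1 - t" "t *\<^sub>R c" K] t by simp
    have "compact ?S" by (intro compact_continuous_image continuous_intros compact_K)
    then have lS: "?S \<in> lmeasurable" by (rule lmeasurable_compact)
    have "measure lebesgue (K - (\<lambda>y. y + v) ` K) \<le> measure lebesgue (K - ?S)"
      using sub by (intro measure_mono_fmeasurable fmeasurableD fmeasurable.Diff lK lT lS) auto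
    also have "\<dots> = ?m - measure lebesgue ?S"
      using sub by (intro measurable_measure_Diff lK fmeasurableD lS) auto
    also have "\<dots> = (2 * t - t\<^sup>2) * ?m" unfolding Sm by (simp add: algebra_simps power2_eq_square)
    also have "\<dots> \<le> 2 * t * ?m" by (intro mult_right_mono) auto
    finally show ?thesis by (simp add: t_def)
  qed
  have one: "covariogram K x - covariogram K (x + v) \<le> 2 * (norm v / r) * ?m" if v: "norm v < r" for x v
  proof -
    let ?A = "(\<lambda>y. y + x) ` (K - (\<lambda>y. y + v) ` K)"
    have A: "?A \<in> lmeasurable" "measure lebesgue ?A = measure lebesgue (K - (\<lambda>y. y + v) ` K)"
      using measurable_translation[OF fmeasurable.Diff[OF lK lT(1)], of x v]
        measure_translation[of x "K - (\<lambda>y. y + v) ` K"] by (simp_all add: add.commute[of _ x])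
    have "K \<inter> (\<lambda>y. y + x) ` K \<subseteq> (K \<inter> (\<lambda>y. y + (x + v)) ` K) \<union> ?A"
      by (auto simp: mem_translate_iff diff_diff_eq)
    then have "covariogram K x \<le> measure lebesgue ((K \<inter> (\<lambda>y. y + (x + v)) ` K) \<union> ?A)"
      unfolding covariogram_def
      by (intro measure_mono_fmeasurable fmeasurable.Un fmeasurableD A lmeasurable_compact compact_lens)
    also have "\<dots> \<le> covariogram K (x + v) + measure lebesgue ?A"
      unfolding covariogram_def by (intro measure_Un_le fmeasurableD A lmeasurable_compact compact_lens)
    finally show ?thesis using diff[OF v] A(2) by simp
  qed
  have "\<bar>covariogram K (x + v) - covariogram K x\<bar> \<le> (2 / r * ?m) * norm v" if "norm v < r" for x v
  proof -
    have "(2 / r * ?m) * norm v = 2 * (norm v / r) * ?m" by simp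
    then show ?thesis using one[OF that, of x] one[of "- v" "x + v"] that by (simp only: abs_le_iff) simp
  qed
  moreover have "2 / r * ?m \<ge> 0" using r by simp
  ultimately show ?thesis using r(1) by blast
qed

lemma continuous_covariogram: "continuous_on UNIV (covariogram K)"
proof -
  obtain r C where r: "r > 0" "C \<ge> 0" "\<forall>x v. norm v < r \<longrightarrow> \<bar>covariogram K (x + v) - covariogram K x\<bar> \<le> C * norm v"
    using covariogram_lipschitz by blast
  show ?thesis
    unfolding continuous_on_iff
  proof (intro ballI allI impI)
    fix x :: "real^2" and e :: real assume e: "e > 0"
    show "\<exists>d>0. \<forall>y\<in>UNIV. dist y x < d \<longrightarrow> dist (covariogram K y) (covariogram K x) < e"
    proof (intro exI[of _ "min r (e / (C + 1))"] conjI ballI impI)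
      show "min r (e / (C + 1)) > 0" using r e by simp
      fix y assume "dist y x < min r (e / (C + 1))"
      then have y: "norm (y - x) < r" "norm (y - x) < e / (C + 1)" by (auto simp: dist_norm)
      have "\<bar>covariogram K (x + (y - x)) - covariogram K x\<bar> \<le> C * norm (y - x)" using r(3) y(1) by blast
      also have "\<dots> \<le> (C + 1) * norm (y - x)" by (intro mult_right_mono) auto
      also have "\<dots> < e" using y(2) r(2) by (simp add: less_divide_eq algebra_simps)
      finally show "dist (covariogram K y) (covariogram K x) < e" by (simp add: dist_real_def)
    qed
  qed
qed

end

locale oval_pair = K: oval K + L: oval L for K L +
  assumes same: "covariogram K x = covariogram L x"
begin

lemma lens_eq: "K.lens x \<longleftrightarrow> L.lens x"
  using K.covariogram_pos_iff[of x] L.covariogram_pos_iff[of x] same[of x] by simp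

text \<open>By \<open>covariogram_upper\<close> both vectors are rotated gradients of the common covariogram, with a
  one-sided estimate only. If they differed, then on a suitable segment the covariogram plus a
  linear function would have a strict one-sided decrease in both directions at every point, which
  is impossible where it is least.\<close>
lemma twin_eq:
  assumes x: "x \<noteq> 0" "K.lens x"
  shows "K.pl x - K.mi x = L.pl x - L.mi x"
proof (rule ccontr)
  let ?g = "covariogram K"
  define dK where "dK y = K.pl y - K.mi y" for y
  define dL where "dL y = L.pl y - L.mi y" for y
  assume "K.pl x - K.mi x \<noteq> L.pl x - L.mi x"
  define w where "w = dK x - dL x"
  \<comment> \<open>along \<open>v\<close> the two gradients give different slopes; \<open>k\<close> lies between them near \<open>x\<close>\<close>
  define v where "v = - rot w"
  have "w \<noteq> 0" using \<open>K.pl x - K.mi x \<noteq> L.pl x - L.mi x\<close> by (simp add: w_def dK_def dL_def)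
  moreover have "cr v w = w \<bullet> w" by (simp add: v_def cr_def rot_def inner_plane)
  ultimately have "cr v w > 0" by simp
  then have "cr v (dK x - dL x) > 0" by (simp only: w_def)
  then have lt: "cr v (dL x) < cr v (dK x)" by simp
  define k where "k = (cr v (dL x) + cr v (dK x)) / 2"
  have k: "cr v (dL x) < k" "k < cr v (dK x)" using lt by (auto simp: k_def)
  let ?G = "{y. K.lens y} - {0}"
  have oG: "open ?G" using K.open_lens by (intro open_delete)
  have cont: "continuous_on ?G dK" "continuous_on ?G dL"
    unfolding dK_def dL_def
    using K.continuous_pl K.continuous_mi L.continuous_pl L.continuous_mi lens_eq by (auto intro!: continuous_intros)
  have contv: "continuous_on ?G (\<lambda>y. cr v (dK y))" "continuous_on ?G (\<lambda>y. cr v (dL y))"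
    using cont by (auto intro!: continuous_intros)
  define U where "U = (?G \<inter> (\<lambda>y. cr v (dK y)) -` {k<..}) \<inter> (?G \<inter> (\<lambda>y. cr v (dL y)) -` {..<k})"
  have "open U"
    unfolding U_def using contv oG by (intro open_Int continuous_open_preimage) auto
  moreover have "x \<in> U" using x k by (simp add: U_def)
  ultimately obtain r where r: "r > 0" "ball x r \<subseteq> U" by (rule openE)
  have U: "y \<noteq> 0" "K.lens y" "k < cr v (dK y)" "cr v (dL y) < k" if "y \<in> U" for y
    using that by (auto simp: U_def)
  have nv: "norm v + 1 > 0" by (simp add: add_nonneg_pos)
  have small: "\<exists>h0>0. \<forall>h. 0 < h \<and> h < h0 \<longrightarrow> h * norm v < d" if "d > 0" for d
  proof (intro exI[of _ "d / (norm v + 1)"] conjI allI impI)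
    show "d / (norm v + 1) > 0" using that nv by simp
    fix h assume h: "0 < h \<and> h < d / (norm v + 1)"
    then have "h * (norm v + 1) < d" using nv by (simp add: less_divide_eq)
    then show "h * norm v < d" using h by (simp add: algebra_simps)
  qed
  have right: "\<exists>h0>0. \<forall>h. 0 < h \<and> h < h0 \<longrightarrow> ?g (y + h *\<^sub>R v) + k * h < ?g y" if y: "y \<in> U" for y
  proof -
    define e where "e = (cr v (dK y) - k) / (norm v + 1)"
    have e: "e > 0" "e * norm v < cr v (dK y) - k"
      using U(3)[OF y] nv by (auto simp: e_def divide_simps)
    obtain d where d: "d > 0" "\<forall>u. norm u < d \<longrightarrow> ?g (y + u) \<le> ?g y - cr u (dK y) + e * norm u"
      using K.covariogram_upper[OF U(1,2)[OF y] e(1)] unfolding dK_def by blast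
    obtain h0 where h0: "h0 > 0" "\<forall>h. 0 < h \<and> h < h0 \<longrightarrow> h * norm v < d" using small[OF d(1)] by blast
    show ?thesis
    proof (intro exI[of _ h0] conjI allI impI h0(1))
      fix h assume h: "0 < h \<and> h < h0"
      then have "norm (h *\<^sub>R v) < d" using h0(2) by simp
      then have "?g (y + h *\<^sub>R v) \<le> ?g y - cr (h *\<^sub>R v) (dK y) + e * norm (h *\<^sub>R v)" using d(2) by blast
      also have "\<dots> = ?g y - h * (cr v (dK y) - e * norm v)" using h by (simp add: algebra_simps)
      also have "\<dots> < ?g y - h * k" using h e(2) by simp
      finally show "?g (y + h *\<^sub>R v) + k * h < ?g y" by (simp add: algebra_simps)
    qed
  qed
  have left: "\<exists>h0>0. \<forall>h. 0 < h \<and> h < h0 \<longrightarrow> ?g (y - h *\<^sub>R v) - k * h < ?g y" if y: "y \<in> U" for y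
  proof -
    define e where "e = (k - cr v (dL y)) / (norm v + 1)"
    have e: "e > 0" "e * norm v < k - cr v (dL y)"
      using U(4)[OF y] nv by (auto simp: e_def divide_simps)
    obtain d where d: "d > 0" "\<forall>u. norm u < d \<longrightarrow> ?g (y + u) \<le> ?g y - cr u (dL y) + e * norm u"
      using L.covariogram_upper[OF U(1)[OF y] _ e(1)] U(2)[OF y] unfolding dL_def lens_eq same by blast
    obtain h0 where h0: "h0 > 0" "\<forall>h. 0 < h \<and> h < h0 \<longrightarrow> h * norm v < d" using small[OF d(1)] by blast
    show ?thesis
    proof (intro exI[of _ h0] conjI allI impI h0(1))
      fix h assume h: "0 < h \<and> h < h0"
      then have "norm (- (h *\<^sub>R v)) < d" using h0(2) by simp
      then have "?g (y + - (h *\<^sub>R v)) \<le> ?g y - cr (- (h *\<^sub>R v)) (dL y) + e * norm (- (h *\<^sub>R v))" using d(2) by blast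
      also have "\<dots> = ?g y + h * (cr v (dL y) + e * norm v)" using h by (simp add: algebra_simps)
      also have "\<dots> < ?g y + h * k" using h e(2) by simp
      finally show "?g (y - h *\<^sub>R v) - k * h < ?g y" by (simp add: algebra_simps)
    qed
  qed
  define T where "T = r / (2 * (norm v + 1))"
  have T: "T > 0" using r nv by (simp add: T_def)
  have inU: "x + t *\<^sub>R v \<in> U" if "\<bar>t\<bar> \<le> T" for t
  proof -
    have "\<bar>t\<bar> * (2 * (norm v + 1)) \<le> r" using that nv by (simp add: T_def le_divide_eq)
    moreover have "\<bar>t\<bar> * norm v \<ge> 0" by simp
    ultimately have "\<bar>t\<bar> * norm v < r" using r(1) by (simp add: algebra_simps)
    then show ?thesis using r(2) by (auto simp: dist_norm)
  qed
  let ?f = "\<lambda>t. ?g (x + t *\<^sub>R v) + k * t"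
  have "continuous_on {-T..T} ?f"
    by (intro continuous_intros continuous_on_compose2[OF K.continuous_covariogram]) auto
  then obtain t0 where t0: "t0 \<in> {-T..T}" "\<forall>t\<in>{-T..T}. ?f t0 \<le> ?f t"
    using continuous_attains_inf[of "{-T..T}" ?f] T by auto
  have y: "x + t0 *\<^sub>R v \<in> U" using t0(1) by (intro inU) auto
  show False
  proof (cases "t0 < T")
    case True
    obtain h0 where h0: "h0 > 0" "\<forall>h. 0 < h \<and> h < h0 \<longrightarrow> ?g (x + t0 *\<^sub>R v + h *\<^sub>R v) + k * h < ?g (x + t0 *\<^sub>R v)"
      using right[OF y] by blast
    define h where "h = min (h0 / 2) (T - t0)"
    have h: "0 < h" "h < h0" "t0 + h \<in> {-T..T}" using h0 True t0(1) by (auto simp: h_def min_def)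
    have "?f (t0 + h) < ?f t0" using h0(2) h(1,2) by (auto simp: algebra_simps)
    then show False using t0(2) h(3) by force
  next
    case False
    obtain h0 where h0: "h0 > 0" "\<forall>h. 0 < h \<and> h < h0 \<longrightarrow> ?g (x + t0 *\<^sub>R v - h *\<^sub>R v) - k * h < ?g (x + t0 *\<^sub>R v)"
      using left[OF y] by blast
    define h where "h = min (h0 / 2) T"
    have h: "0 < h" "h < h0" "t0 - h \<in> {-T..T}" using h0 False T t0(1) by (auto simp: h_def min_def)
    have "?f (t0 - h) < ?f t0" using h0(2) h(1,2) by (auto simp: algebra_simps)
    then show False using t0(2) h(3) by force
  qed
qed

end

section \<open>Matching boundary points of two ovals\<close>

lemma sgn_eqI: "(a = 0 \<longleftrightarrow> b = 0) \<Longrightarrow> a * b \<ge> 0 \<Longrightarrow> sgn a = sgn (b::real)"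
  by (auto simp: sgn_if zero_le_mult_iff)

lemma sgn_eq_mult_nonneg: "sgn a = sgn b \<Longrightarrow> 0 \<le> a * (b::real)"
  by (cases a "0::real" rule: linorder_cases) (auto simp: sgn_if zero_le_mult_iff split: if_splits)

context oval begin

text \<open>In the parallelogram with the vertices \<open>pl x\<close>, \<open>mi x\<close>, \<open>mi x - x\<close> and \<open>pl x - x\<close>, this is \<open>cs\<close> of the
  diagonal with the head \<open>pl x\<close>.\<close>
definition diag :: "real^2 \<Rightarrow> real" where
  "diag x = cr (nrm (pl x)) (nrm (mi x - x))"

lemma pl_neq_mi: "x \<noteq> 0 \<Longrightarrow> lens x \<Longrightarrow> mi x \<noteq> pl x"
  using cr_pl_mi[of x] by auto

lemma lens_shrink:
  assumes "chord x a" "x \<noteq> 0" "0 < t" "t < 1"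
  shows "lens (t *\<^sub>R x)"
proof -
  have ends: "a \<in> K" "a - x \<in> K" "a \<noteq> a - x" using assms frontier_subset by (auto simp: chord_def)
  have int: "a - s *\<^sub>R x \<in> interior K" if "0 < s" "s < 1" for s
  proof -
    have "a - s *\<^sub>R x = (1 - s) *\<^sub>R a + s *\<^sub>R (a - x)" by (simp add: algebra_simps)
    then have "a - s *\<^sub>R x \<in> open_segment a (a - x)" using that ends(3) by (auto simp: in_segment)
    then show ?thesis by (rule open_segment_interior[OF ends])
  qed
  have "a - ((1 - t) / 2) *\<^sub>R x \<in> interior K" using assms by (intro int) auto
  moreover have "a - ((1 - t) / 2) *\<^sub>R x - t *\<^sub>R x \<in> interior K"
  proof -
    have "0 < (1 - t) / 2 + t" "(1 - t) / 2 + t < 1" using assms by (auto simp: field_simps)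
    from int[OF this] show ?thesis by (simp add: scaleR_add_left diff_diff_eq)
  qed
  ultimately show ?thesis unfolding lens_def by blast
qed

end

context oval_pair begin

lemma chord_sign_zero_eq: "x \<noteq> 0 \<Longrightarrow> K.chord x a \<Longrightarrow> L.chord x b \<Longrightarrow> K.cs x a = 0 \<longleftrightarrow> L.cs x b = 0"
  using K.lens_iff_chord L.lens_iff_chord lens_eq by blast

text \<open>The chord of \<open>L\<close> that corresponds to the chord of \<open>K\<close> from \<open>z\<close> to \<open>p\<close> has the head \<open>q\<close>. When \<open>p\<close> and
  \<open>z\<close> are antipodal both signs are 0.\<close>
definition mate :: "real^2 \<Rightarrow> real^2 \<Rightarrow> real^2 \<Rightarrow> bool" where
  "mate p z q \<longleftrightarrow> L.chord (p - z) q \<and> sgn (L.cs (p - z) q) = sgn (K.cs (p - z) p)"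

lemma mate_unique: "p \<noteq> z \<Longrightarrow> mate p z q \<Longrightarrow> mate p z q' \<Longrightarrow> q = q'"
proof -
  assume "p \<noteq> z" "mate p z q" "mate p z q'"
  then show "q = q'" using L.chord_unique_sign[of "p - z" q q'] sgn_eq_mult_nonneg by (simp add: mate_def)
qed

lemma chord_K: "p \<in> frontier K \<Longrightarrow> z \<in> frontier K \<Longrightarrow> K.chord (p - z) p"
  by (simp add: K.chord_def)

text \<open>If \<open>p\<close> and \<open>z\<close> are antipodal, the covariogram vanishes at \<open>p - z\<close> and \<open>L.pl\<close> is not available; the
  chord of \<open>L\<close> is then a limit of chords with slightly shorter vectors.\<close>
lemma mate_exists:
  assumes "p \<in> frontier K" "z \<in> frontier K" "p \<noteq> z"
  shows "\<exists>q. mate p z q"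
proof -
  let ?x = "p - z"
  have x: "?x \<noteq> 0" using assms by simp
  note cK = chord_K[OF assms(1,2)]
  show ?thesis
  proof (cases "K.lens ?x")
    case True
    then have L: "L.lens ?x" using lens_eq by simp
    have "K.cs ?x p \<noteq> 0" using K.lens_iff_chord[OF x cK] True by simp
    then consider "K.cs ?x p > 0" | "K.cs ?x p < 0" by linarith
    then show ?thesis
    proof cases
      case 1 then show ?thesis using L.pl_mi[OF x L] by (intro exI[of _ "L.pl ?x"]) (simp add: mate_def)
    next
      case 2 then show ?thesis using L.pl_mi[OF x L] by (intro exI[of _ "L.mi ?x"]) (simp add: mate_def)
    qed
  next
    case False
    define t where "t n = real (Suc n) / real (Suc (Suc n))" for n
    have t: "0 < t n" "t n < 1" for n by (auto simp: t_def divide_simps)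
    have t1: "t \<longlonglongrightarrow> 1" unfolding t_def using LIMSEQ_Suc[OF LIMSEQ_n_over_Suc_n] by simp
    have tx: "t n *\<^sub>R ?x \<noteq> 0" "L.lens (t n *\<^sub>R ?x)" for n
      using K.lens_shrink[OF cK x t] t(1)[of n] x lens_eq by auto
    define a where "a n = L.pl (t n *\<^sub>R ?x)" for n
    have a: "L.chord (t n *\<^sub>R ?x) (a n)" for n unfolding a_def by (rule L.pl_mi(1)[OF tx])
    then have "\<forall>n. a n \<in> frontier L" by (simp add: L.chord_def)
    then obtain l r where r: "strict_mono r" "(a \<circ> r) \<longlonglongrightarrow> l"
      using L.compact_frontier_K unfolding compact_def by metis
    have "(\<lambda>n. t (r n)) \<longlonglongrightarrow> 1" using LIMSEQ_subseq_LIMSEQ[OF t1 r(1)] by (simp add: comp_def)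
    then have lim: "(\<lambda>n. t (r n) *\<^sub>R ?x) \<longlonglongrightarrow> 1 *\<^sub>R ?x" by (intro tendsto_scaleR tendsto_const)
    have l: "L.chord ?x l" using L.tendsto_chord(1)[OF lim r(2)] a by (simp add: comp_def)
    moreover have "K.cs ?x p = 0" using K.lens_iff_chord[OF x cK] False by simp
    ultimately show ?thesis
      using chord_sign_zero_eq[OF x cK l] by (intro exI[of _ l]) (simp add: mate_def)
  qed
qed

text \<open>The parallelograms of \<open>p - z\<close> in the two bodies are translates of each other, so the diagonals that
  end in \<open>p\<close> and in \<open>q\<close> have the same vector, and \<open>co\<close> says that they have the same sign. The opposite
  vertex is \<open>z - D\<close> for the second side vector \<open>D\<close>, and \<open>D\<close> points to the outside of the tangent at \<open>p\<close>.\<close>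
lemma mate_opposite_pos:
  assumes p: "p \<in> frontier K" and z: "z \<in> frontier K" and ne: "p \<noteq> z"
    and pos: "K.cs (p - z) p > 0" and m: "mate p z q"
    and co: "K.diag (p - z) * L.diag (p - z) \<ge> 0"
  shows "K.mi (p - z) - (p - z) \<in> frontier K" "K.mi (p - z) - (p - z) \<noteq> p"
    "mate p (K.mi (p - z) - (p - z)) q"
    "K.nrm p \<bullet> (K.mi (p - z) - (p - z)) < K.nrm p \<bullet> z"
proof -
  define x where "x = p - z"
  have x: "x \<noteq> 0" using ne by (simp add: x_def)
  have cK: "K.chord x p" unfolding x_def by (rule chord_K[OF p z])
  have lens: "K.lens x" "L.lens x"
    using K.lens_iff_chord[OF x cK] pos lens_eq by (simp_all add: x_def)
  have pK: "K.pl x = p" using K.pl_eqI[OF x cK] pos by (simp add: x_def)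
  have q: "L.chord x q" "L.cs x q > 0" using m pos by (auto simp: mate_def x_def sgn_1_pos)
  have qL: "L.pl x = q" by (rule L.pl_eqI[OF x q])
  define D where "D = K.pl x - K.mi x"
  define t where "t = K.mi x - x"
  note cmi = K.pl_mi[OF x lens(1)] and Lmi = L.pl_mi[OF x lens(2)]
  show tK: "K.mi (p - z) - (p - z) \<in> frontier K" using cmi(3) by (simp add: K.chord_def x_def)
  have "(K.pl x - K.mi x) \<bullet> K.nrm (K.pl x) > 0"
    by (rule K.two_chords_normals(3)[OF cmi(3,1) K.pl_neq_mi[OF x lens(1)]])
  then have "K.nrm p \<bullet> D > 0" by (simp add: D_def pK inner_commute)
  moreover have tz: "t = z - D" unfolding t_def D_def pK by (simp add: x_def)
  ultimately have low: "K.nrm p \<bullet> t < K.nrm p \<bullet> z" by (simp add: inner_diff_right)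
  then show "K.nrm p \<bullet> (K.mi (p - z) - (p - z)) < K.nrm p \<bullet> z" by (simp only: t_def x_def)
  have "K.nrm p \<bullet> z \<le> K.nrm p \<bullet> p" using K.nrm_max[OF p] z K.frontier_subset by blast
  then have tp: "t \<noteq> p" using low by auto
  then show "K.mi (p - z) - (p - z) \<noteq> p" unfolding t_def x_def .
  have pt: "p - t = x + D" by (simp add: tz x_def)
  have eqD: "L.pl x - L.mi x = D" using twin_eq[OF x lens(1)] by (simp add: D_def)
  have qt: "q - (p - t) = L.mi x - x" using eqD by (simp add: pt qL algebra_simps)
  have cLt: "L.chord (p - t) q" using q(1) Lmi(3) unfolding L.chord_def qt by simp
  have cKt: "K.chord (p - t) p" by (rule chord_K[OF p]) (use tK in \<open>simp add: t_def x_def\<close>)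
  have "K.cs (p - t) p = K.diag x" by (simp add: K.cs_def K.diag_def pK t_def)
  moreover have "L.cs (p - t) q = L.diag x" by (simp add: L.cs_def L.diag_def qL qt)
  moreover have "K.cs (p - t) p = 0 \<longleftrightarrow> L.cs (p - t) q = 0"
    by (rule chord_sign_zero_eq[OF _ cKt cLt]) (use tp in simp)
  ultimately have "sgn (L.cs (p - t) q) = sgn (K.cs (p - t) p)"
    using co by (intro sgn_eqI) (auto simp: x_def mult.commute)
  then have "mate p t q" using cLt by (simp add: mate_def)
  then show "mate p (K.mi (p - z) - (p - z)) q" by (simp only: t_def x_def)
qed

text \<open>Here the chord from \<open>z\<close> to \<open>p\<close> is the one with the head \<open>K.mi\<close>. The other neighbour \<open>w\<close> of \<open>p\<close> in
  the parallelogram lies on the positive side of \<open>p\<close>, has the same mate because the second side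
  vectors agree in \<open>K\<close> and \<open>L\<close>, and leads to the same vertex opposite to \<open>p\<close>.\<close>
lemma mate_adjacent:
  assumes p: "p \<in> frontier K" and z: "z \<in> frontier K" and ne: "p \<noteq> z"
    and neg: "K.cs (p - z) p < 0" and m: "mate p z q"
  shows "\<exists>w. w \<in> frontier K \<and> p \<noteq> w \<and> K.cs (p - w) p > 0 \<and> mate p w q \<and>
    K.nrm p \<bullet> (K.mi (p - w) - (p - w)) < K.nrm p \<bullet> z"
proof -
  define x where "x = p - z"
  have x: "x \<noteq> 0" using ne by (simp add: x_def)
  have cK: "K.chord x p" unfolding x_def by (rule chord_K[OF p z])
  have lens: "K.lens x" "L.lens x"
    using K.lens_iff_chord[OF x cK] neg lens_eq by (simp_all add: x_def)
  have pK: "K.mi x = p" using K.mi_eqI[OF x cK] neg by (simp add: x_def)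
  have q: "L.chord x q" "L.cs x q < 0" using m neg by (auto simp: mate_def x_def sgn_1_neg)
  have qL: "L.mi x = q" by (rule L.mi_eqI[OF x q])
  note c = K.pl_mi[OF x lens(1)] and cL = L.pl_mi[OF x lens(2)]
  define D where "D = K.pl x - K.mi x"
  have eqD: "L.pl x - L.mi x = D" using twin_eq[OF x lens(1)] by (simp add: D_def)
  define w where "w = K.pl x"
  have wD: "p - w = - D" by (simp add: w_def D_def pK)
  have wp: "w \<noteq> p" using K.pl_neq_mi[OF x lens(1)] pK by (auto simp: w_def)
  have wK: "w \<in> frontier K" using c by (simp add: w_def K.chord_def)
  have posK: "cr x D > 0" using K.cr_pl_mi[OF x lens(1)] by (simp add: D_def)
  note sK = K.two_chords_signs(3,4)[OF c(3,1) K.pl_neq_mi[OF x lens(1)] x]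
  note sL = L.two_chords_signs(3)[OF cL(3,1) L.pl_neq_mi[OF x lens(2)] x]
  have s1: "cr (K.nrm w) (K.nrm p) * cr x D < 0" using sK(1) by (simp only: D_def pK w_def)
  have s2: "cr (L.nrm (L.pl x)) (L.nrm q) * cr x D < 0" using sL by (simp only: eqD) (simp only: qL)
  have s3: "cr (K.nrm (w - x)) (K.nrm (p - x)) * cr x D > 0" using sK(2) by (simp only: D_def pK w_def)
  note pos_if = zero_less_mult_pos2[OF _ posK]
  have 1: "cr (K.nrm p) (K.nrm w) > 0"
    by (rule pos_if) (use s1 cr_swap[of "K.nrm w" "K.nrm p"] in simp)
  have 2: "cr (L.nrm q) (L.nrm (L.pl x)) > 0"
    by (rule pos_if) (use s2 cr_swap[of "L.nrm (L.pl x)" "L.nrm q"] in simp)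
  have "p - x = z" by (simp add: x_def)
  then have 3: "cr (K.nrm (w - x)) (K.nrm z) > 0"
    using pos_if[OF s3] by simp
  have csw: "K.cs (p - w) p > 0" using 1 by (simp add: K.cs_def)
  have qw: "q - (p - w) = L.pl x" using eqD by (simp add: wD qL algebra_simps)
  have "L.chord (p - w) q" using q(1) cL(1) unfolding L.chord_def qw by simp
  moreover have "L.cs (p - w) q > 0" using 2 by (simp add: L.cs_def qw)
  ultimately have mw: "mate p w q" using csw by (simp add: mate_def)
  have "K.mi (p - w) = z"
  proof (rule K.mi_eqI)
    show "p - w \<noteq> 0" using wp by simp
    have zw: "z - (p - w) = w - x" by (simp add: x_def)
    show "K.chord (p - w) z" unfolding K.chord_def zw using z c(1) by (simp add: K.chord_def w_def)
    show "K.cs (p - w) z < 0" using 3 cr_swap[of "K.nrm (w - x)" "K.nrm z"] by (simp add: K.cs_def zw)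
  qed
  then have opp: "K.mi (p - w) - (p - w) = z + D" by (simp add: wD)
  have "(K.pl x - K.mi x) \<bullet> K.nrm (K.mi x) < 0"
    by (rule K.two_chords_normals(1)[OF c(3,1) K.pl_neq_mi[OF x lens(1)]])
  then have "K.nrm p \<bullet> (K.mi (p - w) - (p - w)) < K.nrm p \<bullet> z"
    unfolding opp by (simp add: D_def pK inner_commute inner_add_right)
  then show ?thesis using wK wp csw mw by (intro exI[of _ w]) simp
qed

text \<open>Walking to the opposite vertex strictly descends in the direction of the normal at \<open>p\<close>, so a lowest
  point with a given mate can only be the antipode of \<open>p\<close>. Hence all points of the boundary of \<open>K\<close>
  have the same mate \<open>q0\<close>, and \<open>q0 - (p - z)\<close> is on the boundary of \<open>L\<close> for all \<open>z\<close>.\<close>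
theorem coherent_translate:
  assumes p: "p \<in> frontier K"
    and co: "\<And>z. z \<in> frontier K \<Longrightarrow> p \<noteq> z \<Longrightarrow> K.cs (p - z) p > 0 \<Longrightarrow> K.diag (p - z) * L.diag (p - z) \<ge> 0"
  shows "\<exists>v. \<forall>z\<in>frontier K - {p}. z + v \<in> frontier L"
proof -
  have step: "\<exists>t\<in>frontier K. mate p t q \<and> K.nrm p \<bullet> t < K.nrm p \<bullet> z"
    if z: "z \<in> frontier K" "p \<noteq> z" "K.cs (p - z) p \<noteq> 0" "mate p z q" for z q
  proof (cases "K.cs (p - z) p > 0")
    case True
    show ?thesis using mate_opposite_pos(1,3,4)[OF p z(1,2) True z(4) co[OF z(1,2) True]] by blast
  next
    case False
    then have "K.cs (p - z) p < 0" using z(3) by simp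
    then obtain w where w: "w \<in> frontier K" "p \<noteq> w" "K.cs (p - w) p > 0" "mate p w q"
      "K.nrm p \<bullet> (K.mi (p - w) - (p - w)) < K.nrm p \<bullet> z"
      using mate_adjacent[OF p z(1,2) _ z(4)] by blast
    show ?thesis
      using mate_opposite_pos(1,3,4)[OF p w(1-4) co[OF w(1-3)]] w(5) less_trans by blast
  qed
  define p' where "p' = K.contact (- K.nrm p)"
  have np: "norm (K.nrm p) = 1" "K.nrm p \<noteq> 0" using K.norm_nrm[OF p] K.nrm_nz[OF p] by auto
  have p'K: "p' \<in> frontier K" unfolding p'_def by (rule K.contact_frontier) (use np in simp)
  have antipode: "z = p'" if "z \<in> frontier K" "p \<noteq> z" "K.cs (p - z) p = 0" for z
  proof -
    have "K.nrm (p - (p - z)) = - K.nrm p"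
      using that by (intro K.cs_zero_antipodal chord_K p) auto
    then show ?thesis using K.contact_nrm[OF that(1)] by (simp add: p'_def)
  qed
  have main: "mate p p' q" if z: "z \<in> frontier K" "p \<noteq> z" "mate p z q" for z q
  proof -
    define S where "S = {y \<in> frontier K. K.nrm p \<bullet> y \<le> K.nrm p \<bullet> z \<and> mate p y q}"
    have hz: "K.nrm p \<bullet> z < K.nrm p \<bullet> p"
      using K.nrm_strict[OF p, of z] z K.frontier_subset by (auto simp: inner_diff_right)
    have nep: "p \<noteq> y" if "K.nrm p \<bullet> y \<le> K.nrm p \<bullet> z" for y using hz that by auto
    have "closed S"
      unfolding closed_sequential_limits
    proof (intro allI impI)
      fix y l assume "(\<forall>n. y n \<in> S) \<and> y \<longlonglongrightarrow> l"
      then have y: "\<And>n. y n \<in> frontier K" "\<And>n. K.nrm p \<bullet> y n \<le> K.nrm p \<bullet> z" "\<And>n. mate p (y n) q" "y \<longlonglongrightarrow> l"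
        by (auto simp: S_def)
      have lK: "l \<in> frontier K" using closed_sequentially[OF _ _ y(4), of "frontier K"] y(1) by simp
      have hl: "K.nrm p \<bullet> l \<le> K.nrm p \<bullet> z"
        by (rule LIMSEQ_le_const2[of "\<lambda>n. K.nrm p \<bullet> y n"]) (use y in \<open>auto intro!: tendsto_intros\<close>)
      have lx: "(\<lambda>n. p - y n) \<longlonglongrightarrow> p - l" using y(4) by (intro tendsto_intros)
      have ck: "K.chord (p - y n) p" and cl: "L.chord (p - y n) q" for n
        using chord_K[OF p y(1)] y(3)[of n] by (auto simp: mate_def)
      note tK = K.tendsto_chord[OF lx tendsto_const ck] and tL = L.tendsto_chord[OF lx tendsto_const cl]
      have "0 \<le> L.cs (p - y n) q * K.cs (p - y n) p" for n
        using y(3)[of n] by (intro sgn_eq_mult_nonneg) (simp add: mate_def)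
      then have "0 \<le> L.cs (p - l) q * K.cs (p - l) p"
        by (intro LIMSEQ_le_const[OF tendsto_mult[OF tL(2) tK(2)]]) auto
      moreover have "K.cs (p - l) p = 0 \<longleftrightarrow> L.cs (p - l) q = 0"
        by (rule chord_sign_zero_eq[OF _ tK(1) tL(1)]) (use nep[OF hl] in simp)
      ultimately have "sgn (L.cs (p - l) q) = sgn (K.cs (p - l) p)" by (intro sgn_eqI) auto
      then have "mate p l q" using tL(1) by (simp add: mate_def)
      then show "l \<in> S" using lK hl by (simp add: S_def)
    qed
    then have "compact (frontier K \<inter> S)" by (rule compact_Int_closed[OF K.compact_frontier_K])
    moreover have "frontier K \<inter> S = S" by (auto simp: S_def)
    ultimately have "compact S" by simp
    moreover have "S \<noteq> {}" using z by (auto simp: S_def)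
    moreover have "continuous_on S (\<lambda>y. K.nrm p \<bullet> y)" by (intro continuous_intros)
    ultimately obtain y where y: "y \<in> S" "\<forall>t\<in>S. K.nrm p \<bullet> y \<le> K.nrm p \<bullet> t"
      using continuous_attains_inf[of S "\<lambda>y. K.nrm p \<bullet> y"] by blast
    have yS: "y \<in> frontier K" "K.nrm p \<bullet> y \<le> K.nrm p \<bullet> z" "mate p y q" using y(1) by (auto simp: S_def)
    have "K.cs (p - y) p = 0"
    proof (rule ccontr)
      assume "K.cs (p - y) p \<noteq> 0"
      then obtain t where t: "t \<in> frontier K" "mate p t q" "K.nrm p \<bullet> t < K.nrm p \<bullet> y"
        using step[OF yS(1) nep[OF yS(2)] _ yS(3)] by blast
      then have "t \<in> S" using yS(2) by (simp add: S_def)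
      then show False using y(2) t(3) by force
    qed
    then show ?thesis using antipode[OF yS(1) nep[OF yS(2)]] yS(3) by simp
  qed
  have pp': "p \<noteq> p'"
  proof
    assume "p = p'"
    then have "K.nrm p = - K.nrm p" using K.nrm_contact[of "- K.nrm p"] np by (simp add: p'_def)
    then have "K.nrm p \<bullet> K.nrm p = K.nrm p \<bullet> (- K.nrm p)" by (rule arg_cong)
    then show False using np by simp
  qed
  obtain q0 where q0: "mate p p' q0" using mate_exists[OF p p'K pp'] by blast
  have "z + (q0 - p) \<in> frontier L" if z: "z \<in> frontier K" "z \<noteq> p" for z
  proof -
    have pz: "p \<noteq> z" using z by simp
    obtain q where q: "mate p z q" using mate_exists[OF p z(1) pz] by blast
    have "q = q0" using mate_unique[OF pp' main[OF z(1) pz q] q0] .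
    then have "q0 - (p - z) \<in> frontier L" using q by (simp add: mate_def L.chord_def)
    then show ?thesis by (simp add: algebra_simps)
  qed
  then show ?thesis by blast
qed

end

section \<open>Transversal curves\<close>

definition dir :: "real \<Rightarrow> real^2" where
  "dir \<theta> = vector [cos \<theta>, sin \<theta>]"

lemma norm_dir [simp]: "norm (dir \<theta>) = 1"
  by (simp add: norm_eq_sqrt_inner inner_plane dir_def power2_eq_square[symmetric])

lemma cr_dir: "cr (dir a) (dir b) = sin (b - a)"
  by (simp add: cr_def dir_def sin_diff)

lemma dir_add_pi: "dir (\<theta> + pi) = - dir \<theta>"
  by (rule plane_eqI) (simp_all add: dir_def)

lemma continuous_dir [continuous_intros]:
  fixes f :: "'a::t2_space \<Rightarrow> real"
  shows "continuous_on S f \<Longrightarrow> continuous_on S (\<lambda>x. dir (f x))"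
proof -
  have "dir \<theta> = cos \<theta> *\<^sub>R axis 1 1 + sin \<theta> *\<^sub>R axis 2 1" for \<theta>
    by (rule plane_eqI) (simp_all add: dir_def axis_def)
  then show "continuous_on S f \<Longrightarrow> continuous_on S (\<lambda>x. dir (f x))"
    by (simp only:) (intro continuous_intros)
qed

lemma unit_dir: "norm u = 1 \<Longrightarrow> \<exists>\<theta>. u = dir \<theta>"
proof -
  assume "norm u = 1"
  then have "(u$1)\<^sup>2 + (u$2)\<^sup>2 = 1"
    by (simp add: norm_eq_sqrt_inner inner_plane power2_eq_square)
  then obtain t where "u$1 = cos t" "u$2 = sin t" using sincos_total_2pi by metis
  then have "u = dir t" by (intro plane_eqI) (simp_all add: dir_def)
  then show ?thesis by blast
qed

lemma norm_rot [simp]: "norm (rot u) = norm u"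
  by (simp add: norm_eq_sqrt_inner inner_plane rot_def algebra_simps)

lemma cr_decompose: "cr u u' *\<^sub>R w = (w \<bullet> u') *\<^sub>R rot u - (w \<bullet> u) *\<^sub>R rot u'"
  by (rule plane_eqI) (simp_all add: cr_def inner_plane rot_def algebra_simps)

text \<open>A vector is determined by its components along two transversal directions.\<close>
lemma norm_le_transversal:
  assumes "norm u = 1" "norm u' = 1" "\<sigma> > 0" "\<bar>cr u u'\<bar> \<ge> \<sigma>" "\<bar>w \<bullet> u\<bar> \<le> e" "\<bar>w \<bullet> u'\<bar> \<le> e"
  shows "norm w \<le> 2 * e / \<sigma>"
proof -
  have "\<sigma> * norm w \<le> \<bar>cr u u'\<bar> * norm w" using assms by (intro mult_right_mono) auto
  also have "\<dots> = norm ((w \<bullet> u') *\<^sub>R rot u - (w \<bullet> u) *\<^sub>R rot u')"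
    unfolding cr_decompose[symmetric] by simp
  also have "\<dots> \<le> norm ((w \<bullet> u') *\<^sub>R rot u) + norm ((w \<bullet> u) *\<^sub>R rot u')" by (rule norm_triangle_ineq4)
  also have "\<dots> \<le> e + e" using assms by simp
  finally show ?thesis using assms(3) by (simp add: le_divide_eq mult.commute)
qed

lemma card_ints_near: "finite {b::int. \<bar>x - real_of_int b\<bar> \<le> 3} \<and> card {b::int. \<bar>x - real_of_int b\<bar> \<le> 3} \<le> 7"
proof -
  have "{b::int. \<bar>x - real_of_int b\<bar> \<le> 3} \<subseteq> {\<lceil>x - 3\<rceil>..\<lceil>x - 3\<rceil> + 6}"
    by (auto simp: abs_le_iff) linarith+
  moreover have "card {\<lceil>x - 3\<rceil>..\<lceil>x - 3\<rceil> + 6} = 7" by simp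
  ultimately show ?thesis by (metis card_mono finite_atLeastAtMost_int finite_subset)
qed

text \<open>Cut both curves into \<open>N\<close> short pieces. By transversality two pieces meet in a set of diameter
  \<open>o(1/N)\<close>, so the pieces of the first curve that meet at most \<open>M\<close> pieces of the second contribute
  little. A point of a piece that meets more than \<open>M\<close> pieces of the second is projected into a cell of
  length \<open>H\<close>, of the order \<open>1/N\<close>, near which more than \<open>M\<close> of these pieces start; there are at most a
  constant times \<open>N / M\<close> such cells.\<close>
lemma null_transversal:
  fixes \<Gamma> \<Gamma>' :: "real \<Rightarrow> real^2" and \<Theta> \<Theta>' :: "real \<Rightarrow> real"
  assumes AB: "A \<le> B" "A' \<le> B'"
    and lip: "\<And>r s. r \<in> {A..B} \<Longrightarrow> s \<in> {A..B} \<Longrightarrow> norm (\<Gamma> r - \<Gamma> s) \<le> \<bar>r - s\<bar>"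
    and lip': "\<And>r s. r \<in> {A'..B'} \<Longrightarrow> s \<in> {A'..B'} \<Longrightarrow> norm (\<Gamma>' r - \<Gamma>' s) \<le> \<bar>r - s\<bar>"
    and tan: "\<And>r s. r \<in> {A..B} \<Longrightarrow> s \<in> {A..B} \<Longrightarrow> \<bar>(\<Gamma> r - \<Gamma> s) \<bullet> dir (\<Theta> s)\<bar> \<le> \<bar>\<Theta> r - \<Theta> s\<bar> * \<bar>r - s\<bar>"
    and tan': "\<And>r s. r \<in> {A'..B'} \<Longrightarrow> s \<in> {A'..B'} \<Longrightarrow> \<bar>(\<Gamma>' r - \<Gamma>' s) \<bullet> dir (\<Theta>' s)\<bar> \<le> \<bar>\<Theta>' r - \<Theta>' s\<bar> * \<bar>r - s\<bar>"
    and cont: "continuous_on {A..B} \<Theta>" "continuous_on {A'..B'} \<Theta>'"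
    and \<sigma>: "\<sigma> > 0" "\<And>r s. r \<in> {A..B} \<Longrightarrow> s \<in> {A'..B'} \<Longrightarrow> \<bar>sin (\<Theta>' s - \<Theta> r)\<bar> \<ge> \<sigma>"
    and v: "norm v \<le> 1"
  shows "negligible ((\<lambda>y. y \<bullet> v) ` (\<Gamma> ` {A..B} \<inter> \<Gamma>' ` {A'..B'}))"
  unfolding negligible_outer_le
proof (intro allI impI)
  fix \<epsilon> :: real assume \<epsilon>: "\<epsilon> > 0"
  define W where "W = (B - A) + (B' - A') + 1"
  have W: "W > 0" "B - A \<le> W" "B' - A' \<le> W" using AB by (auto simp: W_def)
  \<comment> \<open>there are at most \<open>7 N / (M + 1)\<close> heavy cells, each covered by an interval of length \<open>4 H\<close> with \<open>N H = W\<close>; hence the constant 28\<close>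
  obtain M :: nat where M: "56 * W / \<epsilon> < real M" using reals_Archimedean2 by blast
  have M0: "real M > 0" using M W \<epsilon> by (smt (verit) divide_pos_pos)
  have M28: "28 * W / (real M + 1) \<le> \<epsilon> / 2"
    using M W \<epsilon> by (simp add: field_simps)
  \<comment> \<open>at most \<open>N M\<close> pairs of pieces meet on light pieces, each in a set of diameter \<open>2 \<eta> H / \<sigma>\<close>\<close>
  define \<eta> where "\<eta> = \<epsilon> * \<sigma> / (8 * real M * W)"
  have \<eta>: "\<eta> > 0" using \<epsilon> \<sigma> M0 W by (simp add: \<eta>_def)
  have M\<eta>: "4 * real M * \<eta> * W / \<sigma> = \<epsilon> / 2" using \<sigma>(1) M0 W by (simp add: \<eta>_def)
  have "uniformly_continuous_on {A..B} \<Theta>" "uniformly_continuous_on {A'..B'} \<Theta>'"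
    using cont compact_uniformly_continuous by blast+
  then obtain d d' where d: "d > 0" "\<forall>r\<in>{A..B}. \<forall>s\<in>{A..B}. dist s r < d \<longrightarrow> dist (\<Theta> s) (\<Theta> r) < \<eta>"
    and d': "d' > 0" "\<forall>r\<in>{A'..B'}. \<forall>s\<in>{A'..B'}. dist s r < d' \<longrightarrow> dist (\<Theta>' s) (\<Theta>' r) < \<eta>"
    unfolding uniformly_continuous_on_def using \<eta> by metis
  obtain N :: nat where N: "W / min d d' < real N" using reals_Archimedean2 by blast
  have N0: "real N > 0" using N W d(1) d'(1) by (smt (verit) divide_pos_pos)
  define H where "H = W / real N"
  have "W < min d d' * real N" using N d(1) d'(1) by (simp add: divide_less_eq mult.commute)
  then have "H < min d d'" unfolding H_def using pos_divide_less_eq[OF N0] by blast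
  then have H: "H > 0" "H < d" "H < d'" "real N * H = W"
    using N0 W by (simp_all add: H_def)
  define I where "I i = {r \<in> {A..B}. A + real i * H \<le> r \<and> r \<le> A + (real i + 1) * H}" for i :: nat
  define I' where "I' j = {r \<in> {A'..B'}. A' + real j * H \<le> r \<and> r \<le> A' + (real j + 1) * H}" for j :: nat
  have cover: "\<exists>i<N. a + real i * H \<le> r \<and> r \<le> a + (real i + 1) * H" if r: "a \<le> r" "r \<le> b" "b - a < W" for a b r
  proof -
    define i where "i = nat \<lfloor>(r - a) / H\<rfloor>"
    have nn: "0 \<le> (r - a) / H" using r H by simp
    then have i: "real i \<le> (r - a) / H" "(r - a) / H < real i + 1"
      unfolding i_def by (simp_all add: of_nat_nat)
    have "(r - a) / H < real N" using r H by (simp add: divide_less_eq)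
    then have "i < N" using i(1) by linarith
    moreover have "real i * H \<le> r - a" "r - a \<le> (real i + 1) * H"
      using i H by (simp_all add: le_divide_eq divide_less_eq)
    ultimately show ?thesis by (intro exI[of _ i]) simp
  qed
  have I_near: "\<bar>r - s\<bar> \<le> H" if "r \<in> I i" "s \<in> I i" for r s i
    using that by (auto simp: I_def algebra_simps abs_le_iff)
  have I'_near: "\<bar>r - s\<bar> \<le> H" if "r \<in> I' i" "s \<in> I' i" for r s i
    using that by (auto simp: I'_def algebra_simps abs_le_iff)
  define C where "C i j = \<Gamma> ` I i \<inter> \<Gamma>' ` I' j" for i j
  have small: "\<bar>y \<bullet> v - z \<bullet> v\<bar> \<le> 2 * (\<eta> * H) / \<sigma>" if yz: "y \<in> C i j" "z \<in> C i j" for y z i j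
  proof -
    obtain r s r' s' where rs: "r \<in> I i" "s \<in> I i" "y = \<Gamma> r" "z = \<Gamma> s" "r' \<in> I' j" "s' \<in> I' j" "y = \<Gamma>' r'" "z = \<Gamma>' s'"
      using yz unfolding C_def by blast
    have in_: "r \<in> {A..B}" "s \<in> {A..B}" "r' \<in> {A'..B'}" "s' \<in> {A'..B'}" using rs by (auto simp: I_def I'_def)
    have n: "\<bar>r - s\<bar> \<le> H" "\<bar>r' - s'\<bar> \<le> H" using I_near I'_near rs by auto
    have "dist (\<Theta> r) (\<Theta> s) < \<eta>" "dist (\<Theta>' r') (\<Theta>' s') < \<eta>"
      using d(2) d'(2) in_ n H by (auto simp: dist_real_def)
    then have th: "\<bar>\<Theta> r - \<Theta> s\<bar> \<le> \<eta>" "\<bar>\<Theta>' r' - \<Theta>' s'\<bar> \<le> \<eta>" by (auto simp: dist_real_def)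
    have "\<bar>(y - z) \<bullet> dir (\<Theta> s)\<bar> \<le> \<bar>\<Theta> r - \<Theta> s\<bar> * \<bar>r - s\<bar>" unfolding rs(3,4) by (rule tan[OF in_(1,2)])
    also have "\<dots> \<le> \<eta> * H" using th n \<eta> by (intro mult_mono) auto
    finally have 1: "\<bar>(y - z) \<bullet> dir (\<Theta> s)\<bar> \<le> \<eta> * H" .
    have "\<bar>(y - z) \<bullet> dir (\<Theta>' s')\<bar> \<le> \<bar>\<Theta>' r' - \<Theta>' s'\<bar> * \<bar>r' - s'\<bar>" unfolding rs(7,8) by (rule tan'[OF in_(3,4)])
    also have "\<dots> \<le> \<eta> * H" using th n \<eta> by (intro mult_mono) auto
    finally have 2: "\<bar>(y - z) \<bullet> dir (\<Theta>' s')\<bar> \<le> \<eta> * H" .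
    have "norm (y - z) \<le> 2 * (\<eta> * H) / \<sigma>"
      by (rule norm_le_transversal[OF norm_dir norm_dir \<sigma>(1) _ 1 2]) (use \<sigma>(2)[OF in_(2,4)] in \<open>simp add: cr_dir\<close>)
    moreover have "\<bar>y \<bullet> v - z \<bullet> v\<bar> \<le> norm (y - z) * norm v"
      unfolding inner_diff_left[symmetric] by (rule Cauchy_Schwarz_ineq2)
    moreover have "norm (y - z) * norm v \<le> norm (y - z)" using v by (simp add: mult_left_le)
    ultimately show ?thesis by linarith
  qed
  define R where "R i = {j. j < N \<and> C i j \<noteq> {}}" for i
  have finR: "finite (R i)" for i by (simp add: R_def)
  define light where "light = (SIGMA i:{i. i < N \<and> card (R i) \<le> M}. R i)"
  have fin_light: "finite light" unfolding light_def by (intro finite_SigmaI finR) simp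
  have "card light = (\<Sum>i\<in>{i. i < N \<and> card (R i) \<le> M}. card (R i))"
    unfolding light_def by (rule card_SigmaI) (auto simp: finR)
  also have "\<dots> \<le> (\<Sum>i\<in>{i. i < N \<and> card (R i) \<le> M}. M)" by (rule sum_mono) simp
  also have "\<dots> = card {i. i < N \<and> card (R i) \<le> M} * M" by simp
  also have "\<dots> \<le> card {i. i < N} * M" by (intro mult_right_mono card_mono) auto
  finally have card_light: "card light \<le> N * M" by simp
  \<comment> \<open>the starting points of the pieces of the second curve, projected and measured in cells of length \<open>H\<close>\<close>
  define g where "g j = (\<Gamma>' (A' + real j * H) \<bullet> v) / H" for j :: nat
  define Q where "Q b = {j. j < N \<and> \<bar>g j - real_of_int b\<bar> \<le> 3}" for b :: int
  define heavy where "heavy = {b. M < card (Q b)}"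
  have finQ: "finite (Q b)" for b by (simp add: Q_def)
  have fin_heavy: "finite heavy"
  proof (rule finite_subset)
    show "heavy \<subseteq> (\<Union>j<N. {b. \<bar>g j - real_of_int b\<bar> \<le> 3})"
    proof
      fix b assume "b \<in> heavy"
      then have "Q b \<noteq> {}" by (auto simp: heavy_def)
      then show "b \<in> (\<Union>j<N. {b. \<bar>g j - real_of_int b\<bar> \<le> 3})" by (auto simp: Q_def)
    qed
  qed (use card_ints_near in blast)
  have "card heavy * (M + 1) = (\<Sum>b\<in>heavy. M + 1)" by simp
  also have "\<dots> \<le> (\<Sum>b\<in>heavy. card (Q b))" by (rule sum_mono) (simp add: heavy_def)
  also have "\<dots> = (\<Sum>b\<in>heavy. \<Sum>j<N. if \<bar>g j - real_of_int b\<bar> \<le> 3 then 1 else 0)"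
    by (rule sum.cong[OF refl]) (simp add: Q_def sum.If_cases Int_def)
  also have "\<dots> = (\<Sum>j<N. \<Sum>b\<in>heavy. if \<bar>g j - real_of_int b\<bar> \<le> 3 then 1 else 0)" by (rule sum.swap)
  also have "\<dots> \<le> (\<Sum>j<N. 7)"
  proof (rule sum_mono)
    fix j
    have "(\<Sum>b\<in>heavy. if \<bar>g j - real_of_int b\<bar> \<le> 3 then 1 else (0::nat)) = card (heavy \<inter> {b. \<bar>g j - real_of_int b\<bar> \<le> 3})"
      using fin_heavy by (simp add: sum.If_cases)
    also have "\<dots> \<le> card {b. \<bar>g j - real_of_int b\<bar> \<le> 3}" using card_ints_near by (intro card_mono) auto
    also have "\<dots> \<le> 7" using card_ints_near by blast
    finally show "(\<Sum>b\<in>heavy. if \<bar>g j - real_of_int b\<bar> \<le> 3 then 1 else (0::nat)) \<le> 7" .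
  qed
  finally have "card heavy * (M + 1) \<le> N * 7" by simp
  then have "real (card heavy) * (real M + 1) \<le> 7 * real N" by (metis of_nat_1 of_nat_add of_nat_le_iff of_nat_mult of_nat_numeral mult.commute)
  then have card_heavy: "real (card heavy) \<le> 7 * real N / (real M + 1)" using M0 by (simp add: le_divide_eq)
  define y0 where "y0 p = (SOME y. y \<in> C (fst p) (snd p))" for p
  define \<rho> where "\<rho> = 2 * (\<eta> * H) / \<sigma>"
  have \<rho>: "\<rho> \<ge> 0" using \<eta> H \<sigma> by (simp add: \<rho>_def)
  define T1 where "T1 = (\<Union>p\<in>light. {y0 p \<bullet> v - \<rho> .. y0 p \<bullet> v + \<rho>})"
  define T2 where "T2 = (\<Union>b\<in>heavy. {real_of_int b * H - 2 * H .. real_of_int b * H + 2 * H})"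
  have m1: "T1 \<in> lmeasurable" "measure lebesgue T1 \<le> \<epsilon> / 2"
  proof -
    show "T1 \<in> lmeasurable" unfolding T1_def using fin_light by (intro fmeasurable.finite_UN) auto
    have "measure lebesgue T1 \<le> (\<Sum>p\<in>light. measure lebesgue {y0 p \<bullet> v - \<rho> .. y0 p \<bullet> v + \<rho>})"
      unfolding T1_def using fin_light by (intro measure_UNION_le) auto
    also have "\<dots> = real (card light) * (2 * \<rho>)" using \<rho> by simp
    also have "\<dots> \<le> real (N * M) * (2 * \<rho>)" using \<rho> by (intro mult_right_mono of_nat_mono card_light) simp
    also have "\<dots> = 4 * real M * \<eta> * (real N * H) / \<sigma>" by (simp add: \<rho>_def)
    also have "\<dots> = \<epsilon> / 2" unfolding H(4) by (rule M\<eta>)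
    finally show "measure lebesgue T1 \<le> \<epsilon> / 2" .
  qed
  have m2: "T2 \<in> lmeasurable" "measure lebesgue T2 \<le> \<epsilon> / 2"
  proof -
    show "T2 \<in> lmeasurable" unfolding T2_def using fin_heavy by (intro fmeasurable.finite_UN) auto
    have "measure lebesgue T2 \<le> (\<Sum>b\<in>heavy. measure lebesgue {real_of_int b * H - 2 * H .. real_of_int b * H + 2 * H})"
      unfolding T2_def using fin_heavy by (intro measure_UNION_le) auto
    also have "\<dots> = real (card heavy) * (4 * H)" using H by simp
    also have "\<dots> \<le> (7 * real N / (real M + 1)) * (4 * H)" using card_heavy H by (intro mult_right_mono) auto
    also have "\<dots> = 28 * (real N * H) / (real M + 1)" by simp
    also have "\<dots> \<le> \<epsilon> / 2" unfolding H(4) by (rule M28)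
    finally show "measure lebesgue T2 \<le> \<epsilon> / 2" .
  qed
  have sub: "(\<lambda>y. y \<bullet> v) ` (\<Gamma> ` {A..B} \<inter> \<Gamma>' ` {A'..B'}) \<subseteq> T1 \<union> T2"
  proof
    fix x assume "x \<in> (\<lambda>y. y \<bullet> v) ` (\<Gamma> ` {A..B} \<inter> \<Gamma>' ` {A'..B'})"
    then obtain y r r' where y: "x = y \<bullet> v" "r \<in> {A..B}" "y = \<Gamma> r" "r' \<in> {A'..B'}" "y = \<Gamma>' r'" by blast
    obtain i where i: "i < N" "r \<in> I i" using cover[of A r B] y(2) AB by (auto simp: I_def W_def)
    obtain j where j: "j < N" "r' \<in> I' j" using cover[of A' r' B'] y(4) AB by (auto simp: I'_def W_def)
    have yC: "y \<in> C i j" using i j y unfolding C_def by blast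
    then have jR: "j \<in> R i" using j by (auto simp: R_def)
    show "x \<in> T1 \<union> T2"
    proof (cases "card (R i) \<le> M")
      case True
      then have p: "(i, j) \<in> light" using i jR by (simp add: light_def)
      have "y0 (i, j) \<in> C i j" unfolding y0_def fst_conv snd_conv using yC by (rule someI)
      then have "\<bar>y \<bullet> v - y0 (i, j) \<bullet> v\<bar> \<le> \<rho>" unfolding \<rho>_def by (rule small[OF yC])
      then have "x \<in> {y0 (i, j) \<bullet> v - \<rho> .. y0 (i, j) \<bullet> v + \<rho>}" using y(1) by (auto simp: abs_le_iff)
      then show ?thesis using p unfolding T1_def by blast
    next
      case False
      define b where "b = \<lfloor>x / H\<rfloor>"
      have b: "real_of_int b * H \<le> x" "x < real_of_int b * H + H"
        using H floor_correct[of "x / H"] by (simp_all add: b_def le_divide_eq divide_less_eq algebra_simps)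
      have "R i \<subseteq> Q b"
      proof
        fix k assume k: "k \<in> R i"
        then obtain z s s' where z: "s \<in> I i" "z = \<Gamma> s" "s' \<in> I' k" "z = \<Gamma>' s'" unfolding R_def C_def by blast
        have kN: "k < N" using k by (simp add: R_def)
        have "norm (y - z) \<le> \<bar>r - s\<bar>" unfolding y(3) z(2) by (rule lip) (use y z in \<open>auto simp: I_def\<close>)
        then have yz: "norm (y - z) \<le> H" using I_near[OF i(2) z(1)] by linarith
        have start: "A' + real k * H \<in> I' k" using z(3) H by (auto simp: I'_def algebra_simps)
        have "norm (z - \<Gamma>' (A' + real k * H)) \<le> \<bar>s' - (A' + real k * H)\<bar>"
          unfolding z(4) by (rule lip') (use z start in \<open>auto simp: I'_def\<close>)
        then have zg: "norm (z - \<Gamma>' (A' + real k * H)) \<le> H" using I'_near[OF z(3) start] by linarith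
        have "norm (y - \<Gamma>' (A' + real k * H)) \<le> 2 * H"
          using norm_triangle_ineq[of "y - z" "z - \<Gamma>' (A' + real k * H)"] yz zg by simp
        moreover have "\<bar>y \<bullet> v - \<Gamma>' (A' + real k * H) \<bullet> v\<bar> \<le> norm (y - \<Gamma>' (A' + real k * H)) * norm v"
          unfolding inner_diff_left[symmetric] by (rule Cauchy_Schwarz_ineq2)
        moreover have "norm (y - \<Gamma>' (A' + real k * H)) * norm v \<le> norm (y - \<Gamma>' (A' + real k * H))"
          using v by (simp add: mult_left_le)
        ultimately have "\<bar>x - g k * H\<bar> \<le> 2 * H" using y(1) H by (simp add: g_def)
        then have "\<bar>g k * H - real_of_int b * H\<bar> \<le> 3 * H" using b by linarith
        then have "\<bar>g k - real_of_int b\<bar> * H \<le> 3 * H" using H by (simp add: abs_mult flip: left_diff_distrib)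
        then show "k \<in> Q b" using H kN by (simp add: Q_def)
      qed
      then have "card (R i) \<le> card (Q b)" by (intro card_mono finQ)
      then have "b \<in> heavy" using False by (simp add: heavy_def)
      moreover have "x \<in> {real_of_int b * H - 2 * H .. real_of_int b * H + 2 * H}" using b H by auto
      ultimately show ?thesis unfolding T2_def by blast
    qed
  qed
  have "measure lebesgue (T1 \<union> T2) \<le> \<epsilon>"
    using measure_Un_le[of T1 lebesgue T2] m1 m2 by (simp add: fmeasurableD)
  then show "\<exists>T. (\<lambda>y. y \<bullet> v) ` (\<Gamma> ` {A..B} \<inter> \<Gamma>' ` {A'..B'}) \<subseteq> T \<and> T \<in> lmeasurable \<and> measure lebesgue T \<le> \<epsilon>"
    using sub m1(1) m2(1) by (intro exI[of _ "T1 \<union> T2"]) auto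
qed

section \<open>Midpoints of affine diameters\<close>

lemma cos_ge_half:
  fixes x :: real
  shows "\<bar>x\<bar> \<le> 1 \<Longrightarrow> cos x \<ge> 1 / 2"
proof -
  assume "\<bar>x\<bar> \<le> 1"
  then have "cos \<bar>x\<bar> \<ge> cos (pi / 3)" using pi_gt3 by (intro cos_monotone_0_pi_le) auto
  then show ?thesis by (simp add: cos_60)
qed

text \<open>The two inequalities confine \<open>d\<close> to the narrow sector around \<open>rot (dir \<phi>)\<close> that is bounded by the
  lines orthogonal to \<open>dir \<theta>1\<close> and \<open>dir \<theta>2\<close>.\<close>
lemma between_tangents:
  assumes th: "\<theta>1 < \<theta>2" and m: "\<bar>\<phi> - \<theta>1\<bar> \<le> m" "\<bar>\<phi> - \<theta>2\<bar> \<le> m" "m \<le> 1"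
    and d: "d \<bullet> dir \<theta>1 \<le> 0" "0 \<le> d \<bullet> dir \<theta>2"
  shows "0 \<le> d \<bullet> rot (dir \<phi>)" "\<bar>d \<bullet> dir \<phi>\<bar> \<le> 2 * m * (d \<bullet> rot (dir \<phi>))"
proof -
  define a where "a = d \<bullet> dir \<phi>"
  define b where "b = d \<bullet> rot (dir \<phi>)"
  have dec: "d \<bullet> dir t = a * cos (\<phi> - t) - b * sin (\<phi> - t)" for t
  proof -
    have e: "dir t = cos (\<phi> - t) *\<^sub>R dir \<phi> - sin (\<phi> - t) *\<^sub>R rot (dir \<phi>)"
    proof (rule plane_eqI)
      have "cos t = cos (\<phi> - (\<phi> - t))" "sin t = sin (\<phi> - (\<phi> - t))" by simp_all
      then show "dir t $ 1 = (cos (\<phi> - t) *\<^sub>R dir \<phi> - sin (\<phi> - t) *\<^sub>R rot (dir \<phi>)) $ 1"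
        "dir t $ 2 = (cos (\<phi> - t) *\<^sub>R dir \<phi> - sin (\<phi> - t) *\<^sub>R rot (dir \<phi>)) $ 2"
        by (simp_all only: cos_diff[of \<phi> "\<phi> - t"] sin_diff[of \<phi> "\<phi> - t"]) (simp_all add: dir_def rot_def algebra_simps)
    qed
    show ?thesis unfolding a_def b_def by (subst e) (simp add: inner_diff_right)
  qed
  define c1 where "c1 = cos (\<phi> - \<theta>1)"
  define c2 where "c2 = cos (\<phi> - \<theta>2)"
  define s1 where "s1 = sin (\<phi> - \<theta>1)"
  define s2 where "s2 = sin (\<phi> - \<theta>2)"
  have c: "c1 \<ge> 1/2" "c2 \<ge> 1/2" unfolding c1_def c2_def using m by (intro cos_ge_half; linarith)+
  have s: "\<bar>s1\<bar> \<le> m" "\<bar>s2\<bar> \<le> m"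
    unfolding s1_def s2_def using m abs_sin_x_le_abs_x order_trans by blast+
  have 1: "a * c1 \<le> b * s1" and 2: "b * s2 \<le> a * c2"
    using d dec unfolding c1_def c2_def s1_def s2_def by auto
  have "b * s2 * c1 \<le> a * c2 * c1" using 2 c by (intro mult_right_mono) auto
  also have "\<dots> = a * c1 * c2" by simp
  also have "\<dots> \<le> b * s1 * c2" using 1 c by (intro mult_right_mono) auto
  finally have "0 \<le> b * (s1 * c2 - s2 * c1)" by (simp add: algebra_simps)
  moreover have "s1 * c2 - s2 * c1 = sin (\<theta>2 - \<theta>1)"
    using sin_diff[of "\<phi> - \<theta>1" "\<phi> - \<theta>2"] by (simp add: s1_def s2_def c1_def c2_def mult.commute)
  moreover have "sin (\<theta>2 - \<theta>1) > 0" using th m pi_gt3 by (intro sin_gt_zero) (auto simp: abs_le_iff)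
  ultimately have b: "0 \<le> b" by (simp add: zero_le_mult_iff)
  then show "0 \<le> d \<bullet> rot (dir \<phi>)" by (simp add: b_def)
  have bs: "b * s1 \<le> b * m" "- (b * m) \<le> b * s2"
    using b s mult_left_mono[of s1 m b] mult_left_mono[of "- m" s2 b] by (auto simp: abs_le_iff)
  have "\<bar>a\<bar> \<le> 2 * m * b"
  proof (cases "a \<ge> 0")
    case True
    then have "a * (1/2) \<le> a * c1" using c by (intro mult_left_mono) auto
    then have "a \<le> 2 * (b * m)" using 1 bs by linarith
    then show ?thesis using True by (simp add: algebra_simps)
  next
    case False
    then have "a * c2 \<le> a * (1/2)" using c by (intro mult_left_mono_neg) auto
    then have "- a \<le> 2 * (b * m)" using 2 bs by linarith
    then show ?thesis using False by (simp add: algebra_simps)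
  qed
  then show "\<bar>d \<bullet> dir \<phi>\<bar> \<le> 2 * m * (d \<bullet> rot (dir \<phi>))" by (simp add: a_def b_def)
qed

lemma norm_dir_components: "(norm d)\<^sup>2 = (d \<bullet> dir \<phi>)\<^sup>2 + (d \<bullet> rot (dir \<phi>))\<^sup>2"
proof -
  have "(d \<bullet> dir \<phi>)\<^sup>2 + (d \<bullet> rot (dir \<phi>))\<^sup>2 = (d \<bullet> d) * ((cos \<phi>)\<^sup>2 + (sin \<phi>)\<^sup>2)"
  proof -
    have "(x * c + y * s)\<^sup>2 + (y * c - x * s)\<^sup>2 = (x * x + y * y) * (c\<^sup>2 + s\<^sup>2)" for x y c s :: real
      by (simp add: power2_eq_square algebra_simps)
    from this[of "d$1" "cos \<phi>" "d$2" "sin \<phi>"] show ?thesis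
      by (simp add: inner_plane rot_def dir_def algebra_simps)
  qed
  then show ?thesis by (simp add: dot_square_norm)
qed

lemma between_tangents_norm:
  assumes "\<theta>1 < \<theta>2" "\<bar>\<phi> - \<theta>1\<bar> \<le> 1" "\<bar>\<phi> - \<theta>2\<bar> \<le> 1" "d \<bullet> dir \<theta>1 \<le> 0" "0 \<le> d \<bullet> dir \<theta>2"
  shows "norm d \<le> 3 * (d \<bullet> rot (dir \<phi>))"
proof -
  let ?b = "d \<bullet> rot (dir \<phi>)"
  have b: "0 \<le> ?b" "\<bar>d \<bullet> dir \<phi>\<bar> \<le> 2 * ?b" using between_tangents[OF assms(1-3) _ assms(4,5)] by simp_all
  have "(norm d)\<^sup>2 = \<bar>d \<bullet> dir \<phi>\<bar>\<^sup>2 + ?b\<^sup>2" by (simp add: norm_dir_components[of d \<phi>])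
  also have "\<dots> \<le> (2 * ?b)\<^sup>2 + ?b\<^sup>2" using b by (intro add_mono power_mono) auto
  also have "\<dots> \<le> (3 * ?b)\<^sup>2" using b by (simp add: power2_eq_square)
  finally show ?thesis by (rule power2_le_imp_le) (use b in simp)
qed

context oval begin

text \<open>The boundary parametrised by the angle of its outer normal. The parametrisation is continuous but
  need not be differentiable, which is why lengths are handled by \<open>len\<close> below.\<close>
definition top :: "real \<Rightarrow> real^2" where "top \<theta> = contact (dir \<theta>)"

lemma dir_nz [simp]: "dir \<theta> \<noteq> 0" using norm_dir[of \<theta>] by (metis norm_zero zero_neq_one)

lemma top_frontier: "top \<theta> \<in> frontier K" by (simp add: top_def contact_frontier)

lemma nrm_top: "nrm (top \<theta>) = dir \<theta>" by (simp add: top_def nrm_contact)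

lemma top_nrm: "p \<in> frontier K \<Longrightarrow> nrm p = dir \<theta> \<Longrightarrow> top \<theta> = p"
  by (metis contact_nrm top_def)

lemma top_surj: "p \<in> frontier K \<Longrightarrow> \<exists>\<theta>. p = top \<theta>"
  using unit_dir[of "nrm p"] norm_nrm top_nrm by metis

lemma continuous_top [continuous_intros]:
  fixes f :: "'a::t2_space \<Rightarrow> real"
  shows "continuous_on S f \<Longrightarrow> continuous_on S (\<lambda>x. top (f x))"
  unfolding top_def by (rule continuous_on_compose2[OF continuous_contact]) (auto intro: continuous_intros)

lemma top_max: "(top \<theta> - top \<phi>) \<bullet> dir \<theta> \<ge> 0"
  using contact_max[OF contact_K, of "dir \<theta>" "dir \<phi>"]
  by (simp add: top_def inner_diff_left inner_commute[of "dir \<theta>"])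

lemma top_increment:
  "(top \<theta>2 - top \<theta>1) \<bullet> dir \<theta>1 \<le> 0" "0 \<le> (top \<theta>2 - top \<theta>1) \<bullet> dir \<theta>2"
  "(top (\<theta>1 + pi) - top (\<theta>2 + pi)) \<bullet> dir \<theta>1 \<le> 0" "0 \<le> (top (\<theta>1 + pi) - top (\<theta>2 + pi)) \<bullet> dir \<theta>2"
  using top_max[of \<theta>2 \<theta>1] top_max[of \<theta>1 \<theta>2] top_max[of "\<theta>2 + pi" "\<theta>1 + pi"] top_max[of "\<theta>1 + pi" "\<theta>2 + pi"]
  by (simp_all add: dir_add_pi inner_diff_left)

text \<open>The midpoint of the affine diameter with normal direction \<open>\<theta>\<close>.\<close>
definition ctr :: "real \<Rightarrow> real^2" where "ctr \<theta> = (1/2) *\<^sub>R (top \<theta> + top (\<theta> + pi))"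

lemma continuous_ctr [continuous_intros]:
  fixes f :: "'a::t2_space \<Rightarrow> real"
  shows "continuous_on S f \<Longrightarrow> continuous_on S (\<lambda>x. ctr (f x))"
  unfolding ctr_def by (intro continuous_intros)

text \<open>A substitute for the arc length of the boundary of the difference body. For angles near \<open>a\<close> the
  increments of both are comparable.\<close>
definition len :: "real \<Rightarrow> real \<Rightarrow> real" where
  "len a \<theta> = 3 * ((top \<theta> - top (\<theta> + pi)) \<bullet> rot (dir a))"

text \<open>The boundary increments \<open>d\<close> and \<open>d'\<close> at antipodal points both lie in the narrow sector of
  \<open>between_tangents\<close>. So \<open>len\<close> grows by at least the sum of their lengths, whereas \<open>ctr\<close> moves by half
  of their difference.\<close>
lemma ctr_increment:
  assumes "\<theta>1 < \<theta>2" "\<theta>1 \<in> {a..a + 1}" "\<theta>2 \<in> {a..a + 1}"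
  shows "len a \<theta>1 < len a \<theta>2" "norm (ctr \<theta>2 - ctr \<theta>1) \<le> len a \<theta>2 - len a \<theta>1"
    "\<phi> \<in> {\<theta>1..\<theta>2} \<Longrightarrow> \<bar>(ctr \<theta>2 - ctr \<theta>1) \<bullet> dir \<phi>\<bar> \<le> \<bar>\<theta>2 - \<theta>1\<bar> * (len a \<theta>2 - len a \<theta>1)"
proof -
  define d where "d = top \<theta>2 - top \<theta>1"
  define d' where "d' = top (\<theta>1 + pi) - top (\<theta>2 + pi)"
  note inc = top_increment[where ?\<theta>1.0=\<theta>1 and ?\<theta>2.0=\<theta>2, folded d_def d'_def]
  have a: "\<bar>a - \<theta>1\<bar> \<le> 1" "\<bar>a - \<theta>2\<bar> \<le> 1" using assms by auto
  have n: "norm d \<le> 3 * (d \<bullet> rot (dir a))" "norm d' \<le> 3 * (d' \<bullet> rot (dir a))"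
    using between_tangents_norm[OF assms(1) a] inc by auto
  have len: "len a \<theta>2 - len a \<theta>1 = 3 * (d \<bullet> rot (dir a)) + 3 * (d' \<bullet> rot (dir a))"
    by (simp add: len_def d_def d'_def inner_diff_left algebra_simps)
  have ctr: "ctr \<theta>2 - ctr \<theta>1 = (1/2) *\<^sub>R (d - d')"
    by (simp add: ctr_def d_def d'_def algebra_simps)
  have nn: "norm d + norm d' \<le> len a \<theta>2 - len a \<theta>1" unfolding len using n by simp
  have "d \<noteq> 0"
  proof
    assume "d = 0"
    then have "dir \<theta>1 = dir \<theta>2" using nrm_top[of \<theta>1] nrm_top[of \<theta>2] by (simp add: d_def)
    then have "sin (\<theta>2 - \<theta>1) = 0" using cr_dir[of \<theta>1 \<theta>2] by simp
    moreover have "sin (\<theta>2 - \<theta>1) > 0" using assms pi_gt3 by (intro sin_gt_zero) auto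
    ultimately show False by simp
  qed
  then have "norm d > 0" by simp
  then show "len a \<theta>1 < len a \<theta>2" using nn norm_ge_zero[of d'] by linarith
  have "norm (ctr \<theta>2 - ctr \<theta>1) \<le> (norm d + norm d') / 2" unfolding ctr using norm_triangle_ineq4[of d d'] by simp
  then show "norm (ctr \<theta>2 - ctr \<theta>1) \<le> len a \<theta>2 - len a \<theta>1"
    by (rule order_trans[OF _ order_trans[OF _ nn]]) simp
  assume phi: "\<phi> \<in> {\<theta>1..\<theta>2}"
  define m where "m = \<theta>2 - \<theta>1"
  have m: "\<bar>\<phi> - \<theta>1\<bar> \<le> m" "\<bar>\<phi> - \<theta>2\<bar> \<le> m" "m \<le> 1" "m > 0" using phi assms by (auto simp: m_def)
  have le: "e \<bullet> rot (dir \<phi>) \<le> norm e" for e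
    using norm_cauchy_schwarz[of e "rot (dir \<phi>)"] by simp
  have t: "\<bar>e \<bullet> dir \<phi>\<bar> \<le> 2 * m * norm e" if "e \<bullet> dir \<theta>1 \<le> 0" "0 \<le> e \<bullet> dir \<theta>2" for e
  proof -
    have "\<bar>e \<bullet> dir \<phi>\<bar> \<le> 2 * m * (e \<bullet> rot (dir \<phi>))" by (rule between_tangents(2)[OF assms(1) m(1-3) that])
    also have "\<dots> \<le> 2 * m * norm e" using m(4) le by (intro mult_left_mono) auto
    finally show ?thesis .
  qed
  have "\<bar>(ctr \<theta>2 - ctr \<theta>1) \<bullet> dir \<phi>\<bar> \<le> (\<bar>d \<bullet> dir \<phi>\<bar> + \<bar>d' \<bullet> dir \<phi>\<bar>) / 2"
    unfolding ctr by (simp add: inner_diff_left)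
  also have "\<dots> \<le> m * (norm d + norm d')" using t[OF inc(1,2)] t[OF inc(3,4)] by (simp add: algebra_simps)
  also have "\<dots> \<le> m * (len a \<theta>2 - len a \<theta>1)" using nn m(4) by (intro mult_left_mono) auto
  finally show "\<bar>(ctr \<theta>2 - ctr \<theta>1) \<bullet> dir \<phi>\<bar> \<le> \<bar>\<theta>2 - \<theta>1\<bar> * (len a \<theta>2 - len a \<theta>1)"
    using m(4) by (simp add: m_def)
qed

text \<open>Parametrised by \<open>len\<close> instead of the angle, the curve of midpoints satisfies the estimates on which
  \<open>null_transversal\<close> relies.\<close>
lemma arc_parametrisation:
  assumes "a \<le> b" "b \<le> a + 1"
  shows "\<exists>A B \<Theta>. A \<le> B \<and> continuous_on {A..B} \<Theta> \<and> \<Theta> ` {A..B} = {a..b} \<and>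
    (\<forall>r\<in>{A..B}. \<forall>s\<in>{A..B}. norm (ctr (\<Theta> r) - ctr (\<Theta> s)) \<le> \<bar>r - s\<bar> \<and>
      \<bar>(ctr (\<Theta> r) - ctr (\<Theta> s)) \<bullet> dir (\<Theta> s)\<bar> \<le> \<bar>\<Theta> r - \<Theta> s\<bar> * \<bar>r - s\<bar>)"
proof -
  let ?l = "len a"
  have mono: "?l x < ?l y" if "x < y" "x \<in> {a..b}" "y \<in> {a..b}" for x y
    by (rule ctr_increment(1)[OF that(1)]) (use that assms in auto)
  have mono_le: "?l x \<le> ?l y" if "x \<le> y" "x \<in> {a..b}" "y \<in> {a..b}" for x y
    using mono[of x y] that by (cases "x = y") auto
  have inj: "inj_on ?l {a..b}"
  proof (rule inj_onI)
    fix x y assume "x \<in> {a..b}" "y \<in> {a..b}" "?l x = ?l y"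
    then show "x = y" using mono[of x y] mono[of y x] by (cases x y rule: linorder_cases) auto
  qed
  have cont: "continuous_on {a..b} ?l" unfolding len_def by (intro continuous_intros)
  define A where "A = ?l a" define B where "B = ?l b"
  have AB: "A \<le> B" unfolding A_def B_def using assms by (intro mono_le) auto
  have img: "?l ` {a..b} = {A..B}"
  proof
    show "?l ` {a..b} \<subseteq> {A..B}" unfolding A_def B_def using assms by (auto intro!: mono_le)
    show "{A..B} \<subseteq> ?l ` {a..b}"
    proof
      fix s assume "s \<in> {A..B}"
      then obtain x where "a \<le> x" "x \<le> b" "?l x = s"
        using IVT'[of ?l a s b] cont assms by (auto simp: A_def B_def)
      then show "s \<in> ?l ` {a..b}" by auto
    qed
  qed
  define \<Theta> where "\<Theta> = inv_into {a..b} ?l"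
  have \<Theta>: "\<Theta> s \<in> {a..b}" "?l (\<Theta> s) = s" if "s \<in> {A..B}" for s
  proof -
    have s: "s \<in> ?l ` {a..b}" using that img by simp
    show "\<Theta> s \<in> {a..b}" "?l (\<Theta> s) = s" unfolding \<Theta>_def by (rule inv_into_into[OF s], rule f_inv_into_f[OF s])
  qed
  have "continuous_on (?l ` {a..b}) \<Theta>"
    by (rule continuous_on_inv[OF cont]) (use inj in \<open>auto simp: \<Theta>_def\<close>)
  then have c\<Theta>: "continuous_on {A..B} \<Theta>" by (simp add: img)
  have "\<Theta> ` {A..B} = {a..b}"
    unfolding img[symmetric] \<Theta>_def using inv_into_image_cancel[OF inj, of "{a..b}"] by simp
  moreover have "norm (ctr (\<Theta> r) - ctr (\<Theta> s)) \<le> \<bar>r - s\<bar> \<and>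
      \<bar>(ctr (\<Theta> r) - ctr (\<Theta> s)) \<bullet> dir (\<Theta> s)\<bar> \<le> \<bar>\<Theta> r - \<Theta> s\<bar> * \<bar>r - s\<bar>"
    if r: "r \<in> {A..B}" and s: "s \<in> {A..B}" for r s
  proof -
    have in_: "\<Theta> r \<in> {a..a + 1}" "\<Theta> s \<in> {a..a + 1}" using \<Theta>(1)[OF r] \<Theta>(1)[OF s] assms by auto
    consider "\<Theta> s < \<Theta> r" | "\<Theta> r < \<Theta> s" | "\<Theta> r = \<Theta> s" by linarith
    then show ?thesis
    proof cases
      case 1
      note c = ctr_increment[OF 1 in_(2,1), unfolded \<Theta>(2)[OF r] \<Theta>(2)[OF s]]
      show ?thesis using c(1,2) c(3)[of "\<Theta> s"] 1 by simp
    next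
      case 2
      note c = ctr_increment[OF 2 in_, unfolded \<Theta>(2)[OF r] \<Theta>(2)[OF s]]
      have "ctr (\<Theta> r) - ctr (\<Theta> s) = - (ctr (\<Theta> s) - ctr (\<Theta> r))" by simp
      then show ?thesis using c(1,2) c(3)[of "\<Theta> s"] 2
        by (simp only: norm_minus_cancel inner_minus_left abs_minus_cancel abs_minus_commute[of r s] abs_minus_commute[of "\<Theta> r" "\<Theta> s"]) simp
    next
      case 3 then show ?thesis by simp
    qed
  qed
  ultimately show ?thesis using AB c\<Theta> by blast
qed

lemma null_double_points_local:
  assumes "a \<le> b" "b \<le> a + 1" "a' \<le> b'" "b' \<le> a' + 1" "\<sigma> > 0"
    and tr: "\<And>\<theta> \<theta>'. \<theta> \<in> {a..b} \<Longrightarrow> \<theta>' \<in> {a'..b'} \<Longrightarrow> \<bar>sin (\<theta>' - \<theta>)\<bar> \<ge> \<sigma>" and v: "norm v \<le> 1"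
  shows "negligible ((\<lambda>y. y \<bullet> v) ` (ctr ` {a..b} \<inter> ctr ` {a'..b'}))"
proof -
  obtain A B \<Theta> where P: "A \<le> B" "continuous_on {A..B} \<Theta>" "\<Theta> ` {A..B} = {a..b}"
    "\<forall>r\<in>{A..B}. \<forall>s\<in>{A..B}. norm (ctr (\<Theta> r) - ctr (\<Theta> s)) \<le> \<bar>r - s\<bar> \<and>
      \<bar>(ctr (\<Theta> r) - ctr (\<Theta> s)) \<bullet> dir (\<Theta> s)\<bar> \<le> \<bar>\<Theta> r - \<Theta> s\<bar> * \<bar>r - s\<bar>"
    using arc_parametrisation[OF assms(1,2)] by blast
  obtain A' B' \<Theta>' where P': "A' \<le> B'" "continuous_on {A'..B'} \<Theta>'" "\<Theta>' ` {A'..B'} = {a'..b'}"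
    "\<forall>r\<in>{A'..B'}. \<forall>s\<in>{A'..B'}. norm (ctr (\<Theta>' r) - ctr (\<Theta>' s)) \<le> \<bar>r - s\<bar> \<and>
      \<bar>(ctr (\<Theta>' r) - ctr (\<Theta>' s)) \<bullet> dir (\<Theta>' s)\<bar> \<le> \<bar>\<Theta>' r - \<Theta>' s\<bar> * \<bar>r - s\<bar>"
    using arc_parametrisation[OF assms(3,4)] by blast
  have "negligible ((\<lambda>y. y \<bullet> v) ` ((\<lambda>s. ctr (\<Theta> s)) ` {A..B} \<inter> (\<lambda>s. ctr (\<Theta>' s)) ` {A'..B'}))"
  proof (rule null_transversal[OF P(1) P'(1) _ _ _ _ P(2) P'(2) \<open>\<sigma> > 0\<close> _ v])
    show "\<bar>sin (\<Theta>' s - \<Theta> r)\<bar> \<ge> \<sigma>" if "r \<in> {A..B}" "s \<in> {A'..B'}" for r s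
      using tr P(3) P'(3) that by blast
  qed (use P(4) P'(4) in auto)
  moreover have "(\<lambda>s. ctr (\<Theta> s)) ` {A..B} = ctr ` {a..b}" "(\<lambda>s. ctr (\<Theta>' s)) ` {A'..B'} = ctr ` {a'..b'}"
    by (simp_all only: P(3)[symmetric] P'(3)[symmetric] image_image)
  ultimately show ?thesis by (simp only:)
qed

text \<open>Countably many pairs of intervals with rational ends suffice to separate any two directions that
  are not parallel.\<close>
lemma null_double_points:
  assumes v: "norm v \<le> 1"
  shows "negligible ((\<lambda>\<theta>. ctr \<theta> \<bullet> v) ` {\<theta>. \<exists>\<phi>. ctr \<phi> = ctr \<theta> \<and> sin (\<phi> - \<theta>) \<noteq> 0})"
proof -
  define I :: "(real \<times> real \<times> real \<times> real) set" where "I = {(a, b, a', b') \<in> \<rat> \<times> \<rat> \<times> \<rat> \<times> \<rat>. a \<le> b \<and> b \<le> a + 1 \<and> a' \<le> b' \<and> b' \<le> a' + 1 \<and>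
    (\<exists>\<sigma>>0. \<forall>\<theta>\<in>{a..b}. \<forall>\<phi>\<in>{a'..b'}. \<bar>sin (\<phi> - \<theta>)\<bar> \<ge> \<sigma>)}"
  define F where "F = (\<lambda>(a, b, a', b'). (\<lambda>y. y \<bullet> v) ` (ctr ` {a..b} \<inter> ctr ` {a'..b'}))"
  have "countable I"
    by (rule countable_subset[of _ "\<rat> \<times> \<rat> \<times> \<rat> \<times> \<rat>"]) (auto simp: I_def intro!: countable_SIGMA countable_rat)
  then have "countable (F ` I)" by (rule countable_image)
  moreover have "negligible T" if TF: "T \<in> F ` I" for T
  proof -
    obtain a b a' b' where T: "T = F (a, b, a', b')" "(a, b, a', b') \<in> I" using TF by auto
    then obtain \<sigma> where "\<sigma> > 0" "\<forall>\<theta>\<in>{a..b}. \<forall>\<phi>\<in>{a'..b'}. \<bar>sin (\<phi> - \<theta>)\<bar> \<ge> \<sigma>" by (auto simp: I_def)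
    then show ?thesis
      unfolding T(1) F_def prod.case using T(2) v by (intro null_double_points_local[of a b a' b' \<sigma>]) (auto simp: I_def)
  qed
  ultimately have "negligible (\<Union>(F ` I))" by (rule negligible_countable_Union)
  moreover have "(\<lambda>\<theta>. ctr \<theta> \<bullet> v) ` {\<theta>. \<exists>\<phi>. ctr \<phi> = ctr \<theta> \<and> sin (\<phi> - \<theta>) \<noteq> 0} \<subseteq> \<Union>(F ` I)"
  proof
    fix y assume "y \<in> (\<lambda>\<theta>. ctr \<theta> \<bullet> v) ` {\<theta>. \<exists>\<phi>. ctr \<phi> = ctr \<theta> \<and> sin (\<phi> - \<theta>) \<noteq> 0}"
    then obtain \<theta> \<phi> where y: "y = ctr \<theta> \<bullet> v" "ctr \<phi> = ctr \<theta>" "sin (\<phi> - \<theta>) \<noteq> 0" by auto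
    define s where "s = \<bar>sin (\<phi> - \<theta>)\<bar>"
    have s: "s > 0" using y(3) by (simp add: s_def)
    have "continuous (at (\<phi> - \<theta>)) (\<lambda>t::real. sin t)" by (intro continuous_intros)
    then obtain d where d: "d > 0" "\<forall>t. dist t (\<phi> - \<theta>) < d \<longrightarrow> dist (sin t) (sin (\<phi> - \<theta>)) < s / 2"
      unfolding continuous_at_eps_delta using s by (meson half_gt_zero)
    define r where "r = min (d / 2) (1 / 2)"
    have r: "r > 0" "r \<le> d / 2" "r \<le> 1 / 2" using d by (auto simp: r_def)
    have dense: "\<exists>q\<in>\<rat>. t - r < q \<and> q < t" "\<exists>q\<in>\<rat>. t < q \<and> q < t + r" for t
      using Rats_dense_in_real[of "t - r" t] Rats_dense_in_real[of t "t + r"] r by auto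
    obtain a b where ab: "a \<in> \<rat>" "b \<in> \<rat>" "\<theta> - r < a" "a < \<theta>" "\<theta> < b" "b < \<theta> + r" using dense by blast
    obtain a' b' where ab': "a' \<in> \<rat>" "b' \<in> \<rat>" "\<phi> - r < a'" "a' < \<phi>" "\<phi> < b'" "b' < \<phi> + r" using dense by blast
    have far: "\<bar>sin (\<phi>' - \<theta>')\<bar> \<ge> s / 2" if "\<theta>' \<in> {a..b}" "\<phi>' \<in> {a'..b'}" for \<theta>' \<phi>'
    proof -
      have "\<bar>(\<phi>' - \<theta>') - (\<phi> - \<theta>)\<bar> < d" using that ab ab' r by (auto simp: abs_less_iff)
      then have "\<bar>sin (\<phi>' - \<theta>') - sin (\<phi> - \<theta>)\<bar> < s / 2" using d(2) by (simp add: dist_real_def)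
      then show ?thesis unfolding s_def by linarith
    qed
    have "(a, b, a', b') \<in> I"
      unfolding I_def using ab ab' r far s by (auto intro!: exI[of _ "s / 2"])
    moreover have "ctr \<theta> \<in> ctr ` {a..b}" using ab by auto
    moreover have "ctr \<theta> \<in> ctr ` {a'..b'}" unfolding y(2)[symmetric] using ab' by auto
    ultimately show "y \<in> \<Union>(F ` I)"
      unfolding y(1) by (intro UnionI[of "F (a, b, a', b')"] imageI) (auto simp: F_def)
  qed
  ultimately show ?thesis by (rule negligible_subset)
qed

text \<open>If every midpoint were a double point, the projection of the curve of midpoints to any line
  would be a negligible interval, that is, a single point.\<close>
lemma simple_midpoint_or_symmetric:
  "(\<exists>\<phi>. \<forall>\<theta>. ctr \<theta> = ctr \<phi> \<longrightarrow> sin (\<theta> - \<phi>) = 0) \<or> (\<forall>\<theta> \<phi>. ctr \<theta> = ctr \<phi>)"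
proof (rule disjCI)
  assume none: "\<not> (\<forall>\<theta> \<phi>. ctr \<theta> = ctr \<phi>)"
  show "\<exists>\<phi>. \<forall>\<theta>. ctr \<theta> = ctr \<phi> \<longrightarrow> sin (\<theta> - \<phi>) = 0"
  proof (rule ccontr)
    assume "\<not> ?thesis"
    then have UNIV: "{\<theta>. \<exists>\<phi>. ctr \<phi> = ctr \<theta> \<and> sin (\<phi> - \<theta>) \<noteq> 0} = UNIV" by auto
    have eq: "ctr \<theta> \<bullet> v = ctr \<phi> \<bullet> v" if v: "norm v \<le> 1" for v \<theta> \<phi>
    proof (rule ccontr)
      assume ne: "ctr \<theta> \<bullet> v \<noteq> ctr \<phi> \<bullet> v"
      let ?R = "range (\<lambda>\<theta>. ctr \<theta> \<bullet> v)"
      define x where "x = min (ctr \<theta> \<bullet> v) (ctr \<phi> \<bullet> v)"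
      define y where "y = max (ctr \<theta> \<bullet> v) (ctr \<phi> \<bullet> v)"
      have xy: "x < y" "x \<in> ?R" "y \<in> ?R" using ne by (auto simp: x_def y_def min_def max_def)
      have "connected ?R" by (intro connected_continuous_image continuous_intros connected_UNIV)
      then have "{x..y} \<subseteq> ?R" using xy by (intro connected_contains_Icc) auto
      moreover have "negligible ?R" using null_double_points[OF v] by (simp add: UNIV)
      ultimately have "negligible {x..y}" using negligible_subset by blast
      then have "negligible (cbox x y)" by (simp add: cbox_interval)
      then have "box x y = {}" by (simp only: negligible_interval)
      moreover have "(x + y) / 2 \<in> box x y" using xy(1) by (simp add: box_real)
      ultimately show False by blast
    qed
    have "ctr \<theta> = ctr \<phi>" for \<theta> \<phi>
    proof (rule plane_eqI)
      have "norm (axis 1 1 :: real^2) \<le> 1" "norm (axis 2 1 :: real^2) \<le> 1" by (simp_all add: norm_axis_1)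
      then have "ctr \<theta> \<bullet> axis 1 1 = ctr \<phi> \<bullet> axis 1 1" "ctr \<theta> \<bullet> axis 2 1 = ctr \<phi> \<bullet> axis 2 1" by (auto intro!: eq)
      then show "ctr \<theta> $ 1 = ctr \<phi> $ 1" "ctr \<theta> $ 2 = ctr \<phi> $ 2" by (simp_all add: inner_axis)
    qed
    then show False using none by blast
  qed
qed

end

section \<open>Diagonals of inscribed parallelograms near an affine diameter\<close>

lemma abs_cr_le: "\<bar>cr a b\<bar> \<le> norm a * norm b"
  using Cauchy_Schwarz_ineq2[of "rot a" b] by (simp add: rot_inner)

text \<open>The positive combinations \<open>u\<close> of \<open>u1\<close>, \<open>u2\<close> and \<open>v\<close> of \<open>v1\<close>, \<open>v2\<close> that are orthogonal to \<open>d\<close> are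
  parallel, although \<open>cr u v\<close> is a positive combination of numbers of the sign of \<open>c\<close>.\<close>
lemma no_crossing_signs:
  assumes d: "d \<bullet> u1 < 0" "d \<bullet> u2 > 0" "d \<bullet> v1 > 0" "d \<bullet> v2 < 0"
    and c: "c * cr u1 v1 > 0" "c * cr u1 v2 > 0" "c * cr u2 v1 > 0" "c * cr u2 v2 > 0"
  shows False
proof -
  define u where "u = (d \<bullet> u2) *\<^sub>R u1 + (- (d \<bullet> u1)) *\<^sub>R u2"
  define v where "v = (d \<bullet> v1) *\<^sub>R v2 + (- (d \<bullet> v2)) *\<^sub>R v1"
  have "d \<noteq> 0" using d by auto
  moreover have "d \<bullet> u = 0" "d \<bullet> v = 0" by (simp_all add: u_def v_def inner_add_right inner_diff_right)
  ultimately have "cr u v = 0" by (rule cr_eq_0_orthogonal)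
  moreover have "c * cr u v = (d \<bullet> u2) * (d \<bullet> v1) * (c * cr u1 v2) + (d \<bullet> u2) * (- (d \<bullet> v2)) * (c * cr u1 v1)
      + (- (d \<bullet> u1)) * (d \<bullet> v1) * (c * cr u2 v2) + (- (d \<bullet> u1)) * (- (d \<bullet> v2)) * (c * cr u2 v1)"
    by (simp add: u_def v_def algebra_simps)
  moreover have "\<dots> > 0" by (intro add_pos_pos mult_pos_pos[OF mult_pos_pos] c) (use d in auto)
  ultimately show False by simp
qed

lemma unit_eqI:
  assumes "norm d = 1" "norm u = 1" "norm v = 1" "cr d u = cr d v" "d \<bullet> u < 0" "d \<bullet> v < 0"
  shows "u = v"
proof -
  have "(d \<bullet> u)\<^sup>2 = (d \<bullet> v)\<^sup>2" using cr_square_unit[OF assms(1,2)] cr_square_unit[OF assms(1,3)] assms(4) by simp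
  then have "d \<bullet> u = d \<bullet> v" using assms(5,6) by (simp add: power2_eq_iff)
  then have o: "d \<bullet> (u - v) = 0" "rot d \<bullet> (u - v) = 0" using assms(4) by (simp_all add: rot_inner inner_diff_right)
  have "u - v = 0"
  proof (rule ccontr)
    assume "u - v \<noteq> 0"
    then have "cr d (rot d) = 0" using o by (intro cr_eq_0_orthogonal[of "u - v"]) (simp_all add: inner_commute)
    moreover have "cr d (rot d) = d \<bullet> d" by (simp add: cr_def rot_def inner_plane)
    ultimately show False using assms(1) by auto
  qed
  then show ?thesis by simp
qed

lemma between_inj_pos:
  fixes f :: "real \<Rightarrow> real"
  assumes cont: "continuous_on {c..d} f" and inj: "inj_on f {c..d}"
    and e: "e \<in> {c..d}" "f e > 0" and x: "x \<in> {c..d}" "f x > 0" and y: "y \<in> closed_segment x e"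
  shows "y \<in> {c..d}" "f y > 0"
proof -
  have seg: "closed_segment x e = {min x e..max x e}" by (simp add: closed_segment_eq_real_ivl min_def max_def)
  have sub: "{min x e..max x e} \<subseteq> {c..d}" using e x by auto
  show "y \<in> {c..d}" using y sub unfolding seg by blast
  have ends: "f (min x e) > 0" "f (max x e) > 0" using e x by (auto simp: min_def max_def)
  show "f y > 0"
  proof (cases "y = min x e \<or> y = max x e")
    case True then show ?thesis using ends by auto
  next
    case False
    then have "min x e < y" "y < max x e" using y unfolding seg by auto
    from continuous_inj_imp_mono[OF this continuous_on_subset[OF cont sub] inj_on_subset[OF inj sub]]
    show ?thesis using ends by linarith
  qed
qed

text \<open>On every fibre an injective continuous function stays positive between two positive values. So a
  point of the set can be moved within its fibre to the level \<open>e\<close>, on which \<open>A\<close> is positive.\<close>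
lemma strip_connected:
  fixes A :: "real \<times> real \<Rightarrow> real"
  assumes cont: "continuous_on ({a..b} \<times> {c..d}) A"
    and inj: "\<And>\<phi>. \<phi> \<in> {a..b} \<Longrightarrow> inj_on (\<lambda>\<psi>. A (\<phi>, \<psi>)) {c..d}"
    and e: "e \<in> {c..d}" "\<And>\<phi>. \<phi> \<in> {a..b} \<Longrightarrow> A (\<phi>, e) > 0"
  shows "connected {q \<in> {a..b} \<times> {c..d}. A q > 0}"
  unfolding connected_iff_connected_component
proof (intro ballI)
  let ?S = "{q \<in> {a..b} \<times> {c..d}. A q > 0}"
  have up: "connected_component ?S (\<phi>, \<psi>) (\<phi>, e)" if q: "(\<phi>, \<psi>) \<in> ?S" for \<phi> \<psi>
  proof (rule connected_componentI)
    have phi: "\<phi> \<in> {a..b}" "\<psi> \<in> {c..d}" "A (\<phi>, \<psi>) > 0" using q by auto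
    have c: "continuous_on {c..d} (\<lambda>\<psi>. A (\<phi>, \<psi>))"
      by (rule continuous_on_compose2[OF cont]) (use phi in \<open>auto intro!: continuous_intros\<close>)
    show "connected (Pair \<phi> ` closed_segment \<psi> e)"
      by (intro connected_continuous_image continuous_intros connected_segment)
    show "Pair \<phi> ` closed_segment \<psi> e \<subseteq> ?S"
      using between_inj_pos[OF c inj[OF phi(1)] e(1) e(2)[OF phi(1)] phi(2,3)] phi(1) by auto
  qed auto
  have along: "connected_component ?S (\<phi>, e) (\<phi>', e)" if "\<phi> \<in> {a..b}" "\<phi>' \<in> {a..b}" for \<phi> \<phi>'
  proof (rule connected_componentI)
    show "connected ((\<lambda>t. (t, e)) ` {a..b})"
      by (intro connected_continuous_image continuous_intros connected_Icc)
    show "(\<lambda>t. (t, e)) ` {a..b} \<subseteq> ?S" using e by auto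
  qed (use that in auto)
  fix q q' assume q: "q \<in> ?S" "q' \<in> ?S"
  obtain \<phi> \<psi> \<phi>' \<psi>' where eq: "q = (\<phi>, \<psi>)" "q' = (\<phi>', \<psi>')" by (cases q, cases q') auto
  have "connected_component ?S (\<phi>, \<psi>) (\<phi>', e)"
    by (rule connected_component_trans[OF up along]) (use q eq in auto)
  then show "connected_component ?S q q'"
    unfolding eq by (rule connected_component_trans[OF _ connected_component_sym[OF up]]) (use q eq in auto)
qed

lemma frame_expansion: "cr d u *\<^sub>R rot d + (d \<bullet> u) *\<^sub>R d = (d \<bullet> d) *\<^sub>R u"
  by (rule plane_eqI) (simp_all add: cr_def rot_def inner_plane algebra_simps)

lemma angle_near:
  assumes "\<delta> > 0"
  shows "\<exists>\<epsilon>>0. \<forall>u. norm u = 1 \<and> norm (u - dir \<phi>) < \<epsilon> \<longrightarrow> (\<exists>\<theta>. \<bar>\<theta> - \<phi>\<bar> < \<delta> \<and> u = dir \<theta>)"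
proof -
  define d where "d = min \<delta> 1"
  have d: "0 < d" "d \<le> \<delta>" "d \<le> 1" using assms by (auto simp: d_def)
  have sd: "sin d > 0" using d pi_gt3 by (intro sin_gt_zero) auto
  show ?thesis
  proof (rule exI[of _ "min (1/2) (sin d)"], intro conjI allI impI)
    show "min (1/2) (sin d) > 0" using sd by simp
    fix u assume u: "norm u = 1 \<and> norm (u - dir \<phi>) < min (1/2) (sin d)"
    define s where "s = cr (dir \<phi>) u"
    define c where "c = dir \<phi> \<bullet> u"
    have "s = cr (dir \<phi>) (u - dir \<phi>)" by (simp add: s_def)
    then have "\<bar>s\<bar> \<le> norm (u - dir \<phi>)" using abs_cr_le[of "dir \<phi>" "u - dir \<phi>"] by simp
    then have s: "- sin d < s" "s < sin d" using u by auto
    have "\<bar>dir \<phi> \<bullet> (u - dir \<phi>)\<bar> \<le> norm (u - dir \<phi>)" using Cauchy_Schwarz_ineq2[of "dir \<phi>" "u - dir \<phi>"] by simp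
    then have "\<bar>c - 1\<bar> \<le> norm (u - dir \<phi>)" by (simp add: c_def inner_diff_right dot_square_norm)
    moreover have "norm (u - dir \<phi>) < 1 / 2" using u by simp
    ultimately have c: "c > 0" by linarith
    have sc: "s\<^sup>2 + c\<^sup>2 = 1" unfolding s_def c_def by (rule cr_square_unit) (use u in auto)
    define t where "t = arcsin s"
    have s1: "-1 \<le> s" "s \<le> 1" using s sin_le_one[of d] by linarith+
    have st: "sin t = s" using s1 by (simp add: t_def)
    have t: "- (pi/2) \<le> t" "t \<le> pi/2" using s1 arcsin_bounded by (auto simp: t_def)
    have ct: "cos t = c"
    proof -
      have "(cos t)\<^sup>2 = c\<^sup>2" using sc st sin_cos_squared_add[of t] by simp
      moreover have "cos t \<ge> 0" using t by (intro cos_ge_zero) auto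
      ultimately show ?thesis using c by (simp add: power2_eq_iff_nonneg)
    qed
    have "t < d"
    proof (rule ccontr)
      assume "\<not> t < d"
      then have "sin d \<le> sin t" using t d pi_gt3 by (intro sin_monotone_2pi_le) auto
      then show False using s st by simp
    qed
    moreover have "- d < t"
    proof (rule ccontr)
      assume "\<not> - d < t"
      then have "sin t \<le> sin (- d)" using t d pi_gt3 by (intro sin_monotone_2pi_le) auto
      then show False using s st by simp
    qed
    moreover have "u = dir (\<phi> + t)"
    proof -
      have "cr (dir \<phi>) u *\<^sub>R rot (dir \<phi>) + (dir \<phi> \<bullet> u) *\<^sub>R dir \<phi> = (dir \<phi> \<bullet> dir \<phi>) *\<^sub>R u"
        by (rule frame_expansion)
      then have "u = s *\<^sub>R rot (dir \<phi>) + c *\<^sub>R dir \<phi>" by (simp add: s_def c_def dot_square_norm)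
      also have "\<dots> = dir (\<phi> + t)"
        by (rule plane_eqI) (simp_all add: st[symmetric] ct[symmetric] rot_def dir_def sin_add cos_add)
      finally show ?thesis .
    qed
    ultimately show "\<exists>\<theta>. \<bar>\<theta> - \<phi>\<bar> < \<delta> \<and> u = dir \<theta>" using d by (intro exI[of _ "\<phi> + t"]) auto
  qed
qed

context oval begin

abbreviation dom :: "(real^2) set" where "dom \<equiv> {x. lens x} - {0}"

lemma open_dom: "open dom" using open_lens by (rule open_delete)

lemma nrm_compose: "continuous_on S f \<Longrightarrow> (\<And>x. x \<in> S \<Longrightarrow> f x \<in> frontier K) \<Longrightarrow> continuous_on S (\<lambda>x. nrm (f x))"
  by (rule continuous_on_compose2[OF continuous_nrm]) auto

lemma continuous_normals:
  "continuous_on dom (\<lambda>x. nrm (pl x))" "continuous_on dom (\<lambda>x. nrm (mi x))"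
  "continuous_on dom (\<lambda>x. nrm (pl x - x))" "continuous_on dom (\<lambda>x. nrm (mi x - x))"
  using pl_mi(1,3) by (auto intro!: nrm_compose continuous_intros continuous_pl continuous_mi simp: chord_def)

lemma continuous_diag: "continuous_on dom diag"
  unfolding diag_def[abs_def] by (intro continuous_intros continuous_normals)

lemma side_chord:
  assumes "sin (\<psi> - \<phi>) > 0"
  shows "top \<phi> - top \<psi> \<noteq> 0" "lens (top \<phi> - top \<psi>)" "pl (top \<phi> - top \<psi>) = top \<phi>"
proof -
  let ?x = "top \<phi> - top \<psi>"
  show x: "?x \<noteq> 0"
  proof
    assume "?x = 0"
    then have "dir \<phi> = dir \<psi>" using nrm_top[of \<phi>] nrm_top[of \<psi>] by simp
    then show False using assms cr_dir[of \<phi> \<psi>] by simp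
  qed
  have c: "chord ?x (top \<phi>)" by (simp add: chord_def top_frontier)
  have cs: "cs ?x (top \<phi>) = sin (\<psi> - \<phi>)" by (simp add: cs_def nrm_top cr_dir)
  show "lens ?x" using lens_iff_chord[OF x c] cs assms by simp
  show "pl ?x = top \<phi>" using pl_eqI[OF x c] cs assms by simp
qed

text \<open>Otherwise the segments joining \<open>top \<psi>1\<close> to \<open>top \<psi>2\<close> and the heads \<open>w2\<close> to \<open>w1\<close> would be equal
  vectors. The normals at the two ends of the first one lie on different sides of the line
  orthogonal to it, and those of the second one do so in the opposite order. By \<open>no_crossing_signs\<close>
  the normals at the first ends cannot all have the orientation \<open>c\<close> with respect to the second ones.\<close>
lemma opposite_injective:
  assumes p: "sin (\<psi>1 - \<phi>) > 0" "sin (\<psi>2 - \<phi>) > 0" and ne: "top \<psi>1 \<noteq> top \<psi>2"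
    and c: "\<And>i j. i \<in> {\<psi>1, \<psi>2} \<Longrightarrow> j \<in> {\<psi>1, \<psi>2} \<Longrightarrow> c * cr (dir i) (nrm (mi (top \<phi> - top j))) > 0"
  shows "mi (top \<phi> - top \<psi>1) - (top \<phi> - top \<psi>1) \<noteq> mi (top \<phi> - top \<psi>2) - (top \<phi> - top \<psi>2)"
proof
  define w1 where "w1 = mi (top \<phi> - top \<psi>1)"
  define w2 where "w2 = mi (top \<phi> - top \<psi>2)"
  assume "mi (top \<phi> - top \<psi>1) - (top \<phi> - top \<psi>1) = mi (top \<phi> - top \<psi>2) - (top \<phi> - top \<psi>2)"
  then have d: "top \<psi>2 - top \<psi>1 = w1 - w2" by (simp add: w1_def w2_def algebra_simps)
  have w: "w1 \<in> frontier K" "w2 \<in> frontier K"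
    using pl_mi(3)[OF side_chord(1,2)[OF p(1)]] pl_mi(3)[OF side_chord(1,2)[OF p(2)]]
    by (simp_all add: w1_def w2_def chord_def)
  have wne: "w1 \<noteq> w2" using d ne by auto
  have K: "top \<psi>1 \<in> K" "top \<psi>2 \<in> K" "w1 \<in> K" "w2 \<in> K" using w top_frontier frontier_subset by auto
  let ?d = "top \<psi>2 - top \<psi>1"
  have 1: "?d \<bullet> dir \<psi>1 < 0"
    using nrm_strict[OF top_frontier K(2), of \<psi>1] ne by (simp add: nrm_top inner_commute)
  have "(top \<psi>1 - top \<psi>2) \<bullet> dir \<psi>2 < 0"
    using nrm_strict[OF top_frontier K(1), of \<psi>2] ne by (simp add: nrm_top inner_commute)
  then have 2: "?d \<bullet> dir \<psi>2 > 0" by (simp add: inner_diff_left)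
  have "(w2 - w1) \<bullet> nrm w1 < 0" using nrm_strict[OF w(1) K(4)] wne by (simp add: inner_commute)
  then have 3: "?d \<bullet> nrm w1 > 0" unfolding d by (simp add: inner_diff_left)
  have 4: "?d \<bullet> nrm w2 < 0" unfolding d using nrm_strict[OF w(2) K(3)] wne by (simp add: inner_commute)
  show False
    by (rule no_crossing_signs[OF 1 2 3 4]) (use c[of \<psi>1 \<psi>1] c[of \<psi>1 \<psi>2] c[of \<psi>2 \<psi>1] c[of \<psi>2 \<psi>2] in \<open>simp_all add: w1_def w2_def\<close>)
qed

text \<open>The angles \<open>\<phi>\<close> and \<open>\<psi>\<close> of the normals at \<open>pl x\<close> and \<open>pl x - x\<close> are coordinates for \<open>x\<close>. Near a zero of
  \<open>diag\<close> the normal at \<open>mi x - x\<close> is almost opposite to that at \<open>pl x\<close>, so it is determined by \<open>diag x\<close>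
  and \<open>\<phi>\<close> (\<open>unit_eqI\<close>); by \<open>opposite_injective\<close> it determines \<open>\<psi>\<close>. So \<open>diag\<close> is strictly monotone in
  \<open>\<psi>\<close> for fixed \<open>\<phi>\<close>, which isolates its zeros and makes the two sign regions connected
  (\<open>strip_connected\<close>).\<close>
lemma diag_crossing:
  assumes s0: "sin (\<psi>0 - \<phi>0) > 0" and x0: "x0 = top \<phi>0 - top \<psi>0" and al0: "diag x0 = 0"
    and other: "cr (nrm (mi x0)) (nrm (pl x0 - x0)) \<noteq> 0" and \<eta>: "\<eta> > 0"
  shows "(\<exists>\<delta>>0. \<forall>\<psi>. \<psi> \<noteq> \<psi>0 \<and> \<bar>\<psi> - \<psi>0\<bar> < \<delta> \<longrightarrow> diag (top \<phi>0 - top \<psi>) \<noteq> 0) \<and>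
    (\<exists>\<rho>>0. \<exists>P Q. connected P \<and> connected Q \<and> P \<noteq> {} \<and> Q \<noteq> {} \<and> P \<union> Q \<subseteq> ball x0 \<eta> \<inter> dom \<and>
      (\<forall>x\<in>P. diag x > 0) \<and> (\<forall>x\<in>Q. diag x < 0) \<and> (\<forall>x\<in>ball x0 \<rho>. diag x = 0 \<or> x \<in> P \<union> Q))"
proof -
  define X where "X q = top (fst q) - top (snd q)" for q
  define V where "V q = nrm (mi (X q) - X q)" for q
  define W where "W q = nrm (mi (X q))" for q
  define q0 where "q0 = (\<phi>0, \<psi>0)"
  have q0s: "fst q0 = \<phi>0" "snd q0 = \<psi>0" by (simp_all add: q0_def)
  have X0: "X q0 = x0" by (simp add: X_def q0_def x0)
  have contX: "continuous_on S X" for S unfolding X_def by (intro continuous_intros)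
  \<comment> \<open>\<open>O1\<close> is the region of the coordinates in which \<open>pl (X q)\<close> is the point with the first angle\<close>
  define O1 where "O1 = {q :: real \<times> real. sin (snd q - fst q) > 0}"
  have oO1: "open O1" unfolding O1_def by (intro open_Collect_less continuous_intros)
  have XO1: "X q \<in> dom" "pl (X q) = top (fst q)" if "q \<in> O1" for q
    using side_chord[of "snd q" "fst q"] that by (auto simp: X_def O1_def)
  have contV: "continuous_on O1 V" "continuous_on O1 W"
    unfolding V_def W_def using XO1(1)
    by (auto intro!: continuous_on_compose2[OF continuous_normals(4) contX] continuous_on_compose2[OF continuous_normals(2) contX])
  have q0O1: "q0 \<in> O1" using s0 by (simp add: O1_def q0_def)
  have unit: "norm (V q) = 1" "norm (W q) = 1" if "q \<in> O1" for q
    using pl_mi(3)[of "X q"] XO1(1)[OF that] norm_nrm by (auto simp: V_def W_def chord_def)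
  have alX: "diag (X q) = cr (dir (fst q)) (V q)" if "q \<in> O1" for q
    using XO1(2)[OF that] by (simp add: diag_def V_def nrm_top)
  have c1: "chord x0 (pl x0)" "chord x0 (mi x0)" and x0d: "x0 \<noteq> 0" "lens x0"
    using pl_mi[of x0] XO1(1)[OF q0O1] by (auto simp: X0)
  have pl0: "pl x0 = top \<phi>0" using XO1(2)[OF q0O1] unfolding X0 by (simp add: q0_def)
  have V0: "dir \<phi>0 \<bullet> V q0 < 0"
  proof -
    have "V q0 = dir \<phi>0 \<or> V q0 = - dir \<phi>0"
    proof (rule cr_eq_0_unit[OF norm_dir unit(1)[OF q0O1]])
      show "cr (dir \<phi>0) (V q0) = 0" using alX[OF q0O1] al0 unfolding X0 by (simp add: q0_def)
    qed
    moreover have "V q0 \<noteq> dir \<phi>0"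
    proof
      assume "V q0 = dir \<phi>0"
      then have "top \<phi>0 = mi x0 - x0" using c1(2) by (intro top_nrm) (auto simp: V_def X0 chord_def)
      then have "pl x0 - mi x0 = - x0" using pl0 by simp
      then show False using cr_pl_mi[OF x0d] by (simp del: cr_bilinear(4))
    qed
    ultimately have "V q0 = - dir \<phi>0" by blast
    then show ?thesis by (simp add: dot_square_norm)
  qed
  \<comment> \<open>up to sign the other diagonal at \<open>x0\<close>; a quarter of it is room enough for two perturbed normals\<close>
  define c0 where "c0 = cr (dir \<psi>0) (W q0)"
  have "pl x0 - x0 = top \<psi>0" unfolding pl0 by (simp add: x0)
  then have c0: "c0 \<noteq> 0" using other cr_swap[of "nrm (mi x0)" "dir \<psi>0"] by (simp add: c0_def W_def X0 nrm_top)
  define \<epsilon> where "\<epsilon> = \<bar>c0\<bar> / 4"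
  have \<epsilon>: "\<epsilon> > 0" using c0 by (simp add: \<epsilon>_def)
  define O2 where "O2 = (O1 \<inter> X -` ball x0 \<eta>) \<inter> (O1 \<inter> (\<lambda>q. dir (fst q) \<bullet> V q) -` {..<0})
    \<inter> (O1 \<inter> (\<lambda>q. dir (snd q)) -` ball (dir \<psi>0) \<epsilon>) \<inter> (O1 \<inter> W -` ball (W q0) \<epsilon>)"
  have "open O2"
    unfolding O2_def
    by (intro open_Int continuous_open_preimage contX contV oO1 continuous_intros) auto
  moreover have "q0 \<in> O2" using q0O1 \<eta> \<epsilon> V0 by (simp add: O2_def X0 q0s)
  ultimately obtain r where r: "r > 0" "ball q0 r \<subseteq> O2" by (rule openE)
  have O2: "q \<in> O1" "X q \<in> ball x0 \<eta>" "dir (fst q) \<bullet> V q < 0" "norm (dir (snd q) - dir \<psi>0) < \<epsilon>" "norm (W q - W q0) < \<epsilon>"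
    if "q \<in> O2" for q
    using that by (auto simp: O2_def dist_norm norm_minus_commute)
  define \<delta> where "\<delta> = min (r / 3) 1"
  have \<delta>: "\<delta> > 0" "\<delta> \<le> r / 3" "\<delta> \<le> 1" using r by (auto simp: \<delta>_def)
  have box: "(\<phi>, \<psi>) \<in> O2" if "\<bar>\<phi> - \<phi>0\<bar> \<le> \<delta>" "\<bar>\<psi> - \<psi>0\<bar> \<le> \<delta>" for \<phi> \<psi>
  proof -
    have "dist q0 (\<phi>, \<psi>) \<le> dist \<phi>0 \<phi> + dist \<psi>0 \<psi>"
      unfolding q0_def dist_Pair_Pair by (rule sqrt_sum_squares_le_sum) auto
    also have "\<dots> < r" using that \<delta> r(1) by (simp add: dist_real_def abs_minus_commute)
    finally show ?thesis using r(2) by auto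
  qed
  have sgn: "c0 * cr (dir (snd q)) (W q') > 0" if "q \<in> O2" "q' \<in> O2" for q q'
  proof -
    let ?u = "dir (snd q)" and ?v = "W q'"
    have "cr ?u ?v - c0 = cr (?u - dir \<psi>0) ?v + cr (dir \<psi>0) (?v - W q0)" by (simp add: c0_def)
    then have "\<bar>cr ?u ?v - c0\<bar> \<le> norm (?u - dir \<psi>0) * norm ?v + norm (dir \<psi>0) * norm (?v - W q0)"
      using abs_cr_le[of "?u - dir \<psi>0" ?v] abs_cr_le[of "dir \<psi>0" "?v - W q0"] by linarith
    also have "\<dots> < \<epsilon> + \<epsilon>" using O2[OF that(1)] O2[OF that(2)] unit(2)[OF O2(1)[OF that(2)]] by simp
    also have "\<dots> < \<bar>c0\<bar>" using c0 by (simp add: \<epsilon>_def)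
    finally have "\<bar>cr ?u ?v - c0\<bar> < \<bar>c0\<bar>" .
    then show ?thesis by (cases "c0 > 0") (auto intro: mult_pos_pos mult_neg_neg)
  qed
  define A where "A q = diag (X q)" for q
  let ?I = "{\<psi>0 - \<delta>..\<psi>0 + \<delta>}"
  have contA: "continuous_on ({\<phi>0 - \<delta>..\<phi>0 + \<delta>} \<times> ?I) A"
    unfolding A_def
  proof (rule continuous_on_compose2[OF continuous_diag contX])
    show "X ` ({\<phi>0 - \<delta>..\<phi>0 + \<delta>} \<times> ?I) \<subseteq> dom"
      using XO1(1)[OF O2(1)[OF box]] by (auto simp: abs_le_iff)
  qed
  have inj: "inj_on (\<lambda>\<psi>. A (\<phi>, \<psi>)) ?I" if phi: "\<bar>\<phi> - \<phi>0\<bar> \<le> \<delta>" for \<phi>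
  proof (rule inj_onI, rule ccontr)
    fix \<psi>1 \<psi>2 assume I: "\<psi>1 \<in> ?I" "\<psi>2 \<in> ?I" and eq: "A (\<phi>, \<psi>1) = A (\<phi>, \<psi>2)" and ne: "\<psi>1 \<noteq> \<psi>2"
    have in_: "(\<phi>, \<psi>1) \<in> O2" "(\<phi>, \<psi>2) \<in> O2" using I phi by (auto intro!: box simp: abs_le_iff)
    have topne: "top \<psi>1 \<noteq> top \<psi>2"
    proof
      assume "top \<psi>1 = top \<psi>2"
      then have "dir \<psi>1 = dir \<psi>2" using nrm_top[of \<psi>1] nrm_top[of \<psi>2] by simp
      then have "cr (dir \<psi>1) (dir \<psi>2) = 0" by (simp only: cr_def diff_self mult.commute)
      then have "sin (\<psi>2 - \<psi>1) = 0" unfolding cr_dir .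
      moreover have "- pi < \<psi>2 - \<psi>1" "\<psi>2 - \<psi>1 < pi"
        using I \<delta>(3) pi_gt3 unfolding atLeastAtMost_iff by linarith+
      ultimately have "\<psi>2 - \<psi>1 = 0" using sin_eq_0_pi by blast
      then show False using ne by simp
    qed
    note O1s = O2(1)[OF in_(1)] O2(1)[OF in_(2)]
    have "V (\<phi>, \<psi>1) = V (\<phi>, \<psi>2)"
    proof (rule unit_eqI[OF norm_dir unit(1)[OF O1s(1)] unit(1)[OF O1s(2)]])
      show "cr (dir \<phi>) (V (\<phi>, \<psi>1)) = cr (dir \<phi>) (V (\<phi>, \<psi>2))"
        using eq unfolding A_def alX[OF O1s(1)] alX[OF O1s(2)] fst_conv .
      show "dir \<phi> \<bullet> V (\<phi>, \<psi>1) < 0" "dir \<phi> \<bullet> V (\<phi>, \<psi>2) < 0"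
        using O2(3)[OF in_(1)] O2(3)[OF in_(2)] unfolding fst_conv by blast+
    qed
    then have same: "nrm (mi (X (\<phi>, \<psi>1)) - X (\<phi>, \<psi>1)) = nrm (mi (X (\<phi>, \<psi>2)) - X (\<phi>, \<psi>2))" by (simp only: V_def)
    have fr: "mi (X q) - X q \<in> frontier K" if "q \<in> O1" for q
      using pl_mi(3)[of "X q"] XO1(1)[OF that] by (simp add: chord_def)
    have "mi (X (\<phi>, \<psi>1)) - X (\<phi>, \<psi>1) = mi (X (\<phi>, \<psi>2)) - X (\<phi>, \<psi>2)"
      by (rule nrm_inj[OF fr[OF O1s(1)] fr[OF O1s(2)] same])
    moreover have "mi (X (\<phi>, \<psi>1)) - X (\<phi>, \<psi>1) \<noteq> mi (X (\<phi>, \<psi>2)) - X (\<phi>, \<psi>2)"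
      unfolding X_def fst_conv snd_conv
    proof (rule opposite_injective[OF _ _ topne])
      show "sin (\<psi>1 - \<phi>) > 0" "sin (\<psi>2 - \<phi>) > 0" using O2(1)[OF in_(1)] O2(1)[OF in_(2)] by (auto simp: O1_def)
      show "c0 * cr (dir i) (nrm (mi (top \<phi> - top j))) > 0" if "i \<in> {\<psi>1, \<psi>2}" "j \<in> {\<psi>1, \<psi>2}" for i j
        using sgn[of "(\<phi>, i)" "(\<phi>, j)"] that in_ by (auto simp: W_def X_def)
    qed
    ultimately show False by blast
  qed
  have A0: "A (\<phi>0, \<psi>0) = 0" using al0 X0 by (simp add: A_def q0_def)
  have isolated: "diag (top \<phi>0 - top \<psi>) \<noteq> 0" if "\<psi> \<noteq> \<psi>0" "\<bar>\<psi> - \<psi>0\<bar> < \<delta>" for \<psi>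
  proof
    assume "diag (top \<phi>0 - top \<psi>) = 0"
    then have eq: "A (\<phi>0, \<psi>) = A (\<phi>0, \<psi>0)" using A0 by (simp add: A_def X_def)
    have "inj_on (\<lambda>\<psi>. A (\<phi>0, \<psi>)) ?I" using \<delta>(1) by (intro inj) simp
    from inj_onD[OF this eq] have "\<psi> = \<psi>0"
      using that(2) \<delta>(1) by (simp add: abs_less_iff)
    then show False using that(1) by simp
  qed
  have cont\<phi>: "continuous_on {\<phi>0 - \<delta>..\<phi>0 + \<delta>} (\<lambda>\<phi>. A (\<phi>, e))" if "e \<in> ?I" for e
    by (rule continuous_on_compose2[OF contA]) (use that in \<open>auto intro!: continuous_intros\<close>)
  have cont\<psi>: "continuous_on ?I (\<lambda>\<psi>. A (\<phi>0, \<psi>))"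
    by (rule continuous_on_compose2[OF contA]) (use \<delta> in \<open>auto intro!: continuous_intros\<close>)
  have "\<exists>e1\<in>?I. \<exists>e2\<in>?I. A (\<phi>0, e1) > 0 \<and> A (\<phi>0, e2) < 0"
    proof -
    have "(A (\<phi>0, \<psi>0 - \<delta>) < A (\<phi>0, \<psi>0) \<and> A (\<phi>0, \<psi>0) < A (\<phi>0, \<psi>0 + \<delta>)) \<or>
        (A (\<phi>0, \<psi>0 + \<delta>) < A (\<phi>0, \<psi>0) \<and> A (\<phi>0, \<psi>0) < A (\<phi>0, \<psi>0 - \<delta>))"
      using continuous_inj_imp_mono[OF _ _ cont\<psi> inj, of \<psi>0] \<delta> by simp
    then show ?thesis using A0 \<delta> by (smt (verit, best) atLeastAtMost_iff)
  qed
  then obtain e1 e2 where e: "e1 \<in> ?I" "e2 \<in> ?I" "A (\<phi>0, e1) > 0" "A (\<phi>0, e2) < 0" by blast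
  have near: "\<exists>d>0. \<forall>\<phi>\<in>{\<phi>0 - \<delta>..\<phi>0 + \<delta>}. dist \<phi> \<phi>0 < d \<longrightarrow> dist (A (\<phi>, e)) (A (\<phi>0, e)) < r"
    if "e \<in> ?I" "r > 0" for e r
  proof -
    have "\<phi>0 \<in> {\<phi>0 - \<delta>..\<phi>0 + \<delta>}" using \<delta> by simp
    then show ?thesis using cont\<phi>[OF that(1)] that(2) unfolding continuous_on_iff by blast
  qed
  obtain d1 where d1: "d1 > 0" "\<forall>\<phi>\<in>{\<phi>0 - \<delta>..\<phi>0 + \<delta>}. dist \<phi> \<phi>0 < d1 \<longrightarrow> dist (A (\<phi>, e1)) (A (\<phi>0, e1)) < A (\<phi>0, e1)"
    using near[OF e(1,3)] by blast
  have "- A (\<phi>0, e2) > 0" using e(4) by simp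
  from near[OF e(2) this] obtain d2 where d2: "d2 > 0" "\<forall>\<phi>\<in>{\<phi>0 - \<delta>..\<phi>0 + \<delta>}. dist \<phi> \<phi>0 < d2 \<longrightarrow> dist (A (\<phi>, e2)) (A (\<phi>0, e2)) < - A (\<phi>0, e2)"
    by blast
  define \<kappa> where "\<kappa> = min \<delta> (min d1 d2 / 2)"
  have \<kappa>: "\<kappa> > 0" "\<kappa> \<le> \<delta>" "\<kappa> < d1" "\<kappa> < d2" using \<delta> d1 d2 by (auto simp: \<kappa>_def)
  let ?J = "{\<phi>0 - \<kappa>..\<phi>0 + \<kappa>}"
  have ends: "A (\<phi>, e1) > 0" "A (\<phi>, e2) < 0" if "\<phi> \<in> ?J" for \<phi>
  proof -
    have "\<phi> \<in> {\<phi>0 - \<delta>..\<phi>0 + \<delta>}" "dist \<phi> \<phi>0 < d1" "dist \<phi> \<phi>0 < d2" using that \<kappa> by (auto simp: dist_real_def abs_less_iff)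
    then have "dist (A (\<phi>, e1)) (A (\<phi>0, e1)) < A (\<phi>0, e1)" "dist (A (\<phi>, e2)) (A (\<phi>0, e2)) < - A (\<phi>0, e2)" using d1(2) d2(2) by auto
    then show "A (\<phi>, e1) > 0" "A (\<phi>, e2) < 0" by (auto simp: dist_real_def abs_less_iff)
  qed
  have sub: "?J \<times> ?I \<subseteq> {\<phi>0 - \<delta>..\<phi>0 + \<delta>} \<times> ?I" using \<kappa> by auto
  have injJ: "inj_on (\<lambda>\<psi>. A (\<phi>, \<psi>)) ?I" if "\<phi> \<in> ?J" for \<phi> using that \<kappa> by (intro inj) (auto simp: abs_le_iff)
  let ?P = "{q \<in> ?J \<times> ?I. A q > 0}" and ?Q = "{q \<in> ?J \<times> ?I. - A q > 0}"
  have conP: "connected ?P"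
    by (rule strip_connected[OF continuous_on_subset[OF contA sub] injJ e(1) ends(1)])
  have contm: "continuous_on (?J \<times> ?I) (\<lambda>q. - A q)"
    by (rule continuous_on_minus[OF continuous_on_subset[OF contA sub]])
  have injm: "inj_on (\<lambda>\<psi>. - A (\<phi>, \<psi>)) ?I" if "\<phi> \<in> ?J" for \<phi>
  proof (rule inj_onI)
    fix x y assume xy: "x \<in> ?I" "y \<in> ?I" and "- A (\<phi>, x) = - A (\<phi>, y)"
    then have "A (\<phi>, x) = A (\<phi>, y)" by linarith
    from inj_onD[OF injJ[OF that] this xy] show "x = y" .
  qed
  have endm: "- A (\<phi>, e2) > 0" if "\<phi> \<in> ?J" for \<phi> using ends(2)[OF that] by linarith
  have conQ: "connected ?Q"
    by (rule strip_connected[OF contm injm e(2) endm])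
  have J0: "\<phi>0 \<in> ?J" using \<kappa> by auto
  have "(\<phi>0, e1) \<in> ?P" "(\<phi>0, e2) \<in> ?Q" using e J0 by simp_all
  then have ne: "X ` ?P \<noteq> {}" "X ` ?Q \<noteq> {}" by blast+
  have inO2: "q \<in> O2" if "q \<in> ?J \<times> ?I" for q
    using that \<kappa> by (cases q) (auto intro!: box simp: abs_le_iff)
  obtain \<epsilon>1 where \<epsilon>1: "\<epsilon>1 > 0" "\<forall>u. norm u = 1 \<and> norm (u - dir \<phi>0) < \<epsilon>1 \<longrightarrow> (\<exists>\<theta>. \<bar>\<theta> - \<phi>0\<bar> < \<kappa> \<and> u = dir \<theta>)"
    using angle_near[OF \<kappa>(1)] by blast
  obtain \<epsilon>2 where \<epsilon>2: "\<epsilon>2 > 0" "\<forall>u. norm u = 1 \<and> norm (u - dir \<psi>0) < \<epsilon>2 \<longrightarrow> (\<exists>\<theta>. \<bar>\<theta> - \<psi>0\<bar> < \<delta> \<and> u = dir \<theta>)"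
    using angle_near[OF \<delta>(1)] by blast
  have n0: "nrm (pl x0) = dir \<phi>0" "nrm (pl x0 - x0) = dir \<psi>0"
    using pl0 \<open>pl x0 - x0 = top \<psi>0\<close> by (simp_all add: nrm_top)
  define N where "N = (dom \<inter> (\<lambda>x. nrm (pl x)) -` ball (dir \<phi>0) \<epsilon>1) \<inter> (dom \<inter> (\<lambda>x. nrm (pl x - x)) -` ball (dir \<psi>0) \<epsilon>2)"
  have "open N" unfolding N_def by (intro open_Int continuous_open_preimage continuous_normals open_dom) auto
  moreover have "x0 \<in> N" using x0d \<epsilon>1 \<epsilon>2 by (simp add: N_def n0)
  ultimately obtain \<rho> where \<rho>: "\<rho> > 0" "ball x0 \<rho> \<subseteq> N" by (rule openE)
  have cover: "diag x = 0 \<or> x \<in> X ` ?P \<union> X ` ?Q" if "x \<in> ball x0 \<rho>" for x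
  proof -
    have "x \<in> N" using that \<rho> by blast
    then have xN: "x \<noteq> 0" "lens x" "norm (nrm (pl x) - dir \<phi>0) < \<epsilon>1" "norm (nrm (pl x - x) - dir \<psi>0) < \<epsilon>2"
      by (auto simp: N_def dist_norm norm_minus_commute)
    have fr: "pl x \<in> frontier K" "pl x - x \<in> frontier K" using pl_mi(1)[OF xN(1,2)] by (auto simp: chord_def)
    obtain \<phi> where phi: "\<bar>\<phi> - \<phi>0\<bar> < \<kappa>" "nrm (pl x) = dir \<phi>" using \<epsilon>1(2) xN(3) norm_nrm[OF fr(1)] by blast
    obtain \<psi> where psi: "\<bar>\<psi> - \<psi>0\<bar> < \<delta>" "nrm (pl x - x) = dir \<psi>" using \<epsilon>2(2) xN(4) norm_nrm[OF fr(2)] by blast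
    have "top \<phi> = pl x" "top \<psi> = pl x - x" using top_nrm[OF fr(1) phi(2)] top_nrm[OF fr(2) psi(2)] by auto
    then have X: "x = X (\<phi>, \<psi>)" by (simp add: X_def)
    have JI: "(\<phi>, \<psi>) \<in> ?J \<times> ?I" using phi(1) psi(1) by (simp add: abs_less_iff)
    consider "diag x = 0" | "A (\<phi>, \<psi>) > 0" | "A (\<phi>, \<psi>) < 0" unfolding A_def X[symmetric] by linarith
    then show ?thesis
    proof cases
      case 1 then show ?thesis by blast
    next
      case 2
      then have "(\<phi>, \<psi>) \<in> ?P" using JI by simp
      then show ?thesis unfolding X by blast
    next
      case 3
      then have "(\<phi>, \<psi>) \<in> ?Q" using JI by simp
      then show ?thesis unfolding X by blast
    qed
  qed
  have "\<exists>\<rho>>0. \<exists>P Q. connected P \<and> connected Q \<and> P \<noteq> {} \<and> Q \<noteq> {} \<and> P \<union> Q \<subseteq> ball x0 \<eta> \<inter> dom \<and>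
      (\<forall>x\<in>P. diag x > 0) \<and> (\<forall>x\<in>Q. diag x < 0) \<and> (\<forall>x\<in>ball x0 \<rho>. diag x = 0 \<or> x \<in> P \<union> Q)"
  proof (rule exI[of _ \<rho>], rule conjI[OF \<rho>(1)], rule exI[of _ "X ` ?P"], rule exI[of _ "X ` ?Q"], intro conjI)
    show "connected (X ` ?P)" by (rule connected_continuous_image[OF contX conP])
    show "connected (X ` ?Q)" by (rule connected_continuous_image[OF contX conQ])
    have XB: "X q \<in> ball x0 \<eta> \<inter> dom" if "q \<in> ?J \<times> ?I" for q
      using O2(2)[OF inO2[OF that]] XO1(1)[OF O2(1)[OF inO2[OF that]]] by (rule IntI)
    show "X ` ?P \<union> X ` ?Q \<subseteq> ball x0 \<eta> \<inter> dom"
      by (rule Un_least; rule image_subsetI; rule XB) simp_all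
    show "\<forall>x\<in>X ` ?P. diag x > 0" by (simp add: A_def[symmetric])
    show "\<forall>x\<in>X ` ?Q. diag x < 0" by (simp add: A_def[symmetric])
    show "\<forall>x\<in>ball x0 \<rho>. diag x = 0 \<or> x \<in> X ` ?P \<union> X ` ?Q" by (rule ballI) (rule cover)
    show "X ` ?P \<noteq> {}" "X ` ?Q \<noteq> {}" by (rule ne)+
  qed
  moreover have "\<exists>\<delta>>0. \<forall>\<psi>. \<psi> \<noteq> \<psi>0 \<and> \<bar>\<psi> - \<psi>0\<bar> < \<delta> \<longrightarrow> diag (top \<phi>0 - top \<psi>) \<noteq> 0"
    using isolated \<delta>(1) by (intro exI[of _ \<delta>]) simp
  ultimately show ?thesis by (intro conjI)
qed

end

section \<open>Coherence of the diagonals of two ovals\<close>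

lemma connected_nonzero_sign:
  fixes f :: "'a::topological_space \<Rightarrow> real"
  assumes "connected S" "continuous_on S f" "\<forall>x\<in>S. f x \<noteq> 0"
  shows "(\<forall>x\<in>S. f x > 0) \<or> (\<forall>x\<in>S. f x < 0)"
proof (rule ccontr)
  assume "\<not> ?thesis"
  then obtain x y where xy: "x \<in> S" "y \<in> S" "f x \<le> 0" "f y \<ge> 0" by (meson not_less)
  have "connected (f ` S)" by (rule connected_continuous_image) (use assms in auto)
  then have "0 \<in> f ` S" using xy unfolding connected_iff_interval by blast
  then show False using assms(3) by auto
qed

text \<open>A function that is both non-negative and non-positive near a point would vanish on an interval; so
  being locally non-negative is a locally constant property.\<close>
lemma sign_constant_isolated_zeros:
  fixes f :: "real \<Rightarrow> real"
  assumes loc: "\<forall>t\<in>{a<..<b}. \<exists>\<delta>>0. (\<forall>u. \<bar>u - t\<bar> < \<delta> \<longrightarrow> f u \<ge> 0) \<or> (\<forall>u. \<bar>u - t\<bar> < \<delta> \<longrightarrow> f u \<le> 0)"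
    and iso: "\<forall>t\<in>{a<..<b}. f t = 0 \<longrightarrow> (\<exists>\<delta>>0. \<forall>u. u \<noteq> t \<and> \<bar>u - t\<bar> < \<delta> \<longrightarrow> f u \<noteq> 0)"
  shows "(\<forall>t\<in>{a<..<b}. f t \<ge> 0) \<or> (\<forall>t\<in>{a<..<b}. f t \<le> 0)"
proof -
  define s where "s t \<longleftrightarrow> (\<exists>\<delta>>0. \<forall>u. \<bar>u - t\<bar> < \<delta> \<longrightarrow> f u \<ge> 0)" for t
  have local: "eventually (\<lambda>u. s t = s u) (at t within {a<..<b})" if t: "t \<in> {a<..<b}" for t
  proof -
    obtain \<delta> where \<delta>: "\<delta> > 0" and sgn: "(\<forall>u. \<bar>u - t\<bar> < \<delta> \<longrightarrow> f u \<ge> 0) \<or> (\<forall>u. \<bar>u - t\<bar> < \<delta> \<longrightarrow> f u \<le> 0)"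
      using loc t by blast
    have "s t = s u" if u: "u \<in> {a<..<b}" "dist u t < \<delta>" for u
    proof (cases "\<forall>u. \<bar>u - t\<bar> < \<delta> \<longrightarrow> f u \<ge> 0")
      case True
      have "s t" unfolding s_def using True \<delta> by blast
      moreover have "s u" unfolding s_def
      proof (intro exI[of _ "\<delta> - \<bar>u - t\<bar>"] conjI allI impI)
        show "\<delta> - \<bar>u - t\<bar> > 0" using u by (simp add: dist_real_def)
        fix w assume "\<bar>w - u\<bar> < \<delta> - \<bar>u - t\<bar>"
        then have "\<bar>w - t\<bar> < \<delta>" by linarith
        then show "f w \<ge> 0" using True by blast
      qed
      ultimately show ?thesis by blast
    next
      case False
      then have neg: "\<forall>u. \<bar>u - t\<bar> < \<delta> \<longrightarrow> f u \<le> 0" using sgn by blast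
      have no: "\<not> s v" if v: "v \<in> {a<..<b}" "\<bar>v - t\<bar> < \<delta>" for v
      proof
        assume "s v"
        then obtain \<delta>1 where d1: "\<delta>1 > 0" "\<forall>u. \<bar>u - v\<bar> < \<delta>1 \<longrightarrow> f u \<ge> 0" unfolding s_def by blast
        have zero: "f w = 0" if "\<bar>w - v\<bar> < \<delta>1" "\<bar>w - v\<bar> < \<delta> - \<bar>v - t\<bar>" for w
        proof -
          have "\<bar>w - t\<bar> < \<delta>" using that(2) by linarith
          then have "f w \<le> 0" using neg by blast
          moreover have "f w \<ge> 0" using d1(2) that(1) by blast
          ultimately show ?thesis by linarith
        qed
        have "f v = 0" using zero[of v] d1(1) v(2) by simp
        then obtain \<delta>2 where d2: "\<delta>2 > 0" "\<forall>u. u \<noteq> v \<and> \<bar>u - v\<bar> < \<delta>2 \<longrightarrow> f u \<noteq> 0" using iso v(1) by blast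
        define w where "w = v + min (min \<delta>1 \<delta>2) (\<delta> - \<bar>v - t\<bar>) / 2"
        have "w \<noteq> v" "\<bar>w - v\<bar> < \<delta>1" "\<bar>w - v\<bar> < \<delta>2" "\<bar>w - v\<bar> < \<delta> - \<bar>v - t\<bar>"
          using d1(1) d2(1) v(2) by (auto simp: w_def min_def)
        then show False using zero d2(2) by blast
      qed
      show ?thesis using no[OF t] no[OF u(1)] u(2) \<delta> by (simp add: dist_real_def)
    qed
    then show ?thesis unfolding eventually_at using \<delta> by blast
  qed
  have const: "s t = s u" if "t \<in> {a<..<b}" "u \<in> {a<..<b}" for t u
    by (rule connected_local_const[OF _ that]) (use local in auto)
  show ?thesis
  proof (cases "\<exists>t\<in>{a<..<b}. s t")
    case True
    then have "s u" if "u \<in> {a<..<b}" for u using const that by blast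
    then have "f u \<ge> 0" if "u \<in> {a<..<b}" for u using that unfolding s_def by force
    then show ?thesis by blast
  next
    case False
    have "f u \<le> 0" if u: "u \<in> {a<..<b}" for u
    proof -
      obtain \<delta> where \<delta>: "\<delta> > 0" and sgn: "(\<forall>v. \<bar>v - u\<bar> < \<delta> \<longrightarrow> f v \<ge> 0) \<or> (\<forall>v. \<bar>v - u\<bar> < \<delta> \<longrightarrow> f v \<le> 0)"
        using loc u by blast
      have "\<not> (\<forall>v. \<bar>v - u\<bar> < \<delta> \<longrightarrow> f v \<ge> 0)" using False u \<delta> unfolding s_def by blast
      then have "\<forall>v. \<bar>v - u\<bar> < \<delta> \<longrightarrow> f v \<le> 0" using sgn by blast
      then show ?thesis using \<delta> by simp
    qed
    then show ?thesis by blast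
  qed
qed

context oval begin

text \<open>The other diagonal of the same parallelogram, with the head \<open>mi x\<close>.\<close>
definition diag' :: "real^2 \<Rightarrow> real" where "diag' x = cr (nrm (mi x)) (nrm (pl x - x))"

lemma first_diagonal:
  assumes "x \<noteq> 0" "lens x"
  shows "x + (pl x - mi x) \<noteq> 0" "chord (x + (pl x - mi x)) (pl x)" "cs (x + (pl x - mi x)) (pl x) = diag x"
proof -
  have c: "chord x (pl x)" "chord x (mi x)" using pl_mi[OF assms] by auto
  show "x + (pl x - mi x) \<noteq> 0"
  proof
    assume "x + (pl x - mi x) = 0"
    then have "pl x - mi x = - x" by (simp add: add_eq_0_iff)
    then have "cr x (pl x - mi x) = 0" by (simp only: cr_bilinear minus_zero)
    then show False using cr_pl_mi[OF assms] by linarith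
  qed
  have e: "pl x - (x + (pl x - mi x)) = mi x - x" by simp
  show "chord (x + (pl x - mi x)) (pl x)" "cs (x + (pl x - mi x)) (pl x) = diag x"
    using c unfolding chord_def cs_def diag_def e by auto
qed

lemma second_diagonal:
  assumes "x \<noteq> 0" "lens x"
  shows "x - (pl x - mi x) \<noteq> 0" "chord (x - (pl x - mi x)) (mi x)" "cs (x - (pl x - mi x)) (mi x) = diag' x"
proof -
  have c: "chord x (pl x)" "chord x (mi x)" using pl_mi[OF assms] by auto
  show "x - (pl x - mi x) \<noteq> 0"
  proof
    assume "x - (pl x - mi x) = 0"
    then have "pl x - mi x = x" by simp
    then have "cr x (pl x - mi x) = 0" by (simp only: cr_bilinear)
    then show False using cr_pl_mi[OF assms] by linarith
  qed
  have e: "mi x - (x - (pl x - mi x)) = pl x - x" by simp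
  show "chord (x - (pl x - mi x)) (mi x)" "cs (x - (pl x - mi x)) (mi x) = diag' x"
    using c unfolding chord_def cs_def diag'_def e by auto
qed

lemma diagonal_top:
  assumes x: "x \<noteq> 0" "lens x"
  shows "diag x = 0 \<Longrightarrow> pl x = top \<phi> \<Longrightarrow> mi x - x = top (\<phi> + pi)"
    and "diag' x = 0 \<Longrightarrow> pl x - x = top \<psi> \<Longrightarrow> mi x = top (\<psi> + pi)"
proof -
  note f = first_diagonal[OF x] and s = second_diagonal[OF x]
  have c: "chord x (pl x)" "chord x (mi x)" using pl_mi[OF x] by auto
  show "mi x - x = top (\<phi> + pi)" if "diag x = 0" "pl x = top \<phi>"
  proof -
    have "nrm (mi x - x) = - nrm (pl x)" using cs_zero_antipodal[OF f(1,2)] f(3) that(1) by simp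
    then have "nrm (mi x - x) = dir (\<phi> + pi)" unfolding that(2) nrm_top dir_add_pi .
    moreover have "mi x - x \<in> frontier K" using c(2) by (simp add: chord_def)
    ultimately show ?thesis using top_nrm by metis
  qed
  show "mi x = top (\<psi> + pi)" if "diag' x = 0" "pl x - x = top \<psi>"
  proof -
    have "nrm (pl x - x) = - nrm (mi x)" using cs_zero_antipodal[OF s(1,2)] s(3) that(1) by simp
    then have "nrm (mi x) = - dir \<psi>" unfolding that(2) nrm_top by simp
    then have "nrm (mi x) = dir (\<psi> + pi)" unfolding dir_add_pi .
    moreover have "mi x \<in> frontier K" using c(2) by (simp add: chord_def)
    ultimately show ?thesis using top_nrm by metis
  qed
qed

text \<open>The diagonals of a parallelogram bisect each other.\<close>
lemma both_diagonals_antipodal: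
  assumes s: "sin (\<psi> - \<phi>) > 0" and x: "x = top \<phi> - top \<psi>" and z: "diag x = 0" "diag' x = 0"
  shows "ctr \<psi> = ctr \<phi>"
proof -
  note sc = side_chord[OF s, folded x]
  have "pl x - x = top \<psi>" unfolding sc(3) by (simp add: x)
  then have 2: "mi x = top (\<psi> + pi)" using diagonal_top(2)[OF sc(1,2) z(2)] by blast
  have "mi x - x = top (\<phi> + pi)" using diagonal_top(1)[OF sc(1,2) z(1) sc(3)] .
  then have "top \<psi> + top (\<psi> + pi) = top \<phi> + top (\<phi> + pi)" unfolding 2[symmetric] x by (simp add: algebra_simps)
  then show ?thesis by (simp add: ctr_def)
qed

text \<open>Two affine diameters with a common midpoint are the diagonals of an inscribed parallelogram.\<close>
lemma symmetric_diagonal: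
  assumes s: "sin (\<psi> - \<phi>) > 0" and c: "ctr \<psi> = ctr \<phi>"
  shows "diag (top \<phi> - top \<psi>) = 0"
proof -
  define x where "x = top \<phi> - top \<psi>"
  note sc = side_chord[OF s, folded x_def]
  have "top \<psi> + top (\<psi> + pi) = top \<phi> + top (\<phi> + pi)" using c by (simp add: ctr_def)
  then have e: "top (\<psi> + pi) - x = top (\<phi> + pi)" by (simp add: x_def algebra_simps)
  have "mi x = top (\<psi> + pi)"
  proof (rule mi_eqI[OF sc(1)])
    show "chord x (top (\<psi> + pi))" unfolding chord_def e by (simp add: top_frontier)
    have "sin (\<phi> - \<psi>) < 0" using s sin_minus[of "\<psi> - \<phi>"] by simp
    then show "cs x (top (\<psi> + pi)) < 0" unfolding cs_def e nrm_top cr_dir by simp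
  qed
  then have "diag x = sin ((\<phi> + pi) - \<phi>)" unfolding diag_def sc(3) by (simp only: e nrm_top cr_dir)
  then show ?thesis by (simp add: x_def)
qed

end

context oval_pair begin

text \<open>The diagonals have the same vector in \<open>K\<close> and in \<open>L\<close> by \<open>twin_eq\<close>, and a chord joins antipodal
  points exactly if the covariogram vanishes at its vector.\<close>
lemma diag_zero_eq:
  assumes x: "x \<noteq> 0" "K.lens x"
  shows "K.diag x = 0 \<longleftrightarrow> L.diag x = 0" "K.diag' x = 0 \<longleftrightarrow> L.diag' x = 0"
proof -
  have xL: "L.lens x" using x(2) lens_eq by blast
  note D = twin_eq[OF x]
  note K = K.first_diagonal[OF x] K.second_diagonal[OF x]
  note L = L.first_diagonal[OF x(1) xL, folded D] L.second_diagonal[OF x(1) xL, folded D]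
  show "K.diag x = 0 \<longleftrightarrow> L.diag x = 0" using chord_sign_zero_eq[OF K(1,2) L(2)] unfolding K(3) L(3) .
  show "K.diag' x = 0 \<longleftrightarrow> L.diag' x = 0" using chord_sign_zero_eq[OF K(4,5) L(5)] unfolding K(6) L(6) .
qed

text \<open>On the two pieces on which \<open>K.diag\<close> has a sign, \<open>L.diag\<close> has no zeros and hence constant signs.
  These are different because \<open>L.diag\<close> takes both signs arbitrarily near \<open>x0\<close>, where only the two pieces
  and zeros are found.\<close>
lemma product_local_sign:
  assumes x0: "x0 \<noteq> 0" "K.lens x0" and z: "K.diag x0 = 0" "K.diag' x0 \<noteq> 0"
  shows "\<exists>\<rho>>0. (\<forall>x\<in>ball x0 \<rho>. K.diag x * L.diag x \<ge> 0) \<or> (\<forall>x\<in>ball x0 \<rho>. K.diag x * L.diag x \<le> 0)"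
proof -
  have x0L: "L.lens x0" and zL: "L.diag x0 = 0" "L.diag' x0 \<noteq> 0" using x0 z lens_eq diag_zero_eq[OF x0] by auto
  have cK: "K.chord x0 (K.pl x0)" "K.cs x0 (K.pl x0) > 0" using K.pl_mi[OF x0] by auto
  have cL: "L.chord x0 (L.pl x0)" "L.cs x0 (L.pl x0) > 0" using L.pl_mi[OF x0(1) x0L] by auto
  obtain \<phi> \<psi> where K: "K.pl x0 = K.top \<phi>" "K.pl x0 - x0 = K.top \<psi>"
    using cK(1) K.top_surj unfolding K.chord_def by blast
  obtain \<phi>' \<psi>' where L: "L.pl x0 = L.top \<phi>'" "L.pl x0 - x0 = L.top \<psi>'"
    using cL(1) L.top_surj unfolding L.chord_def by blast
  have sK: "sin (\<psi> - \<phi>) > 0" using cK(2) unfolding K.cs_def K(2) unfolding K(1) K.nrm_top cr_dir .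
  have sL: "sin (\<psi>' - \<phi>') > 0" using cL(2) unfolding L.cs_def L(2) unfolding L(1) L.nrm_top cr_dir .
  have xK: "x0 = K.top \<phi> - K.top \<psi>" unfolding K(2)[symmetric] K(1)[symmetric] by simp
  have xL: "x0 = L.top \<phi>' - L.top \<psi>'" unfolding L(2)[symmetric] L(1)[symmetric] by simp
  from K.diag_crossing[OF sK xK z(1) z(2)[unfolded K.diag'_def] zero_less_one]
  obtain \<rho> P Q where \<rho>: "\<rho> > 0" and con: "connected P" "connected Q"
    and sub: "P \<union> Q \<subseteq> ball x0 1 \<inter> K.dom" and sg: "\<forall>x\<in>P. K.diag x > 0" "\<forall>x\<in>Q. K.diag x < 0"
    and cover: "\<forall>x\<in>ball x0 \<rho>. K.diag x = 0 \<or> x \<in> P \<union> Q"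
    by blast
  from L.diag_crossing[OF sL xL zL(1) zL(2)[unfolded L.diag'_def] \<rho>]
  obtain P' Q' where ne': "P' \<noteq> {}" "Q' \<noteq> {}"
    and sub': "P' \<union> Q' \<subseteq> ball x0 \<rho> \<inter> L.dom" and sg': "\<forall>x\<in>P'. L.diag x > 0" "\<forall>x\<in>Q'. L.diag x < 0"
    by blast
  have domeq: "L.dom = K.dom" using lens_eq by auto
  have const: "(\<forall>x\<in>S. L.diag x > 0) \<or> (\<forall>x\<in>S. L.diag x < 0)"
    if S: "connected S" "S \<subseteq> K.dom" "\<forall>x\<in>S. K.diag x \<noteq> 0" for S
  proof (rule connected_nonzero_sign[OF S(1)])
    show "continuous_on S L.diag" by (rule continuous_on_subset[OF L.continuous_diag]) (use S(2) domeq in simp)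
    show "\<forall>x\<in>S. L.diag x \<noteq> 0"
    proof
      fix x assume xS: "x \<in> S"
      then have "x \<noteq> 0" "K.lens x" using S(2) by auto
      from diag_zero_eq(1)[OF this] show "L.diag x \<noteq> 0" using S(3) xS by simp
    qed
  qed
  have cP: "(\<forall>x\<in>P. L.diag x > 0) \<or> (\<forall>x\<in>P. L.diag x < 0)"
    by (rule const[OF con(1)]) (use sub sg in auto)
  have cQ: "(\<forall>x\<in>Q. L.diag x > 0) \<or> (\<forall>x\<in>Q. L.diag x < 0)"
    by (rule const[OF con(2)]) (use sub sg in auto)
  obtain p q where pq: "p \<in> P'" "q \<in> Q'" using ne' by blast
  have Lp: "L.diag p > 0" and Lq: "L.diag q < 0" using pq sg' by auto
  have inPQ: "r \<in> P \<union> Q" if r: "r \<in> P' \<union> Q'" for r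
  proof -
    have "r \<in> ball x0 \<rho>" "r \<noteq> 0" "K.lens r" using r sub' domeq by auto
    moreover have "L.diag r \<noteq> 0" using r sg' by auto
    ultimately show ?thesis using cover diag_zero_eq(1)[of r] by blast
  qed
  have pPQ: "p \<in> P \<union> Q" using inPQ[of p] pq(1) by simp
  have qPQ: "q \<in> P \<union> Q" using inPQ[of q] pq(2) by simp
  have "\<not> ((\<forall>x\<in>P. L.diag x > 0) \<and> (\<forall>x\<in>Q. L.diag x > 0))"
  proof
    assume "(\<forall>x\<in>P. L.diag x > 0) \<and> (\<forall>x\<in>Q. L.diag x > 0)"
    then have "L.diag q > 0" using qPQ by blast
    then show False using Lq by simp
  qed
  moreover have "\<not> ((\<forall>x\<in>P. L.diag x < 0) \<and> (\<forall>x\<in>Q. L.diag x < 0))"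
  proof
    assume "(\<forall>x\<in>P. L.diag x < 0) \<and> (\<forall>x\<in>Q. L.diag x < 0)"
    then have "L.diag p < 0" using pPQ by blast
    then show False using Lp by simp
  qed
  ultimately have "((\<forall>x\<in>P. L.diag x > 0) \<and> (\<forall>x\<in>Q. L.diag x < 0)) \<or> ((\<forall>x\<in>P. L.diag x < 0) \<and> (\<forall>x\<in>Q. L.diag x > 0))"
    using cP cQ by argo
  then show ?thesis
  proof (elim disjE conjE)
    assume L: "\<forall>x\<in>P. L.diag x > 0" "\<forall>x\<in>Q. L.diag x < 0"
    have "K.diag x * L.diag x \<ge> 0" if xb: "x \<in> ball x0 \<rho>" for x
    proof -
      consider "K.diag x = 0" | "x \<in> P" | "x \<in> Q" using cover xb by blast
      then show ?thesis
      proof cases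
        case 1 then show ?thesis by simp
      next
        case 2 then show ?thesis using sg(1) L(1) by (simp add: less_imp_le)
      next
        case 3 then show ?thesis using sg(2) L(2) by (simp add: mult_nonpos_nonpos less_imp_le)
      qed
    qed
    then show ?thesis using \<rho> by blast
  next
    assume L: "\<forall>x\<in>P. L.diag x < 0" "\<forall>x\<in>Q. L.diag x > 0"
    have "K.diag x * L.diag x \<le> 0" if xb: "x \<in> ball x0 \<rho>" for x
    proof -
      consider "K.diag x = 0" | "x \<in> P" | "x \<in> Q" using cover xb by blast
      then show ?thesis
      proof cases
        case 1 then show ?thesis by simp
      next
        case 2 then show ?thesis using sg(1) L(1) by (simp add: mult_nonneg_nonpos less_imp_le)
      next
        case 3 then show ?thesis using sg(2) L(2) by (simp add: mult_nonpos_nonneg less_imp_le)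
      qed
    qed
    then show ?thesis using \<rho> by blast
  qed
qed

text \<open>By \<open>both_diagonals_antipodal\<close> the hypothesis excludes that both diagonals join antipodal points, so
  that \<open>product_local_sign\<close> and \<open>diag_crossing\<close> apply at every zero.\<close>
lemma leaf_coherent:
  assumes simple: "\<forall>\<theta>. K.ctr \<theta> = K.ctr \<phi> \<longrightarrow> sin (\<theta> - \<phi>) = 0"
  defines "f \<equiv> \<lambda>\<psi>. K.diag (K.top \<phi> - K.top \<psi>) * L.diag (K.top \<phi> - K.top \<psi>)"
  shows "(\<forall>\<psi>\<in>{\<phi><..<\<phi> + pi}. f \<psi> \<ge> 0) \<or> (\<forall>\<psi>\<in>{\<phi><..<\<phi> + pi}. f \<psi> \<le> 0)"
proof (rule sign_constant_isolated_zeros; intro ballI impI)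
  define X where "X \<psi> = K.top \<phi> - K.top \<psi>" for \<psi>
  have contX: "continuous_on S X" for S unfolding X_def by (intro continuous_intros)
  have f: "f \<psi> = K.diag (X \<psi>) * L.diag (X \<psi>)" for \<psi> by (simp add: f_def X_def)
  have sin_pos: "sin (\<psi> - \<phi>) > 0" if "\<psi> \<in> {\<phi><..<\<phi> + pi}" for \<psi> using that by (intro sin_gt_zero) auto
  have dom: "X \<psi> \<noteq> 0" "K.lens (X \<psi>)" if "\<psi> \<in> {\<phi><..<\<phi> + pi}" for \<psi>
    using K.side_chord[OF sin_pos[OF that]] by (simp_all add: X_def)
  have zero: "K.diag (X \<psi>) = 0" "K.diag' (X \<psi>) \<noteq> 0" if psi: "\<psi> \<in> {\<phi><..<\<phi> + pi}" "f \<psi> = 0" for \<psi>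
  proof -
    show al0: "K.diag (X \<psi>) = 0" using psi(2) diag_zero_eq(1)[OF dom[OF psi(1)]] by (auto simp: f)
    show "K.diag' (X \<psi>) \<noteq> 0"
    proof
      assume "K.diag' (X \<psi>) = 0"
      from K.both_diagonals_antipodal[OF sin_pos[OF psi(1)] X_def al0 this]
      have "sin (\<psi> - \<phi>) = 0" using simple by blast
      then show False using sin_pos[OF psi(1)] by simp
    qed
  qed
  fix \<psi> assume psi: "\<psi> \<in> {\<phi><..<\<phi> + pi}"
  show "\<exists>\<delta>>0. \<forall>u. u \<noteq> \<psi> \<and> \<bar>u - \<psi>\<bar> < \<delta> \<longrightarrow> f u \<noteq> 0" if "f \<psi> = 0"
  proof -
    from K.diag_crossing[OF sin_pos[OF psi] X_def zero(1)[OF psi that] zero(2)[OF psi that, unfolded K.diag'_def] zero_less_one]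
    obtain \<delta> where \<delta>: "\<delta> > 0" "\<forall>u. u \<noteq> \<psi> \<and> \<bar>u - \<psi>\<bar> < \<delta> \<longrightarrow> K.diag (X u) \<noteq> 0" unfolding X_def by blast
    define \<delta>' where "\<delta>' = min \<delta> (min (\<psi> - \<phi>) (\<phi> + pi - \<psi>))"
    have \<delta>': "\<delta>' > 0" "\<delta>' \<le> \<delta>" "\<delta>' \<le> \<psi> - \<phi>" "\<delta>' \<le> \<phi> + pi - \<psi>" using \<delta>(1) psi by (auto simp: \<delta>'_def)
    have "f u \<noteq> 0" if u: "u \<noteq> \<psi>" "\<bar>u - \<psi>\<bar> < \<delta>'" for u
    proof -
      have "u \<in> {\<phi><..<\<phi> + pi}" using u(2) \<delta>' unfolding greaterThanLessThan_iff by linarith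
      moreover have "K.diag (X u) \<noteq> 0" using \<delta>(2) u \<delta>'(2) by simp
      ultimately show ?thesis using zero(1) by blast
    qed
    then show ?thesis using \<delta>'(1) by blast
  qed
  show "\<exists>\<delta>>0. (\<forall>u. \<bar>u - \<psi>\<bar> < \<delta> \<longrightarrow> 0 \<le> f u) \<or> (\<forall>u. \<bar>u - \<psi>\<bar> < \<delta> \<longrightarrow> f u \<le> 0)"
  proof (cases "f \<psi> = 0")
    case True
    from product_local_sign[OF dom[OF psi] zero[OF psi True]]
    obtain \<rho> where \<rho>: "\<rho> > 0"
      "(\<forall>x\<in>ball (X \<psi>) \<rho>. K.diag x * L.diag x \<ge> 0) \<or> (\<forall>x\<in>ball (X \<psi>) \<rho>. K.diag x * L.diag x \<le> 0)" by blast
    obtain \<delta> where \<delta>: "\<delta> > 0" "\<forall>u. dist u \<psi> < \<delta> \<longrightarrow> dist (X u) (X \<psi>) < \<rho>"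
      using contX[of UNIV] \<rho>(1) unfolding continuous_on_iff by blast
    have "X u \<in> ball (X \<psi>) \<rho>" if "\<bar>u - \<psi>\<bar> < \<delta>" for u
    proof -
      have "dist (X u) (X \<psi>) < \<rho>" using \<delta>(2) that by (simp add: dist_real_def)
      then show ?thesis by (simp add: dist_commute)
    qed
    then show ?thesis unfolding f using \<rho>(2) \<delta>(1) by blast
  next
    case False
    have "continuous_on {\<phi><..<\<phi> + pi} f"
    proof -
      have "continuous_on {\<phi><..<\<phi> + pi} (\<lambda>\<psi>. K.diag (X \<psi>))"
        by (rule continuous_on_compose2[OF K.continuous_diag contX]) (use dom in auto)
      moreover have "continuous_on {\<phi><..<\<phi> + pi} (\<lambda>\<psi>. L.diag (X \<psi>))"
        by (rule continuous_on_compose2[OF L.continuous_diag contX]) (use dom lens_eq in auto)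
      ultimately show ?thesis unfolding f_def X_def by (rule continuous_on_mult)
    qed
    then have "isCont f \<psi>" using psi by (simp add: continuous_on_eq_continuous_at)
    moreover have "\<bar>f \<psi>\<bar> > 0" using False by simp
    ultimately obtain \<delta> where \<delta>: "\<delta> > 0" "\<forall>u. dist u \<psi> < \<delta> \<longrightarrow> dist (f u) (f \<psi>) < \<bar>f \<psi>\<bar>"
      unfolding continuous_at_eps_delta by blast
    show ?thesis
    proof (cases "f \<psi> > 0")
      case True
      have "f u \<ge> 0" if "\<bar>u - \<psi>\<bar> < \<delta>" for u
      proof -
        have "\<bar>f u - f \<psi>\<bar> < \<bar>f \<psi>\<bar>" using \<delta>(2) that by (simp add: dist_real_def)
        then show ?thesis using True by linarith
      qed
      then show ?thesis using \<delta>(1) by blast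
    next
      case neg: False
      have "f u \<le> 0" if "\<bar>u - \<psi>\<bar> < \<delta>" for u
      proof -
        have "\<bar>f u - f \<psi>\<bar> < \<bar>f \<psi>\<bar>" using \<delta>(2) that by (simp add: dist_real_def)
        then show ?thesis using neg by linarith
      qed
      then show ?thesis using \<delta>(1) by blast
    qed
  qed
qed

theorem some_leaf_coherent:
  "\<exists>\<phi>. (\<forall>\<psi>\<in>{\<phi><..<\<phi> + pi}. K.diag (K.top \<phi> - K.top \<psi>) * L.diag (K.top \<phi> - K.top \<psi>) \<ge> 0)
     \<or> (\<forall>\<psi>\<in>{\<phi><..<\<phi> + pi}. K.diag (K.top \<phi> - K.top \<psi>) * L.diag (K.top \<phi> - K.top \<psi>) \<le> 0)"
proof (cases "\<exists>\<phi>. \<forall>\<theta>. K.ctr \<theta> = K.ctr \<phi> \<longrightarrow> sin (\<theta> - \<phi>) = 0")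
  case True
  then obtain \<phi> where "\<forall>\<theta>. K.ctr \<theta> = K.ctr \<phi> \<longrightarrow> sin (\<theta> - \<phi>) = 0" by blast
  from leaf_coherent[OF this] show ?thesis by (rule exI)
next
  case False
  then have sym: "\<forall>\<theta> \<phi>. K.ctr \<theta> = K.ctr \<phi>" using K.simple_midpoint_or_symmetric by blast
  have "K.diag (K.top 0 - K.top \<psi>) = 0" if "\<psi> \<in> {0<..<0 + pi}" for \<psi>
  proof (rule K.symmetric_diagonal)
    show "sin (\<psi> - 0) > 0" using that sin_gt_zero[of \<psi>] by simp
    show "K.ctr \<psi> = K.ctr 0" using sym by blast
  qed
  then have "\<forall>\<psi>\<in>{0<..<0 + pi}. K.diag (K.top 0 - K.top \<psi>) * L.diag (K.top 0 - K.top \<psi>) \<ge> 0" by simp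
  then show ?thesis by blast
qed

end

section \<open>Reflection and conclusion\<close>

lemma mem_uminus_image: "x \<in> uminus ` S \<longleftrightarrow> - x \<in> (S :: 'a::group_add set)"
  by force

lemma frontier_uminus: "frontier (uminus ` S) = uminus ` frontier (S :: 'a::euclidean_space set)"
proof -
  have "closure (uminus ` S) = uminus ` closure S" by (rule closure_injective_linear_image[OF linear_uminus, symmetric]) simp
  then show ?thesis unfolding frontier_def interior_negations by (simp add: image_set_diff)
qed

lemma supporting_line_uminus:
  assumes "supporting_line K H"
  shows "supporting_line (uminus ` K) (uminus ` H)"
proof -
  obtain u c where u: "u \<noteq> 0" "H = {x. u \<bullet> x = c}" "K \<subseteq> {x. u \<bullet> x \<le> c}" "H \<inter> K \<noteq> {}"
    using assms unfolding supporting_line_def by blast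
  have "uminus ` H = {x. - u \<bullet> x = c}" unfolding u(2) by (auto simp: mem_uminus_image)
  moreover have "uminus ` K \<subseteq> {x. - u \<bullet> x \<le> c}" using u(3) by auto
  moreover have "uminus ` H \<inter> uminus ` K \<noteq> {}" using u(4) by auto
  moreover have "- u \<noteq> 0" using u(1) by simp
  ultimately show ?thesis unfolding supporting_line_def by blast
qed

lemma supporting_line_uminus_iff: "supporting_line (uminus ` K) H \<longleftrightarrow> supporting_line K (uminus ` H)"
  using supporting_line_uminus[of K "uminus ` H"] supporting_line_uminus[of "uminus ` K" H]
  by (auto simp: image_image)

lemma oval_uminus:
  assumes "oval K"
  shows "oval (uminus ` K)"
proof
  interpret oval K by (rule assms)
  show "convex_body (uminus ` K)"
    unfolding convex_body_def interior_negations
    using compact_negations[OF compact_K] convex_negations[OF convex_K] interior_K by simp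
  show "strictly_convex (uminus ` K)"
    unfolding strictly_convex_def frontier_uminus
  proof (intro allI impI notI)
    fix p q :: "real^2" assume "p \<noteq> q" and sub: "closed_segment p q \<subseteq> uminus ` frontier K"
    have "closed_segment (- p) (- q) = uminus ` closed_segment p q"
      by (rule closed_segment_linear_image[OF linear_uminus])
    also have "\<dots> \<subseteq> frontier K" using image_mono[OF sub, of uminus] by (simp add: image_image)
    finally have "closed_segment (- p) (- q) \<subseteq> frontier K" .
    then show False using strict \<open>p \<noteq> q\<close> unfolding strictly_convex_def by (metis neg_equal_iff_equal)
  qed
  show "C1_regular (uminus ` K)"
    unfolding C1_regular_def frontier_uminus
  proof
    fix p assume "p \<in> uminus ` frontier K"
    then have "- p \<in> frontier K" by (simp add: mem_uminus_image)
    then obtain H where H: "supporting_line K H" "- p \<in> H" and uniq: "\<forall>H'. supporting_line K H' \<and> - p \<in> H' \<longrightarrow> H' = H"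
      using smooth unfolding C1_regular_def by (metis (no_types))
    show "\<exists>!H. supporting_line (uminus ` K) H \<and> p \<in> H"
    proof (rule ex1I[of _ "uminus ` H"])
      show "supporting_line (uminus ` K) (uminus ` H) \<and> p \<in> uminus ` H"
        using supporting_line_uminus[OF H(1)] H(2) by (simp add: mem_uminus_image)
      fix H' assume "supporting_line (uminus ` K) H' \<and> p \<in> H'"
      then have "supporting_line K (uminus ` H') \<and> - p \<in> uminus ` H'"
        by (simp add: supporting_line_uminus_iff mem_uminus_image)
      then have "uminus ` H' = H" using uniq by blast
      then show "H' = uminus ` H" by (auto simp: image_image)
    qed
  qed
qed

text \<open>The lens of \<open>- K\<close> is the image of the lens of \<open>K\<close> under the reflection that takes \<open>y\<close> to \<open>x - y\<close>.\<close>
lemma covariogram_uminus: "covariogram (uminus ` K) x = covariogram K x"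
proof -
  have "uminus ` K \<inter> (\<lambda>y. y + x) ` (uminus ` K) = (\<lambda>z. (- 1) *\<^sub>R z + x) ` (K \<inter> (\<lambda>y. y + x) ` K)"
  proof (rule set_eqI)
    fix y
    have "y \<in> (\<lambda>z. (- 1) *\<^sub>R z + x) ` (K \<inter> (\<lambda>y. y + x) ` K) \<longleftrightarrow> x - y \<in> K \<inter> (\<lambda>y. y + x) ` K"
      by (force simp: image_iff algebra_simps)
    also have "\<dots> \<longleftrightarrow> - y \<in> K \<and> x - y \<in> K" by (auto simp: mem_translate_iff)
    also have "\<dots> \<longleftrightarrow> y \<in> uminus ` K \<inter> (\<lambda>y. y + x) ` (uminus ` K)" by (auto simp: mem_translate_iff mem_uminus_image)
    finally show "y \<in> uminus ` K \<inter> (\<lambda>y. y + x) ` (uminus ` K) \<longleftrightarrow> y \<in> (\<lambda>z. (- 1) *\<^sub>R z + x) ` (K \<inter> (\<lambda>y. y + x) ` K)" by simp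
  qed
  then show ?thesis unfolding covariogram_def
    using measure_lebesgue_affine[of "- 1" x "K \<inter> (\<lambda>y. y + x) ` K"] by simp
qed

context oval begin

text \<open>Reflection exchanges head and tail of a chord and the roles of \<open>pl\<close> and \<open>mi\<close>; the reflected
  diagonal is traversed backwards, which reverses the angle between the normals.\<close>
lemma diag_uminus:
  assumes x: "x \<noteq> 0" "lens x"
  shows "oval.diag (uminus ` K) x = - diag x"
proof -
  interpret N: oval "uminus ` K" by (rule oval_uminus) (rule oval_axioms)
  have fr: "p \<in> frontier (uminus ` K) \<longleftrightarrow> - p \<in> frontier K" for p
    unfolding frontier_uminus mem_uminus_image ..
  have nrm: "N.nrm (- p) = - nrm p" if p: "p \<in> frontier K" for p
  proof (rule N.nrm_eqI)
    show "- p \<in> frontier (uminus ` K)" using p by (simp add: fr)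
    show "norm (- nrm p) = 1" using norm_nrm[OF p] by simp
    fix q assume "q \<in> uminus ` K"
    then have "- q \<in> K" by (simp add: mem_uminus_image)
    then show "- nrm p \<bullet> q \<le> - nrm p \<bullet> - p" using nrm_max[OF p] by fastforce
  qed
  have chord: "N.chord x (x - b)" and cs: "N.cs x (x - b) = - cs x b" if b: "chord x b" for b
  proof -
    have f: "b \<in> frontier K" "b - x \<in> frontier K" using b by (simp_all add: chord_def)
    have e: "x - b = - (b - x)" "x - b - x = - b" by simp_all
    show "N.chord x (x - b)" unfolding N.chord_def fr using f by simp
    have "N.cs x (x - b) = cr (- nrm (b - x)) (- nrm b)"
      unfolding N.cs_def e(2) unfolding e(1) nrm[OF f(1)] nrm[OF f(2)] ..
    then show "N.cs x (x - b) = - cs x b" by (simp add: cs_def cr_swap[of "nrm b"])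
  qed
  note c = pl_mi[OF x]
  have pl: "N.pl x = - (mi x - x)"
    using N.pl_eqI[OF x(1) chord[OF c(3)]] cs[OF c(3)] c(4) by simp
  have mi: "N.mi x - x = - pl x"
    using N.mi_eqI[OF x(1) chord[OF c(1)]] cs[OF c(1)] c(2) by simp
  have "pl x \<in> frontier K" "mi x - x \<in> frontier K" using c(1,3) by (simp_all add: chord_def)
  then have "N.diag x = cr (- nrm (mi x - x)) (- nrm (pl x))" unfolding N.diag_def pl mi by (simp only: nrm)
  then show ?thesis by (simp add: diag_def cr_swap[of "nrm (pl x)"])
qed

lemma frontier_point_on_side:
  assumes z: "z \<in> frontier K" and s: "cs (top \<phi> - z) (top \<phi>) > 0"
  shows "\<exists>\<psi>\<in>{\<phi><..<\<phi> + pi}. z = top \<psi>"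
proof -
  obtain \<theta> where th: "z = top \<theta>" using top_surj[OF z] by blast
  have s: "sin (\<theta> - \<phi>) > 0" using s unfolding th cs_def by (simp add: nrm_top cr_dir)
  then obtain t where t: "0 \<le> t" "t \<le> pi" "cos (\<theta> - \<phi>) = cos t" "sin (\<theta> - \<phi>) = sin t"
    using sincos_total_pi[of "sin (\<theta> - \<phi>)" "cos (\<theta> - \<phi>)"] by auto
  have "t \<noteq> 0" "t \<noteq> pi" using s t(4) by auto
  then have I: "\<phi> + t \<in> {\<phi><..<\<phi> + pi}" using t(1,2) by simp
  have cs: "cos \<theta> = cos (\<phi> + t)" "sin \<theta> = sin (\<phi> + t)"
    using cos_add[of "\<theta> - \<phi>" \<phi>] sin_add[of "\<theta> - \<phi>" \<phi>] t(3,4) by (simp_all add: cos_add sin_add algebra_simps)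
  have "dir \<theta> = dir (\<phi> + t)" unfolding dir_def cs ..
  then show ?thesis using I unfolding th top_def by (intro bexI[of _ "\<phi> + t"]) simp_all
qed

lemma arc_avoiding_point: "\<exists>B. B \<subseteq> frontier K - {top \<phi>} \<and> connected B \<and> (\<exists>p\<in>B. \<exists>q\<in>B. p \<noteq> q)"
proof -
  \<comment> \<open>the angles \<open>\<phi> + 1\<close> and \<open>\<phi> + 2\<close> serve as well as any two inside the half turn after \<open>\<phi>\<close>\<close>
  have ne: "top a \<noteq> top b" if "sin (b - a) > 0" for a b
    using side_chord(1)[OF that] by auto
  have "sin (\<theta> - \<phi>) > 0" if "\<theta> \<in> {\<phi> + 1..\<phi> + 2}" for \<theta>
    using that pi_gt3 by (intro sin_gt_zero) auto
  then have "top \<theta> \<noteq> top \<phi>" if "\<theta> \<in> {\<phi> + 1..\<phi> + 2}" for \<theta> using ne[of \<theta> \<phi>] that by metis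
  then have sub: "top ` {\<phi> + 1..\<phi> + 2} \<subseteq> frontier K - {top \<phi>}"
    using top_frontier by (intro image_subsetI) simp
  have con: "connected (top ` {\<phi> + 1..\<phi> + 2})"
    by (intro connected_continuous_image continuous_top continuous_on_id connected_Icc)
  have "top (\<phi> + 1) \<noteq> top (\<phi> + 2)" using pi_gt3 by (intro ne sin_gt_zero) auto
  moreover have "top (\<phi> + 1) \<in> top ` {\<phi> + 1..\<phi> + 2}" "top (\<phi> + 2) \<in> top ` {\<phi> + 1..\<phi> + 2}" by auto
  ultimately show ?thesis using sub con by blast
qed

end

context oval_pair begin

lemma translate_of_coherent_leaf:
  assumes "\<forall>\<psi>\<in>{\<phi><..<\<phi> + pi}. K.diag (K.top \<phi> - K.top \<psi>) * L.diag (K.top \<phi> - K.top \<psi>) \<ge> 0"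
  shows "\<exists>v. \<forall>z\<in>frontier K - {K.top \<phi>}. z + v \<in> frontier L"
proof (rule coherent_translate[OF K.top_frontier])
  fix z assume "z \<in> frontier K" "K.cs (K.top \<phi> - z) (K.top \<phi>) > 0"
  from K.frontier_point_on_side[OF this] obtain \<psi> where "\<psi> \<in> {\<phi><..<\<phi> + pi}" "z = K.top \<psi>" by blast
  then show "K.diag (K.top \<phi> - z) * L.diag (K.top \<phi> - z) \<ge> 0" using assms by blast
qed

end

theorem proposition1p2:
  fixes K L :: "(real^2) set"
  assumes "convex_body K" and "strictly_convex K" and "C1_regular K"
    and "convex_body L" and "strictly_convex L" and "C1_regular L"
    and "\<forall>x. covariogram K x = covariogram L x"
  shows "\<exists>A a. nondegenerate_boundary_arc L A \<and>
           ((\<lambda>x. x + a) ` A \<subseteq> frontier K \<or> (\<lambda>x. - x + a) ` A \<subseteq> frontier K)"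
proof -
  have oL: "oval L" using assms by unfold_locales
  interpret P: oval_pair K L using assms by unfold_locales auto
  interpret N: oval "uminus ` L" by (rule oval_uminus[OF oL])
  interpret Q: oval_pair K "uminus ` L"
    by unfold_locales (use assms(7) in \<open>simp add: covariogram_uminus\<close>)
  obtain \<phi> where \<phi>: "(\<forall>\<psi>\<in>{\<phi><..<\<phi> + pi}. P.K.diag (P.K.top \<phi> - P.K.top \<psi>) * P.L.diag (P.K.top \<phi> - P.K.top \<psi>) \<ge> 0)
     \<or> (\<forall>\<psi>\<in>{\<phi><..<\<phi> + pi}. P.K.diag (P.K.top \<phi> - P.K.top \<psi>) * P.L.diag (P.K.top \<phi> - P.K.top \<psi>) \<le> 0)"
    using P.some_leaf_coherent ..
  obtain B where B: "B \<subseteq> frontier K - {P.K.top \<phi>}" "connected B" "\<exists>p\<in>B. \<exists>q\<in>B. p \<noteq> q"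
    using P.K.arc_avoiding_point[of \<phi>] by blast
  from \<phi> show ?thesis
  proof
    assume "\<forall>\<psi>\<in>{\<phi><..<\<phi> + pi}. P.K.diag (P.K.top \<phi> - P.K.top \<psi>) * P.L.diag (P.K.top \<phi> - P.K.top \<psi>) \<ge> 0"
    from P.translate_of_coherent_leaf[OF this]
    obtain v where v: "\<forall>z\<in>frontier K - {P.K.top \<phi>}. z + v \<in> frontier L" by blast
    let ?A = "(\<lambda>z. z + v) ` B"
    have "nondegenerate_boundary_arc L ?A"
      unfolding nondegenerate_boundary_arc_def
    proof (intro conjI)
      show "?A \<subseteq> frontier L" using v B(1) by blast
      show "connected ?A" by (intro connected_continuous_image continuous_intros B(2))
      show "\<exists>p\<in>?A. \<exists>q\<in>?A. p \<noteq> q" using B(3) by auto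
    qed
    moreover have "(\<lambda>x. x + (- v)) ` ?A \<subseteq> frontier K" using B(1) by (auto simp: image_image)
    ultimately show ?thesis by blast
  next
    assume le: "\<forall>\<psi>\<in>{\<phi><..<\<phi> + pi}. P.K.diag (P.K.top \<phi> - P.K.top \<psi>) * P.L.diag (P.K.top \<phi> - P.K.top \<psi>) \<le> 0"
    have "P.K.diag (P.K.top \<phi> - P.K.top \<psi>) * N.diag (P.K.top \<phi> - P.K.top \<psi>) \<ge> 0" if psi: "\<psi> \<in> {\<phi><..<\<phi> + pi}" for \<psi>
    proof -
      let ?x = "P.K.top \<phi> - P.K.top \<psi>"
      have "sin (\<psi> - \<phi>) > 0" using psi by (intro sin_gt_zero) auto
      note sc = P.K.side_chord(1,2)[OF this]
      have "N.diag ?x = - P.L.diag ?x" by (rule P.L.diag_uminus[OF sc(1)]) (use sc(2) P.lens_eq in blast)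
      then show ?thesis using le psi by simp
    qed
    then have "\<forall>\<psi>\<in>{\<phi><..<\<phi> + pi}. P.K.diag (P.K.top \<phi> - P.K.top \<psi>) * N.diag (P.K.top \<phi> - P.K.top \<psi>) \<ge> 0" by (rule ballI)
    from Q.translate_of_coherent_leaf[OF this]
    obtain v where v: "\<forall>z\<in>frontier K - {P.K.top \<phi>}. z + v \<in> frontier (uminus ` L)" by blast
    let ?A = "(\<lambda>z. - (z + v)) ` B"
    have "nondegenerate_boundary_arc L ?A"
      unfolding nondegenerate_boundary_arc_def
    proof (intro conjI)
      show "?A \<subseteq> frontier L"
      proof (rule image_subsetI)
        fix z assume "z \<in> B"
        then have "z + v \<in> uminus ` frontier L" using v B(1) unfolding frontier_uminus by blast
        then show "- (z + v) \<in> frontier L" unfolding mem_uminus_image .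
      qed
      show "connected ?A" by (intro connected_continuous_image continuous_intros B(2))
      show "\<exists>p\<in>?A. \<exists>q\<in>?A. p \<noteq> q" using B(3) by auto
    qed
    moreover have "(\<lambda>x. - x + (- v)) ` ?A \<subseteq> frontier K" using B(1) by (auto simp: image_image)
    ultimately show ?thesis by blast
  qed
qed

end
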